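(* There exist $Q\in\mathcal{F}$ and $y_0\in L^2(\Omega)\setminus Q$ so that the following propositions are true: (i) The function $T\mapsto N(T,y_0,Q)$, $T\in\mathbb{R}^+$, is not decreasing. (ii) The set $$(\mathcal{K}N)_{y_0,Q}:=\{(M,T)\in[0,+\infty)\times(0,+\infty): M=0,\ N(T,y_0,Q)=0\}$$ is not empty, and the set $$(\mathcal{G}T)_{y_0,Q}:=\{(M,T)\in[0,+\infty)\times(0,+\infty): T=T(M,y_0,Q)\}$$ is not connected (as a subset of $\mathbb{R}^2$).
   Context: $\Omega\subset\mathbb{R}^n$ ($n\ge 1$) is a bounded open domain with $C^2$ boundary $\partial\Omega$; $\omega\subset\Omega$ is an open nonempty subset with characteristic function $\chi_\omega$ ($\Omega$ and $\omega$ are fixed); $\mathbb{R}^+=(0,+\infty)$; $\|\cdot\|$ is the norm of $L^2(\Omega)$. For $y_0\in L^2(\Omega)$ and $u\in L^\infty(\mathbb{R}^+;L^2(\Omega))$, $y(\cdot;y_0,u)$ is the solution of $\partial_t y-\Delta y=\chi_\omega u$ in $\mathbb{R}^+\times\Omega$, $y=0$ on $\mathbb{R}^+\times\partial\Omega$, $y(0)=y_0$. For $T>0$ and $v\in L^\infty(0,T;L^2(\Omega))$, $\hat y(\cdot;y_0,v)$ is the solution of the same equation on $(0,T)$ with control $v$. $\mathcal{F}$ is the set of all bounded closed convex subsets of $L^2(\Omega)$ with nonempty interior. Minimal time: for $M\ge0$, with $\mathcal{U}^M=\{u\in L^\infty(\mathbb{R}^+;L^2(\Omega)):\|u(t)\|\le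 M\text{ for a.e. }t\in\mathbb{R}^+\}$, $T(M,y_0,Q)=\inf\{\hat t\ge0:\exists u\in\mathcal{U}^M\text{ s.t. }y(\hat t;y_0,u)\in Q\}$, with $T(M,y_0,Q)=+\infty$ if this set is empty. Minimal norm: for $T>0$, $N(T,y_0,Q)=\inf\{\|v\|_{L^\infty(0,T;L^2(\Omega))}:\hat y(T;y_0,v)\in Q\}$. "Decreasing" is understood in the non-strict sense ($T\le T'$ implies $N(T',y_0,Q)\le N(T,y_0,Q)$), so (i) says that there are $0<T<T'$ with $N(T,y_0,Q)<N(T',y_0,Q)$. *)

theory Defs
  imports "HOL-Probability.Essential_Supremum"
begin

section \<open>Square-integrable functions\<close>

text \<open>Elements of $L^2(\Omega)$ are represented by functions on the whole space; only
  their values in \<open>\<Omega>\<close>, up to null sets, matter.  The quotient is not formed: everything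
  below is invariant under almost everywhere equality in \<open>\<Omega>\<close>.\<close>

definition L2 :: "'a::euclidean_space set \<Rightarrow> ('a \<Rightarrow> 'b::euclidean_space) set" where
  "L2 \<Omega> = {f. f \<in> borel_measurable (lebesgue_on \<Omega>)
              \<and> integrable (lebesgue_on \<Omega>) (\<lambda>x. (norm (f x))\<^sup>2)}"

definition L2_inner ::
    "'a::euclidean_space set \<Rightarrow> ('a \<Rightarrow> 'b::euclidean_space) \<Rightarrow> ('a \<Rightarrow> 'b) \<Rightarrow> real" where
  "L2_inner \<Omega> f g = (LINT x|lebesgue_on \<Omega>. f x \<bullet> g x)"

definition L2_norm ::
    "'a::euclidean_space set \<Rightarrow> ('a \<Rightarrow> 'b::euclidean_space) \<Rightarrow> real" where
  "L2_norm \<Omega> f = sqrt (L2_inner \<Omega> f f)"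

abbreviation L2_dist ::
    "'a::euclidean_space set \<Rightarrow> ('a \<Rightarrow> 'b::euclidean_space) \<Rightarrow> ('a \<Rightarrow> 'b) \<Rightarrow> real" where
  "L2_dist \<Omega> f g \<equiv> L2_norm \<Omega> (\<lambda>x. f x - g x)"

text \<open>The class $\mathcal{F}$ of targets.  Closedness in the seminorm forces a target to be
  a union of classes of almost everywhere equal functions, so these sets correspond
  exactly to the subsets of the quotient space.\<close>

definition L2_bounded :: "'a::euclidean_space set \<Rightarrow> ('a \<Rightarrow> real) set \<Rightarrow> bool" where
  "L2_bounded \<Omega> Q \<longleftrightarrow> (\<exists>B. \<forall>f\<in>Q. L2_norm \<Omega> f \<le> B)"

definition L2_closed :: "'a::euclidean_space set \<Rightarrow> ('a \<Rightarrow> real) set \<Rightarrow> bool" where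
  "L2_closed \<Omega> Q \<longleftrightarrow> (\<forall>f\<in>L2 \<Omega>. (\<forall>\<epsilon>>0. \<exists>g\<in>Q. L2_dist \<Omega> g f < \<epsilon>) \<longrightarrow> f \<in> Q)"

definition L2_convex :: "('a::euclidean_space \<Rightarrow> real) set \<Rightarrow> bool" where
  "L2_convex Q \<longleftrightarrow> (\<forall>f\<in>Q. \<forall>g\<in>Q. \<forall>s\<in>{0..1}. (\<lambda>x. (1 - s) * f x + s * g x) \<in> Q)"

definition L2_interior ::
    "'a::euclidean_space set \<Rightarrow> ('a \<Rightarrow> real) set \<Rightarrow> ('a \<Rightarrow> real) set" where
  "L2_interior \<Omega> Q = {f \<in> L2 \<Omega>. \<exists>r>0. \<forall>g\<in>L2 \<Omega>. L2_dist \<Omega> g f < r \<longrightarrow> g \<in> Q}"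

definition targets :: "'a::euclidean_space set \<Rightarrow> ('a \<Rightarrow> real) set set" where
  "targets \<Omega> = {Q. Q \<subseteq> L2 \<Omega> \<and> L2_bounded \<Omega> Q \<and> L2_closed \<Omega> Q \<and> L2_convex Q
                 \<and> L2_interior \<Omega> Q \<noteq> {}}"

section \<open>Functions of time with values in $L^2(\Omega)$\<close>

text \<open>Bochner (strong) measurability: almost everywhere limit of simple functions.\<close>

definition strongly_measurable ::
    "real set \<Rightarrow> 'a::euclidean_space set \<Rightarrow> (real \<Rightarrow> 'a \<Rightarrow> 'b::euclidean_space) \<Rightarrow> bool" where
  "strongly_measurable I \<Omega> u \<longleftrightarrow>
     (\<forall>t\<in>I. u t \<in> L2 \<Omega>) \<and>
     (\<exists>s :: nat \<Rightarrow> real \<Rightarrow> 'a \<Rightarrow> 'b.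
        (\<forall>k. simple_function (lebesgue_on I) (s k) \<and> (\<forall>t\<in>I. s k t \<in> L2 \<Omega>)) \<and>
        (AE t in lebesgue_on I. (\<lambda>k. L2_dist \<Omega> (s k t) (u t)) \<longlonglongrightarrow> 0))"

definition Linfty_norm ::
    "real set \<Rightarrow> 'a::euclidean_space set \<Rightarrow> (real \<Rightarrow> 'a \<Rightarrow> real) \<Rightarrow> ereal" where
  "Linfty_norm I \<Omega> u = esssup (lebesgue_on I) (\<lambda>t. ereal (L2_norm \<Omega> (u t)))"

definition Linfty_L2 ::
    "real set \<Rightarrow> 'a::euclidean_space set \<Rightarrow> (real \<Rightarrow> 'a \<Rightarrow> real) set" where
  "Linfty_L2 I \<Omega> = {u. strongly_measurable I \<Omega> u \<and> Linfty_norm I \<Omega> u < \<infinity>}"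

section \<open>Smoothness, the boundary, and $H^1_0(\Omega)$\<close>

primrec Ck :: "nat \<Rightarrow> ('a::euclidean_space \<Rightarrow> real) \<Rightarrow> bool" where
  "Ck 0 f \<longleftrightarrow> continuous_on UNIV f"
| "Ck (Suc k) f \<longleftrightarrow> (\<forall>x. f differentiable (at x)) \<and>
     (\<forall>i\<in>Basis. Ck k (\<lambda>x. frechet_derivative f (at x) i))"

text \<open>Near each boundary point, \<open>\<Omega>\<close> is the strict epigraph, in some direction \<open>e\<close>, of a
  $C^2$ function of the coordinates orthogonal to \<open>e\<close>; that function is given here as a
  function on the whole space which is invariant under translation along \<open>e\<close>.\<close>

definition C2_boundary :: "'a::euclidean_space set \<Rightarrow> bool" where
  "C2_boundary \<Omega> \<longleftrightarrow> (\<forall>p\<in>frontier \<Omega>. \<exists>r>0. \<exists>e \<gamma>. norm e = 1 \<and> Ck 2 \<gamma> \<and>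
      (\<forall>x s. \<gamma> (x + s *\<^sub>R e) = \<gamma> x) \<and>
      \<Omega> \<inter> ball p r = {x \<in> ball p r. \<gamma> x < x \<bullet> e})"

definition test_function :: "'a::euclidean_space set \<Rightarrow> ('a \<Rightarrow> real) \<Rightarrow> bool" where
  "test_function \<Omega> \<phi> \<longleftrightarrow> (\<forall>k. Ck k \<phi>) \<and>
     compact (closure {x. \<phi> x \<noteq> 0}) \<and> closure {x. \<phi> x \<noteq> 0} \<subseteq> \<Omega>"

definition grad :: "('a::euclidean_space \<Rightarrow> real) \<Rightarrow> 'a \<Rightarrow> 'a" where
  "grad \<phi> x = (\<Sum>i\<in>Basis. frechet_derivative \<phi> (at x) i *\<^sub>R i)"

text \<open>\<open>H10_gradient \<Omega> f g\<close>: \<open>f\<close> lies in $H^1_0(\Omega)$, the closure of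
  $C_c^\infty(\Omega)$ in $H^1(\Omega)$, and \<open>g\<close> is its weak gradient.\<close>

definition H10_gradient ::
    "'a::euclidean_space set \<Rightarrow> ('a \<Rightarrow> real) \<Rightarrow> ('a \<Rightarrow> 'a) \<Rightarrow> bool" where
  "H10_gradient \<Omega> f g \<longleftrightarrow> f \<in> L2 \<Omega> \<and> g \<in> L2 \<Omega> \<and>
     (\<exists>\<phi>. (\<forall>k::nat. test_function \<Omega> (\<phi> k)) \<and>
        (\<lambda>k. L2_dist \<Omega> (\<phi> k) f) \<longlonglongrightarrow> 0 \<and>
        (\<lambda>k. L2_dist \<Omega> (grad (\<phi> k)) g) \<longlonglongrightarrow> 0)"

section \<open>The controlled heat equation\<close>

text \<open>Weak solutions, in the class $C([0,T];L^2(\Omega)) \cap L^2(0,T;H^1_0(\Omega))$, of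
  $\partial_t y - \Delta y = \chi_\omega u$ in $(0,T)\times\Omega$ with \<open>y = 0\<close> on the
  lateral boundary and \<open>y(0) = y\<^sub>0\<close>.  \<open>G\<close> is the spatial gradient of \<open>y\<close>, and the weak
  form of the equation is integrated in time.\<close>

definition heat_solution ::
    "'a::euclidean_space set \<Rightarrow> 'a set \<Rightarrow> real \<Rightarrow> ('a \<Rightarrow> real) \<Rightarrow>
     (real \<Rightarrow> 'a \<Rightarrow> real) \<Rightarrow> (real \<Rightarrow> 'a \<Rightarrow> real) \<Rightarrow> bool" where
  "heat_solution \<Omega> \<omega> T y0 u y \<longleftrightarrow>
     (\<forall>t\<in>{0..T}. y t \<in> L2 \<Omega>) \<and>
     (\<forall>t\<in>{0..T}. ((\<lambda>s. L2_dist \<Omega> (y s) (y t)) \<longlongrightarrow> 0) (at t within {0..T})) \<and>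
     (AE x in lebesgue_on \<Omega>. y 0 x = y0 x) \<and>
     (\<exists>G. strongly_measurable {0<..<T} \<Omega> G \<and>
        integrable (lebesgue_on {0<..<T}) (\<lambda>t. (L2_norm \<Omega> (G t))\<^sup>2) \<and>
        (AE t in lebesgue_on {0<..<T}. H10_gradient \<Omega> (y t) (G t)) \<and>
        (\<forall>\<phi> \<psi>. H10_gradient \<Omega> \<phi> \<psi> \<longrightarrow>
           (\<forall>t\<in>{0..T}.
              L2_inner \<Omega> (y t) \<phi> - L2_inner \<Omega> y0 \<phi>
                + (LINT s|lebesgue_on {0<..<t}. L2_inner \<Omega> (G s) \<psi>)
              = (LINT s|lebesgue_on {0<..<t}. L2_inner \<Omega> (\<lambda>x. indicator \<omega> x * u s x) \<phi>))))"

definition heat_solution_global ::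
    "'a::euclidean_space set \<Rightarrow> 'a set \<Rightarrow> ('a \<Rightarrow> real) \<Rightarrow>
     (real \<Rightarrow> 'a \<Rightarrow> real) \<Rightarrow> (real \<Rightarrow> 'a \<Rightarrow> real) \<Rightarrow> bool" where
  "heat_solution_global \<Omega> \<omega> y0 u y \<longleftrightarrow> (\<forall>T>0. heat_solution \<Omega> \<omega> T y0 u y)"

section \<open>Minimal time and minimal norm\<close>

text \<open>The value of the solution at a given time is unique up to null sets, and targets are
  invariant under almost everywhere equality, so ``the solution at that time lies in \<open>Q\<close>''
  is stated as ``some solution lies in \<open>Q\<close> at that time''.  In \<^typ>\<open>ereal\<close> the infimum
  of the empty set is \<open>\<infinity>\<close>.\<close>

definition controls_bounded_by ::
    "'a::euclidean_space set \<Rightarrow> real \<Rightarrow> (real \<Rightarrow> 'a \<Rightarrow> real) set" where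
  "controls_bounded_by \<Omega> M =
     {u \<in> Linfty_L2 {0<..} \<Omega>. AE t in lebesgue_on {0<..}. L2_norm \<Omega> (u t) \<le> M}"

definition minimal_time ::
    "'a::euclidean_space set \<Rightarrow> 'a set \<Rightarrow> real \<Rightarrow> ('a \<Rightarrow> real) \<Rightarrow> ('a \<Rightarrow> real) set \<Rightarrow> ereal" where
  "minimal_time \<Omega> \<omega> M y0 Q =
     Inf {ereal t | t. 0 \<le> t \<and>
       (\<exists>u\<in>controls_bounded_by \<Omega> M. \<exists>y. heat_solution_global \<Omega> \<omega> y0 u y \<and> y t \<in> Q)}"

definition minimal_norm ::
    "'a::euclidean_space set \<Rightarrow> 'a set \<Rightarrow> real \<Rightarrow> ('a \<Rightarrow> real) \<Rightarrow> ('a \<Rightarrow> real) set \<Rightarrow> ereal" where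
  "minimal_norm \<Omega> \<omega> T y0 Q =
     Inf {Linfty_norm {0<..<T} \<Omega> v | v. v \<in> Linfty_L2 {0<..<T} \<Omega> \<and>
       (\<exists>y. heat_solution \<Omega> \<omega> T y0 v y \<and> y T \<in> Q)}"

definition KN_set ::
    "'a::euclidean_space set \<Rightarrow> 'a set \<Rightarrow> ('a \<Rightarrow> real) \<Rightarrow> ('a \<Rightarrow> real) set \<Rightarrow> (real \<times> real) set" where
  "KN_set \<Omega> \<omega> y0 Q = {(M, T). 0 \<le> M \<and> 0 < T \<and> M = 0 \<and> minimal_norm \<Omega> \<omega> T y0 Q = 0}"

definition GT_set ::
    "'a::euclidean_space set \<Rightarrow> 'a set \<Rightarrow> ('a \<Rightarrow> real) \<Rightarrow> ('a \<Rightarrow> real) set \<Rightarrow> (real \<times> real) set" where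
  "GT_set \<Omega> \<omega> y0 Q = {(M, T). 0 \<le> M \<and> 0 < T \<and> ereal T = minimal_time \<Omega> \<omega> M y0 Q}"

end

theory Submission
  imports Defs
begin

text \<open>In the coordinates given by the coefficients with respect to two Dirichlet eigenfunctions \<open>e\<^sub>1\<close>, \<open>e\<^sub>2\<close>
  with eigenvalues \<open>\<mu>\<^sub>1 < \<mu>\<^sub>2\<close>, the uncontrolled trajectory from \<open>e\<^sub>1 + e\<^sub>2\<close> is the curve
  $(e^{-\mu_1 t}, e^{-\mu_2 t})$, which is bent: the ratio of the second coordinate to the first is strictly
  decreasing.  The target is a wedge to the left of a vertical line and above an oblique one, cut off by a large ball.
  At time 1 the curve passes the corner of the wedge at a distance of order \<open>\<delta>\<close>; it then bends away below the oblique edge, and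
  between the times 2 and 3 its distance from the wedge is bounded below independently of \<open>\<delta>\<close>; it enters the wedge only near
  the origin, after time 3.  So controls of size of order \<open>\<delta>\<close> suffice to arrive at time 1, whereas an arrival between the times
  2 and 3 requires controls of a size bounded below independently of \<open>\<delta>\<close>, and later the zero control suffices.
  For small \<open>\<delta>\<close> the minimal norm is therefore larger at time 2 than at time 1, it vanishes at a later time, and the minimal
  time, as a function of the bound on the controls, jumps over the interval from 2 to 3 (\<open>GT_set_not_connected\<close>).

  The solutions that must be exhibited are finite sums of modes with explicit coefficients
  (\<open>modal_heat_solution\<close>); the control is \<open>\<partial>\<^sub>t - \<Delta>\<close> applied to a multiple of a test function \<open>\<phi>\<close>
  supported in \<open>\<omega>\<close>.  That other controls fail is seen by testing the weak form with \<open>e\<^sub>1\<close> and \<open>e\<^sub>2\<close>, which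
  leads to scalar equations with a small forcing (\<open>heat_solution_mode_estimate\<close>) and applies to every weak solution.

  The remaining work is to find the eigenfunctions, with \<open>e\<^sub>1\<close> not orthogonal to \<open>\<phi>\<close>, so that the control can
  act on it (\<open>exist_two_eigenpairs\<close>).  Eigenfunctions are minimisers of the Rayleigh quotient on orthogonal complements of earlier
  ones; compactness enters through an inequality bounding the norm by a small multiple of the gradient
  and finitely many linear functionals (\<open>H10_finite_rank_estimate\<close>), itself a consequence of an estimate for the
  translates of a test function.\<close>

section \<open>The inner product space of square-integrable functions\<close>

lemma integrable_inner_L2:
  assumes "f \<in> L2 \<Omega>" "g \<in> L2 \<Omega>"
  shows "integrable (lebesgue_on \<Omega>) (\<lambda>x. f x \<bullet> g x)"
proof -
  have [measurable]: "f \<in> borel_measurable (lebesgue_on \<Omega>)" "g \<in> borel_measurable (lebesgue_on \<Omega>)"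
    using assms by (auto simp: L2_def)
  have "integrable (lebesgue_on \<Omega>) (\<lambda>x. (norm (f x))\<^sup>2 + (norm (g x))\<^sup>2)"
    using assms by (auto simp: L2_def)
  then show ?thesis
  proof (rule Bochner_Integration.integrable_bound)
    show "AE x in lebesgue_on \<Omega>. norm (f x \<bullet> g x) \<le> norm ((norm (f x))\<^sup>2 + (norm (g x))\<^sup>2)"
    proof (intro AE_I2)
      fix x
      have "\<bar>f x \<bullet> g x\<bar> \<le> norm (f x) * norm (g x)" by (rule Cauchy_Schwarz_ineq2)
      also have "\<dots> \<le> 2 * norm (f x) * norm (g x)" by simp
      also have "\<dots> \<le> (norm (f x))\<^sup>2 + (norm (g x))\<^sup>2" by (rule sum_squares_bound)
      finally show "norm (f x \<bullet> g x) \<le> norm ((norm (f x))\<^sup>2 + (norm (g x))\<^sup>2)" by simp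
    qed
  qed measurable
qed

lemma L2_zero: "(\<lambda>x. 0) \<in> L2 \<Omega>"
  by (simp add: L2_def)

lemma L2_add:
  assumes "f \<in> L2 \<Omega>" "g \<in> L2 \<Omega>"
  shows "(\<lambda>x. f x + g x) \<in> L2 \<Omega>"
proof -
  have "integrable (lebesgue_on \<Omega>) (\<lambda>x. (norm (f x))\<^sup>2 + 2 * (f x \<bullet> g x) + (norm (g x))\<^sup>2)"
    using assms integrable_inner_L2[OF assms] by (auto simp: L2_def)
  moreover have "(\<lambda>x. (norm (f x + g x))\<^sup>2) = (\<lambda>x. (norm (f x))\<^sup>2 + 2 * (f x \<bullet> g x) + (norm (g x))\<^sup>2)"
    by (simp add: power2_norm_eq_inner algebra_simps inner_commute)
  ultimately show ?thesis
    using assms by (auto simp: L2_def)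
qed

lemma L2_scaleR: "f \<in> L2 \<Omega> \<Longrightarrow> (\<lambda>x. c *\<^sub>R f x) \<in> L2 \<Omega>"
  by (auto simp: L2_def power_mult_distrib)

lemma L2_mult: "f \<in> L2 \<Omega> \<Longrightarrow> (\<lambda>x. c * f x :: real) \<in> L2 \<Omega>"
  using L2_scaleR[of f \<Omega> c] by simp

lemma L2_uminus: "f \<in> L2 \<Omega> \<Longrightarrow> (\<lambda>x. - f x) \<in> L2 \<Omega>"
  using L2_scaleR[of f \<Omega> "-1"] by simp

lemma L2_diff: "f \<in> L2 \<Omega> \<Longrightarrow> g \<in> L2 \<Omega> \<Longrightarrow> (\<lambda>x. f x - g x) \<in> L2 \<Omega>"
  using L2_add[of f \<Omega> "\<lambda>x. - g x"] L2_uminus[of g \<Omega>] by simp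

lemma L2_sum:
  assumes "\<And>j. j \<in> J \<Longrightarrow> f j \<in> L2 \<Omega>"
  shows "(\<lambda>x. \<Sum>j\<in>J. f j x) \<in> L2 \<Omega>"
  using assms by (induction J rule: infinite_finite_induct) (auto simp: L2_zero L2_add)

lemmas L2_closed_ops = L2_zero L2_add L2_scaleR L2_mult L2_uminus L2_diff L2_sum

lemma L2_inner_commute: "L2_inner \<Omega> f g = L2_inner \<Omega> g f"
  by (simp add: L2_inner_def inner_commute)

lemma L2_inner_add_left:
  "f \<in> L2 \<Omega> \<Longrightarrow> g \<in> L2 \<Omega> \<Longrightarrow> h \<in> L2 \<Omega> \<Longrightarrow>
     L2_inner \<Omega> (\<lambda>x. f x + g x) h = L2_inner \<Omega> f h + L2_inner \<Omega> g h"
  by (simp add: L2_inner_def inner_add_left integrable_inner_L2)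

lemma L2_inner_diff_left:
  "f \<in> L2 \<Omega> \<Longrightarrow> g \<in> L2 \<Omega> \<Longrightarrow> h \<in> L2 \<Omega> \<Longrightarrow>
     L2_inner \<Omega> (\<lambda>x. f x - g x) h = L2_inner \<Omega> f h - L2_inner \<Omega> g h"
  by (simp add: L2_inner_def inner_diff_left integrable_inner_L2)

lemma L2_inner_scaleR_left: "L2_inner \<Omega> (\<lambda>x. c *\<^sub>R f x) h = c * L2_inner \<Omega> f h"
  by (simp add: L2_inner_def)

lemma L2_inner_mult_left: "L2_inner \<Omega> (\<lambda>x. c * f x) h = c * L2_inner \<Omega> f h" for f :: "_ \<Rightarrow> real"
  using L2_inner_scaleR_left[of \<Omega> c f h] by simp

lemma L2_inner_uminus_left: "L2_inner \<Omega> (\<lambda>x. - f x) h = - L2_inner \<Omega> f h"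
  by (simp add: L2_inner_def)

lemma L2_inner_zero_left: "L2_inner \<Omega> (\<lambda>x. 0) h = 0"
  by (simp add: L2_inner_def)

lemma L2_inner_sum_left:
  assumes "\<And>j. j \<in> J \<Longrightarrow> f j \<in> L2 \<Omega>" "h \<in> L2 \<Omega>"
  shows "L2_inner \<Omega> (\<lambda>x. \<Sum>j\<in>J. f j x) h = (\<Sum>j\<in>J. L2_inner \<Omega> (f j) h)"
  using assms
  by (induction J rule: infinite_finite_induct) (auto simp: L2_inner_zero_left L2_inner_add_left L2_sum)

lemma L2_inner_add_right:
  "f \<in> L2 \<Omega> \<Longrightarrow> g \<in> L2 \<Omega> \<Longrightarrow> h \<in> L2 \<Omega> \<Longrightarrow>
     L2_inner \<Omega> h (\<lambda>x. f x + g x) = L2_inner \<Omega> h f + L2_inner \<Omega> h g"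
  using L2_inner_add_left[of f \<Omega> g h] by (simp add: L2_inner_commute)

lemma L2_inner_diff_right:
  "f \<in> L2 \<Omega> \<Longrightarrow> g \<in> L2 \<Omega> \<Longrightarrow> h \<in> L2 \<Omega> \<Longrightarrow>
     L2_inner \<Omega> h (\<lambda>x. f x - g x) = L2_inner \<Omega> h f - L2_inner \<Omega> h g"
  using L2_inner_diff_left[of f \<Omega> g h] by (simp add: L2_inner_commute)

lemma L2_inner_scaleR_right: "L2_inner \<Omega> h (\<lambda>x. c *\<^sub>R f x) = c * L2_inner \<Omega> h f"
  by (simp add: L2_inner_def)

lemma L2_inner_mult_right: "L2_inner \<Omega> h (\<lambda>x. c * f x) = c * L2_inner \<Omega> h f" for f :: "_ \<Rightarrow> real"
  using L2_inner_scaleR_right[of \<Omega> h c f] by simp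

lemma L2_inner_sum_right:
  assumes "\<And>j. j \<in> J \<Longrightarrow> f j \<in> L2 \<Omega>" "h \<in> L2 \<Omega>"
  shows "L2_inner \<Omega> h (\<lambda>x. \<Sum>j\<in>J. f j x) = (\<Sum>j\<in>J. L2_inner \<Omega> h (f j))"
  using L2_inner_sum_left[OF assms] by (simp add: L2_inner_commute)

lemmas L2_inner_expand = L2_inner_add_left L2_inner_diff_left L2_inner_scaleR_left
  L2_inner_mult_left L2_inner_add_right L2_inner_diff_right
  L2_inner_scaleR_right L2_inner_mult_right

lemma L2_inner_self_nonneg: "0 \<le> L2_inner \<Omega> f f"
  by (simp add: L2_inner_def)

lemma L2_norm_nonneg: "0 \<le> L2_norm \<Omega> f"
  by (simp add: L2_norm_def L2_inner_self_nonneg)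

lemma L2_norm_power2: "(L2_norm \<Omega> f)\<^sup>2 = L2_inner \<Omega> f f"
  by (simp add: L2_norm_def L2_inner_self_nonneg)

lemma L2_norm_power2_integral: "(L2_norm \<Omega> f)\<^sup>2 = (LINT x|lebesgue_on \<Omega>. (norm (f x))\<^sup>2)"
  by (simp add: L2_norm_power2 L2_inner_def power2_norm_eq_inner)

lemma L2_norm_scaleR: "L2_norm \<Omega> (\<lambda>x. c *\<^sub>R f x) = \<bar>c\<bar> * L2_norm \<Omega> f"
  by (simp add: L2_norm_def L2_inner_scaleR_left L2_inner_scaleR_right real_sqrt_mult flip: mult.assoc)

lemma L2_norm_mult: "L2_norm \<Omega> (\<lambda>x. c * f x) = \<bar>c\<bar> * L2_norm \<Omega> f" for f :: "_ \<Rightarrow> real"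
  using L2_norm_scaleR[of \<Omega> c f] by simp

lemma L2_norm_zero: "L2_norm \<Omega> (\<lambda>x. 0) = 0"
  by (simp add: L2_norm_def L2_inner_zero_left)

lemma L2_dist_commute: "L2_dist \<Omega> f g = L2_dist \<Omega> g f"
  using L2_norm_scaleR[of \<Omega> "-1" "\<lambda>x. f x - g x"] by simp

lemma L2_norm_add_power2:
  "f \<in> L2 \<Omega> \<Longrightarrow> g \<in> L2 \<Omega> \<Longrightarrow>
    (L2_norm \<Omega> (\<lambda>x. f x + g x))\<^sup>2 = (L2_norm \<Omega> f)\<^sup>2 + 2 * L2_inner \<Omega> f g + (L2_norm \<Omega> g)\<^sup>2"
  by (simp add: L2_norm_power2 L2_inner_expand L2_closed_ops L2_inner_commute[of \<Omega> g f])

lemma L2_norm_diff_power2: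
  "f \<in> L2 \<Omega> \<Longrightarrow> g \<in> L2 \<Omega> \<Longrightarrow>
    (L2_norm \<Omega> (\<lambda>x. f x - g x))\<^sup>2 = (L2_norm \<Omega> f)\<^sup>2 - 2 * L2_inner \<Omega> f g + (L2_norm \<Omega> g)\<^sup>2"
  by (simp add: L2_norm_power2 L2_inner_expand L2_closed_ops L2_inner_commute[of \<Omega> g f])

text \<open>A quadratic that is nowhere negative has nonpositive discriminant.  With \<open>a = 0\<close> this
  also forces \<open>b = 0\<close>, which is how the Euler-Lagrange equation of a minimiser is obtained below.\<close>

lemma nonneg_quadratic_imp_discriminant:
  fixes a b c :: real
  assumes "\<And>s. 0 \<le> a + 2 * s * b + s\<^sup>2 * c" and "0 \<le> c"
  shows "b\<^sup>2 \<le> a * c"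
proof (cases "c = 0")
  case True
  have "b = 0"
  proof (rule ccontr)
    assume "b \<noteq> 0"
    then have "a + 2 * (- (a + 1) / (2 * b)) * b + (- (a + 1) / (2 * b))\<^sup>2 * c = -1"
      using True by (simp add: field_simps)
    then show False using assms(1)[of "- (a + 1) / (2 * b)"] by simp
  qed
  then show ?thesis using True by simp
next
  case False
  then have "a + 2 * (- b / c) * b + (- b / c)\<^sup>2 * c = a - b\<^sup>2 / c"
    by (simp add: field_simps power2_eq_square)
  then have "0 \<le> a - b\<^sup>2 / c" using assms(1)[of "- b / c"] by simp
  then show ?thesis using False assms(2) by (simp add: field_simps)
qed

lemma L2_Cauchy_Schwarz:
  assumes "f \<in> L2 \<Omega>" "g \<in> L2 \<Omega>"
  shows "\<bar>L2_inner \<Omega> f g\<bar> \<le> L2_norm \<Omega> f * L2_norm \<Omega> g"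
proof -
  have "(L2_inner \<Omega> f g)\<^sup>2 \<le> (L2_norm \<Omega> f)\<^sup>2 * (L2_norm \<Omega> g)\<^sup>2"
  proof (rule nonneg_quadratic_imp_discriminant)
    fix s
    have "0 \<le> (L2_norm \<Omega> (\<lambda>x. f x + s *\<^sub>R g x))\<^sup>2" by simp
    also have "\<dots> = (L2_norm \<Omega> f)\<^sup>2 + 2 * s * L2_inner \<Omega> f g + s\<^sup>2 * (L2_norm \<Omega> g)\<^sup>2"
      using assms by (simp add: L2_norm_add_power2 L2_closed_ops L2_inner_expand L2_norm_scaleR power_mult_distrib)
    finally show "0 \<le> (L2_norm \<Omega> f)\<^sup>2 + 2 * s * L2_inner \<Omega> f g + s\<^sup>2 * (L2_norm \<Omega> g)\<^sup>2" .
  qed simp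
  then have "\<bar>L2_inner \<Omega> f g\<bar>\<^sup>2 \<le> (L2_norm \<Omega> f * L2_norm \<Omega> g)\<^sup>2"
    by (simp add: power_mult_distrib)
  then show ?thesis
    by (rule power2_le_imp_le) (simp add: L2_norm_nonneg)
qed

lemma L2_norm_triangle:
  assumes "f \<in> L2 \<Omega>" "g \<in> L2 \<Omega>"
  shows "L2_norm \<Omega> (\<lambda>x. f x + g x) \<le> L2_norm \<Omega> f + L2_norm \<Omega> g"
proof -
  have "(L2_norm \<Omega> (\<lambda>x. f x + g x))\<^sup>2 \<le> (L2_norm \<Omega> f + L2_norm \<Omega> g)\<^sup>2"
    using L2_Cauchy_Schwarz[OF assms] by (simp add: L2_norm_add_power2[OF assms] power2_sum)
  then show ?thesis
    by (rule power2_le_imp_le) (simp add: L2_norm_nonneg)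
qed

lemma L2_dist_triangle:
  assumes "f \<in> L2 \<Omega>" "g \<in> L2 \<Omega>" "h \<in> L2 \<Omega>"
  shows "L2_dist \<Omega> f h \<le> L2_dist \<Omega> f g + L2_dist \<Omega> g h"
  using L2_norm_triangle[OF L2_diff[OF assms(1,2)] L2_diff[OF assms(2,3)]] by simp

lemma L2_norm_diff_ineq:
  assumes "f \<in> L2 \<Omega>" "g \<in> L2 \<Omega>"
  shows "\<bar>L2_norm \<Omega> f - L2_norm \<Omega> g\<bar> \<le> L2_dist \<Omega> f g"
  using L2_norm_triangle[OF L2_diff[OF assms] assms(2)] L2_norm_triangle[OF L2_diff[OF assms(2,1)] assms(1)]
    L2_dist_commute[of \<Omega> f g] by simp

lemma L2_norm_sum_scaleR_le:
  assumes "\<And>j. j \<in> J \<Longrightarrow> f j \<in> L2 \<Omega>"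
  shows "L2_norm \<Omega> (\<lambda>x. \<Sum>j\<in>J. c j *\<^sub>R f j x) \<le> (\<Sum>j\<in>J. \<bar>c j\<bar> * L2_norm \<Omega> (f j))"
  using assms
proof (induction J rule: infinite_finite_induct)
  case (insert j J)
  have "L2_norm \<Omega> (\<lambda>x. \<Sum>j\<in>insert j J. c j *\<^sub>R f j x)
      = L2_norm \<Omega> (\<lambda>x. c j *\<^sub>R f j x + (\<Sum>j\<in>J. c j *\<^sub>R f j x))"
    using insert by simp
  also have "\<dots> \<le> L2_norm \<Omega> (\<lambda>x. c j *\<^sub>R f j x) + L2_norm \<Omega> (\<lambda>x. \<Sum>j\<in>J. c j *\<^sub>R f j x)"
    using insert by (intro L2_norm_triangle L2_closed_ops) auto
  also have "\<dots> \<le> (\<Sum>j\<in>insert j J. \<bar>c j\<bar> * L2_norm \<Omega> (f j))"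
    using insert by (auto simp: L2_norm_scaleR)
  finally show ?case .
qed (auto simp: L2_norm_zero)

lemma L2_inner_tendsto:
  assumes "\<And>k. f k \<in> L2 \<Omega>" "f' \<in> L2 \<Omega>" "h \<in> L2 \<Omega>"
    and "((\<lambda>k. L2_dist \<Omega> (f k) f') \<longlongrightarrow> 0) F"
  shows "((\<lambda>k. L2_inner \<Omega> (f k) h) \<longlongrightarrow> L2_inner \<Omega> f' h) F"
proof (rule Lim_transform2[OF tendsto_const])
  show "((\<lambda>k. L2_inner \<Omega> f' h - L2_inner \<Omega> (f k) h) \<longlongrightarrow> 0) F"
  proof (rule Lim_null_comparison)
    show "\<forall>\<^sub>F k in F. norm (L2_inner \<Omega> f' h - L2_inner \<Omega> (f k) h) \<le> L2_dist \<Omega> (f k) f' * L2_norm \<Omega> h"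
    proof (rule always_eventually, rule allI)
      fix k
      have "L2_inner \<Omega> f' h - L2_inner \<Omega> (f k) h = - L2_inner \<Omega> (\<lambda>x. f k x - f' x) h"
        using assms by (simp add: L2_inner_expand)
      then show "norm (L2_inner \<Omega> f' h - L2_inner \<Omega> (f k) h) \<le> L2_dist \<Omega> (f k) f' * L2_norm \<Omega> h"
        using L2_Cauchy_Schwarz[of "\<lambda>x. f k x - f' x" \<Omega> h] assms by (simp add: L2_closed_ops)
    qed
    show "((\<lambda>k. L2_dist \<Omega> (f k) f' * L2_norm \<Omega> h) \<longlongrightarrow> 0) F"
      using tendsto_mult_right[OF assms(4), of "L2_norm \<Omega> h"] by simp
  qed
qed

lemma L2_norm_tendsto:
  assumes "\<And>k. f k \<in> L2 \<Omega>" "f' \<in> L2 \<Omega>"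
    and "((\<lambda>k. L2_dist \<Omega> (f k) f') \<longlongrightarrow> 0) F"
  shows "((\<lambda>k. L2_norm \<Omega> (f k)) \<longlongrightarrow> L2_norm \<Omega> f') F"
proof (rule Lim_transform2[OF tendsto_const])
  show "((\<lambda>k. L2_norm \<Omega> f' - L2_norm \<Omega> (f k)) \<longlongrightarrow> 0) F"
    by (rule Lim_null_comparison[OF _ assms(3)])
       (use L2_norm_diff_ineq[OF assms(1,2)] in \<open>auto simp: abs_minus_commute intro!: always_eventually\<close>)
qed

lemma L2_dist_scaleR_add_tendsto:
  assumes "\<And>k. f k \<in> L2 \<Omega>" "f' \<in> L2 \<Omega>" "\<And>k. g k \<in> L2 \<Omega>" "g' \<in> L2 \<Omega>"
    and "((\<lambda>k. L2_dist \<Omega> (f k) f') \<longlongrightarrow> 0) F" "((\<lambda>k. L2_dist \<Omega> (g k) g') \<longlongrightarrow> 0) F"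
  shows "((\<lambda>k. L2_dist \<Omega> (\<lambda>x. f k x + c *\<^sub>R g k x) (\<lambda>x. f' x + c *\<^sub>R g' x)) \<longlongrightarrow> 0) F"
proof (rule Lim_null_comparison)
  show "((\<lambda>k. L2_dist \<Omega> (f k) f' + \<bar>c\<bar> * L2_dist \<Omega> (g k) g') \<longlongrightarrow> 0) F"
    using tendsto_add[OF assms(5) tendsto_mult_left[OF assms(6), of "\<bar>c\<bar>"]] by simp
  show "\<forall>\<^sub>F k in F. norm (L2_dist \<Omega> (\<lambda>x. f k x + c *\<^sub>R g k x) (\<lambda>x. f' x + c *\<^sub>R g' x))
      \<le> L2_dist \<Omega> (f k) f' + \<bar>c\<bar> * L2_dist \<Omega> (g k) g'"
  proof (rule always_eventually, rule allI)
    fix k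
    have "L2_dist \<Omega> (\<lambda>x. f k x + c *\<^sub>R g k x) (\<lambda>x. f' x + c *\<^sub>R g' x)
        = L2_norm \<Omega> (\<lambda>x. (f k x - f' x) + c *\<^sub>R (g k x - g' x))"
      by (simp add: algebra_simps)
    also have "\<dots> \<le> L2_dist \<Omega> (f k) f' + L2_norm \<Omega> (\<lambda>x. c *\<^sub>R (g k x - g' x))"
      using assms by (intro L2_norm_triangle L2_closed_ops) auto
    finally show "norm (L2_dist \<Omega> (\<lambda>x. f k x + c *\<^sub>R g k x) (\<lambda>x. f' x + c *\<^sub>R g' x))
      \<le> L2_dist \<Omega> (f k) f' + \<bar>c\<bar> * L2_dist \<Omega> (g k) g'"
      by (simp add: L2_norm_nonneg L2_norm_scaleR)
  qed
qed

section \<open>Completeness of $L^2(\Omega)$\<close>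

lemma nn_integral_norm_power2:
  assumes "f \<in> L2 \<Omega>"
  shows "(\<integral>\<^sup>+x. ennreal ((norm (f x))\<^sup>2) \<partial>lebesgue_on \<Omega>) = ennreal ((L2_norm \<Omega> f)\<^sup>2)"
  using assms by (subst nn_integral_eq_integral) (auto simp: L2_def L2_norm_power2_integral)

lemma L2_if_nn_integral_le:
  assumes "f \<in> borel_measurable (lebesgue_on \<Omega>)"
    and "(\<integral>\<^sup>+x. ennreal ((norm (f x))\<^sup>2) \<partial>lebesgue_on \<Omega>) \<le> ennreal (B\<^sup>2)" and "0 \<le> B"
  shows "f \<in> L2 \<Omega>" "L2_norm \<Omega> f \<le> B"
proof -
  have "integrable (lebesgue_on \<Omega>) (\<lambda>x. (norm (f x))\<^sup>2)"
    using assms(1,2) by (intro integrableI_bounded) (auto intro: le_less_trans[OF _ ennreal_less_top])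
  then show f: "f \<in> L2 \<Omega>" using assms(1) by (simp add: L2_def)
  have "ennreal ((L2_norm \<Omega> f)\<^sup>2) \<le> ennreal (B\<^sup>2)"
    using assms(2) by (simp add: nn_integral_norm_power2[OF f])
  then show "L2_norm \<Omega> f \<le> B"
    using assms(3) by (auto intro: power2_le_imp_le)
qed

lemma nn_integral_norm_le_L2_norm:
  assumes "f \<in> L2 \<Omega>" "emeasure (lebesgue_on \<Omega>) (space (lebesgue_on \<Omega>)) < \<infinity>"
  shows "(\<integral>\<^sup>+x. ennreal (norm (f x)) \<partial>lebesgue_on \<Omega>)
      \<le> ennreal (L2_norm \<Omega> f * sqrt (measure (lebesgue_on \<Omega>) (space (lebesgue_on \<Omega>))))"
proof -
  have c: "(\<lambda>x. 1::real) \<in> L2 \<Omega>"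
    using assms(2) by (auto simp: L2_def intro!: finite_measure.integrable_const finite_measureI)
  have n: "(\<lambda>x. norm (f x)) \<in> L2 \<Omega>"
    using assms(1) by (auto simp: L2_def)
  have i: "integrable (lebesgue_on \<Omega>) (\<lambda>x. norm (f x))"
    using integrable_inner_L2[OF n c] by simp
  have e: "L2_norm \<Omega> (\<lambda>x. norm (f x)) = L2_norm \<Omega> f"
    by (simp add: L2_norm_def L2_inner_def power2_norm_eq_inner flip: power2_eq_square)
  have o: "L2_norm \<Omega> (\<lambda>x. 1::real) = sqrt (measure (lebesgue_on \<Omega>) (space (lebesgue_on \<Omega>)))"
    by (simp add: L2_norm_def L2_inner_def)
  have "(LINT x|lebesgue_on \<Omega>. norm (f x)) = L2_inner \<Omega> (\<lambda>x. norm (f x)) (\<lambda>x. 1)"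
    by (simp add: L2_inner_def)
  also have "\<dots> \<le> L2_norm \<Omega> f * sqrt (measure (lebesgue_on \<Omega>) (space (lebesgue_on \<Omega>)))"
    using L2_Cauchy_Schwarz[OF n c] by (simp only: e o)
  finally show ?thesis
    using i by (subst nn_integral_eq_integral) (auto intro: ennreal_leI)
qed

text \<open>The Riesz-Fischer argument.  Along a subsequence the increments have norms at most
  $2^{-j}$; on a space of finite measure they are then summable in $L^1$, hence pointwise almost
  everywhere, and Fatou's lemma upgrades the pointwise limit to a limit in norm.\<close>

theorem L2_complete:
  fixes f :: "nat \<Rightarrow> 'a::euclidean_space \<Rightarrow> 'b::euclidean_space"
  assumes fin: "emeasure (lebesgue_on \<Omega>) (space (lebesgue_on \<Omega>)) < \<infinity>"
    and f: "\<And>k. f k \<in> L2 \<Omega>"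
    and cauchy: "\<And>\<epsilon>. \<epsilon> > 0 \<Longrightarrow> \<exists>K. \<forall>m\<ge>K. \<forall>n\<ge>K. L2_dist \<Omega> (f m) (f n) < \<epsilon>"
  shows "\<exists>g\<in>L2 \<Omega>. (\<lambda>k. L2_dist \<Omega> (f k) g) \<longlonglongrightarrow> 0"
proof -
  let ?M = "lebesgue_on \<Omega>"
  have [measurable]: "f k \<in> borel_measurable ?M" for k
    using f by (auto simp: L2_def)
  obtain K where K: "\<And>j m n. K j \<le> m \<Longrightarrow> K j \<le> n \<Longrightarrow> L2_dist \<Omega> (f m) (f n) < (1/2)^j"
    using cauchy[of "(1/2)^_"] by (metis zero_less_power half_gt_zero_iff zero_less_one)
  \<comment> \<open>Partial sums make the indices nondecreasing while keeping \<open>K j \<le> r j\<close> and \<open>j \<le> r j\<close>.\<close>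
  define r where "r = (\<lambda>j. \<Sum>i\<le>j. K i + i)"
  have rK: "K j \<le> r j" for j
    unfolding r_def by (rule order_trans[OF _ member_le_sum[of j]]) auto
  have rj: "j \<le> r j" for j
    unfolding r_def by (rule order_trans[OF _ member_le_sum[of j]]) auto
  have rm: "r j \<le> r (Suc j)" for j
    unfolding r_def by simp
  define d where "d = (\<lambda>j x. f (r (Suc j)) x - f (r j) x)"
  have d: "d j \<in> L2 \<Omega>" for j unfolding d_def by (intro L2_diff f)
  have [measurable]: "d j \<in> borel_measurable ?M" for j
    using d by (auto simp: L2_def)
  have dn: "L2_norm \<Omega> (d j) \<le> (1/2)^j" for j
    unfolding d_def using K[of j "r (Suc j)" "r j"] rK[of j] rm[of j] by force
  define V where "V = sqrt (measure ?M (space ?M))"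
  have "0 \<le> V" by (simp add: V_def)
  have "(\<integral>\<^sup>+x. (\<Sum>j. ennreal (norm (d j x))) \<partial>?M) = (\<Sum>j. \<integral>\<^sup>+x. ennreal (norm (d j x)) \<partial>?M)"
    by (rule nn_integral_suminf) measurable
  also have "\<dots> \<le> (\<Sum>j. ennreal ((1/2)^j * V))"
  proof (rule suminf_le)
    fix j
    show "(\<integral>\<^sup>+x. ennreal (norm (d j x)) \<partial>?M) \<le> ennreal ((1/2)^j * V)"
      using nn_integral_norm_le_L2_norm[OF d fin, of j] dn[of j] \<open>0 \<le> V\<close>
      unfolding V_def[symmetric] by (meson ennreal_leI mult_right_mono order_trans)
  qed auto
  also have "\<dots> = ennreal (\<Sum>j. (1/2)^j * V)"
    using \<open>0 \<le> V\<close> by (intro suminf_ennreal2) (auto intro!: summable_mult2 summable_geometric)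
  also have "\<dots> < \<infinity>" by simp
  finally have "AE x in ?M. (\<Sum>j. ennreal (norm (d j x))) \<noteq> \<infinity>"
    by (intro nn_integral_PInf_AE) auto
  then have ae: "AE x in ?M. convergent (\<lambda>j. f (r j) x)"
  proof (rule AE_mp, intro AE_I2 impI)
    fix x assume "(\<Sum>j. ennreal (norm (d j x))) \<noteq> \<infinity>"
    then have "summable (\<lambda>j. norm (d j x))"
      by (intro summable_suminf_not_top) auto
    then have "summable (\<lambda>j. d j x)" by (rule summable_norm_cancel)
    then have "convergent (\<lambda>n. \<Sum>j<n. d j x)" by (simp add: summable_iff_convergent)
    moreover have "(\<Sum>j<n. d j x) = f (r n) x - f (r 0) x" for n
      by (induction n) (auto simp: d_def)
    ultimately have "convergent (\<lambda>n. (f (r n) x - f (r 0) x) + f (r 0) x)"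
      by (intro convergent_add) (auto simp: convergent_const)
    then show "convergent (\<lambda>n. f (r n) x)" by simp
  qed
  define g where "g = (\<lambda>x. lim (\<lambda>j. f (r j) x))"
  have gm [measurable]: "g \<in> borel_measurable ?M"
    unfolding g_def by (rule borel_measurable_lim_metric) measurable
  have aeg: "AE x in ?M. (\<lambda>j. f (r j) x) \<longlonglongrightarrow> g x"
    using ae by eventually_elim (auto simp: g_def convergent_LIMSEQ_iff)
  \<comment> \<open>Fatou along the subsequence, with the first index \<open>n\<close> fixed.\<close>
  have near: "(\<lambda>x. f n x - g x) \<in> L2 \<Omega> \<and> L2_dist \<Omega> (f n) g \<le> (1/2)^j" if "K j \<le> n" for n j
  proof -
    have "(\<integral>\<^sup>+x. ennreal ((norm (f n x - g x))\<^sup>2) \<partial>?M)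
        = (\<integral>\<^sup>+x. liminf (\<lambda>k. ennreal ((norm (f n x - f (r k) x))\<^sup>2)) \<partial>?M)"
    proof (rule nn_integral_cong_AE, use aeg in eventually_elim)
      fix x assume "(\<lambda>j. f (r j) x) \<longlonglongrightarrow> g x"
      then have "(\<lambda>k. ennreal ((norm (f n x - f (r k) x))\<^sup>2)) \<longlonglongrightarrow> ennreal ((norm (f n x - g x))\<^sup>2)"
        by (intro tendsto_intros)
      then show "ennreal ((norm (f n x - g x))\<^sup>2) = liminf (\<lambda>k. ennreal ((norm (f n x - f (r k) x))\<^sup>2))"
        by (rule lim_imp_Liminf[OF trivial_limit_sequentially, symmetric])
    qed
    also have "\<dots> \<le> liminf (\<lambda>k. \<integral>\<^sup>+x. ennreal ((norm (f n x - f (r k) x))\<^sup>2) \<partial>?M)"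
      by (rule nn_integral_liminf) measurable
    also have "\<dots> \<le> limsup (\<lambda>k. \<integral>\<^sup>+x. ennreal ((norm (f n x - f (r k) x))\<^sup>2) \<partial>?M)"
      by (rule Liminf_le_Limsup) simp
    also have "\<dots> \<le> ennreal (((1/2)^j)\<^sup>2)"
    proof (rule Limsup_bounded, rule eventually_sequentiallyI[of "K j"])
      fix k assume "K j \<le> k"
      then have "K j \<le> r k" using rj[of k] by simp
      then have "L2_dist \<Omega> (f n) (f (r k)) \<le> (1/2)^j" using K[of j n "r k"] that by force
      then show "(\<integral>\<^sup>+x. ennreal ((norm (f n x - f (r k) x))\<^sup>2) \<partial>?M) \<le> ennreal (((1/2)^j)\<^sup>2)"
        by (subst nn_integral_norm_power2[OF L2_diff[OF f f]]) (auto intro!: ennreal_leI power_mono simp: L2_norm_nonneg)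
    qed
    finally show ?thesis
      using L2_if_nn_integral_le[of "\<lambda>x. f n x - g x" \<Omega> "(1/2)^j"] by auto
  qed
  have "(\<lambda>x. f (K 0) x - (f (K 0) x - g x)) \<in> L2 \<Omega>"
    using near[of 0 "K 0"] by (intro L2_diff[of "f (K 0)" \<Omega> "\<lambda>x. f (K 0) x - g x"] f) auto
  then have "g \<in> L2 \<Omega>" by simp
  moreover have "(\<lambda>k. L2_dist \<Omega> (f k) g) \<longlonglongrightarrow> 0"
  proof (rule LIMSEQ_I)
    fix e :: real assume "0 < e"
    then obtain j where j: "(1/2)^j < e"
      using real_arch_pow_inv[of e "1/2"] by auto
    show "\<exists>no. \<forall>n\<ge>no. norm (L2_dist \<Omega> (f n) g - 0) < e"
    proof (intro exI[of _ "K j"] allI impI)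
      fix n assume "K j \<le> n"
      from near[OF this] j show "norm (L2_dist \<Omega> (f n) g - 0) < e"
        by (simp add: L2_norm_nonneg)
    qed
  qed
  ultimately show ?thesis by blast
qed

section \<open>Smooth functions and test functions\<close>

lemma Ck_SucI:
  assumes "\<And>x. (f has_derivative D x) (at x)" "\<And>i. i \<in> Basis \<Longrightarrow> Ck k (\<lambda>x. D x i)"
  shows "Ck (Suc k) f"
proof -
  have "frechet_derivative f (at x) = D x" for x
    using assms(1) by (metis frechet_derivative_at)
  then show ?thesis using assms by (auto simp: differentiable_def)
qed

lemma Ck_Suc_has_derivative:
  "Ck (Suc k) f \<Longrightarrow> (f has_derivative frechet_derivative f (at x)) (at x)"
  by (simp add: frechet_derivative_works)

lemma Ck_Suc_imp_Ck: "Ck (Suc k) f \<Longrightarrow> Ck k f"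
proof (induction k arbitrary: f)
  case 0
  then show ?case
    by (auto simp: differentiable_on_def differentiable_at_withinI intro!: differentiable_imp_continuous_on)
next
  case (Suc k)
  then show ?case by (simp only: Ck.simps) blast
qed

lemma Ck_imp_continuous: "Ck k f \<Longrightarrow> continuous_on UNIV f"
  by (induction k) (use Ck_Suc_imp_Ck in auto)

lemma Ck_const: "Ck k (\<lambda>x. c)"
proof (induction k arbitrary: c)
  case (Suc k)
  show ?case by (rule Ck_SucI[where D = "\<lambda>x h. 0"]) (auto intro: Suc)
qed simp

lemma Ck_add: "Ck k f \<Longrightarrow> Ck k g \<Longrightarrow> Ck k (\<lambda>x. f x + g x)"
proof (induction k arbitrary: f g)
  case 0 then show ?case by (auto intro: continuous_intros)
next
  case (Suc k)
  show ?case
  proof (rule Ck_SucI)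
    show "((\<lambda>x. f x + g x) has_derivative
        (\<lambda>h. frechet_derivative f (at x) h + frechet_derivative g (at x) h)) (at x)" for x
      using Suc.prems by (intro has_derivative_add Ck_Suc_has_derivative)
    show "Ck k (\<lambda>x. frechet_derivative f (at x) i + frechet_derivative g (at x) i)" if "i \<in> Basis" for i
      using Suc.prems that by (intro Suc.IH) auto
  qed
qed

lemma Ck_mult: "Ck k f \<Longrightarrow> Ck k g \<Longrightarrow> Ck k (\<lambda>x. f x * g x)"
proof (induction k arbitrary: f g)
  case 0 then show ?case by (auto intro: continuous_intros)
next
  case (Suc k)
  show ?case
  proof (rule Ck_SucI)
    show "((\<lambda>x. f x * g x) has_derivative
        (\<lambda>h. f x * frechet_derivative g (at x) h + frechet_derivative f (at x) h * g x)) (at x)" for x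
      using Suc.prems by (intro has_derivative_mult Ck_Suc_has_derivative)
    show "Ck k (\<lambda>x. f x * frechet_derivative g (at x) i + frechet_derivative f (at x) i * g x)"
      if "i \<in> Basis" for i
      using Suc.prems that by (intro Ck_add Suc.IH Ck_Suc_imp_Ck[of k f] Ck_Suc_imp_Ck[of k g]) auto
  qed
qed

lemma Ck_inner_const: "Ck k (\<lambda>x. (x - p) \<bullet> i)"
proof (cases k)
  case (Suc n)
  show ?thesis unfolding Suc
    by (rule Ck_SucI[where D = "\<lambda>x h. h \<bullet> i"]) (auto intro!: derivative_eq_intros Ck_const)
qed (auto intro!: continuous_intros)

text \<open>The functions $t^{-n} e^{-1/t}$, extended by zero to $t \le 0$.  The classical smooth function
  $e^{-1/t}$ is the case \<open>n = 0\<close>; the whole family is needed because its span is closed under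
  differentiation, which makes smoothness an induction on the order.\<close>

definition exp_recip :: "nat \<Rightarrow> real \<Rightarrow> real" where
  "exp_recip n t = (if t \<le> 0 then 0 else (1 / t) ^ n * exp (- (1 / t)))"

lemma exp_recip_tendsto_0: "(exp_recip n \<longlongrightarrow> 0) (at 0)"
proof (rule filterlim_split_at)
  have "eventually (\<lambda>t. exp_recip n t = 0) (at_left 0)"
    by (auto simp: eventually_at_filter exp_recip_def)
  then show "(exp_recip n \<longlongrightarrow> 0) (at_left 0)"
    by (rule tendsto_eventually)
  have "((\<lambda>t. inverse t ^ n / exp (inverse t)) \<longlongrightarrow> 0) (at_right (0::real))"
    by (rule filterlim_compose[OF tendsto_power_div_exp_0 filterlim_inverse_at_top_right])
  then show "(exp_recip n \<longlongrightarrow> 0) (at_right 0)"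
  proof (rule Lim_transform_eventually)
    show "eventually (\<lambda>t. inverse t ^ n / exp (inverse t) = exp_recip n t) (at_right 0)"
      by (auto simp: eventually_at_filter exp_recip_def inverse_eq_divide exp_minus divide_simps)
  qed
qed

lemma exp_recip_has_derivative:
  "(exp_recip n has_real_derivative (exp_recip (n + 2) t - n * exp_recip (n + 1) t)) (at t)"
proof -
  consider "t < 0" | "t = 0" | "0 < t" by linarith
  then show ?thesis
  proof cases
    case 1
    show ?thesis
    proof (rule has_field_derivative_transform_within_open[where f = "\<lambda>_. 0" and S = "{..<0}"])
      show "((\<lambda>_. 0) has_real_derivative (exp_recip (n + 2) t - n * exp_recip (n + 1) t)) (at t)"
        using 1 by (simp add: exp_recip_def)
    qed (use 1 in \<open>auto simp: exp_recip_def\<close>)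
  next
    case 2
    have "((\<lambda>h. (exp_recip n (0 + h) - exp_recip n 0) / h) \<longlongrightarrow> 0) (at 0)"
    proof (rule Lim_transform_eventually[OF exp_recip_tendsto_0[of "Suc n"]])
      show "eventually (\<lambda>h. exp_recip (Suc n) h = (exp_recip n (0 + h) - exp_recip n 0) / h) (at 0)"
        by (auto simp: eventually_at_filter exp_recip_def)
    qed
    then show ?thesis using 2 by (simp add: DERIV_def exp_recip_def)
  next
    case 3
    have inv: "((\<lambda>t. 1 / t) has_real_derivative - ((1 / t)\<^sup>2)) (at t)"
      using 3 by (auto intro!: derivative_eq_intros simp: power2_eq_square)
    have pow: "((\<lambda>t. (1 / t) ^ n) has_real_derivative - (n * (1 / t) ^ Suc n)) (at t)"
      by (rule DERIV_cong[OF DERIV_power[OF inv]]) (cases n; simp only: diff_Suc_Suc diff_zero; simp add: power_Suc power2_eq_square)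
    have ex: "((\<lambda>t. exp (- (1 / t))) has_real_derivative exp (- (1 / t)) * (1 / t)\<^sup>2) (at t)"
      using DERIV_fun_exp[OF DERIV_minus[OF inv]] by simp
    show ?thesis
    proof (rule has_field_derivative_transform_within_open
        [where f = "\<lambda>t. (1 / t) ^ n * exp (- (1 / t))" and S = "{0<..}"])
      have "- (n * s ^ Suc n) * e + e * s\<^sup>2 * s ^ n = s ^ (n + 2) * e - n * (s ^ (n + 1) * e)" for s e :: real
        by (simp add: algebra_simps power2_eq_square)
      from this[of "1 / t" "exp (- (1 / t))"]
      have "- (n * (1 / t) ^ Suc n) * exp (- (1 / t)) + exp (- (1 / t)) * (1 / t)\<^sup>2 * (1 / t) ^ n
          = exp_recip (n + 2) t - n * exp_recip (n + 1) t"
        unfolding exp_recip_def using 3 by (simp only: not_le[symmetric] if_False)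
      then show "((\<lambda>t. (1 / t) ^ n * exp (- (1 / t))) has_real_derivative
              (exp_recip (n + 2) t - n * exp_recip (n + 1) t)) (at t)"
        by (rule DERIV_cong[OF DERIV_mult[OF pow ex]])
    qed (use 3 in \<open>auto simp: exp_recip_def\<close>)
  qed
qed

text \<open>Every partial derivative is a combination of members of the same family, with different \<open>n\<close>,
  multiplied by affine functions.\<close>

lemma Ck_exp_recip_ball: "Ck k (\<lambda>x. exp_recip n (r\<^sup>2 - (x - p) \<bullet> (x - p)))"
proof (induction k arbitrary: n)
  case 0
  have "continuous_on UNIV (exp_recip n)"
    using exp_recip_has_derivative by (intro DERIV_continuous_on) (auto intro: has_field_derivative_at_within)
  then show ?case
    by (auto intro!: continuous_intros continuous_on_compose2[of UNIV "exp_recip n"])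
next
  case (Suc k)
  define c where "c = (\<lambda>n x. exp_recip n (r\<^sup>2 - (x - p) \<bullet> (x - p)))"
  define D where "D = (\<lambda>x h. (c (n + 2) x + (- real n) * c (n + 1) x) * ((-2) * ((x - p) \<bullet> h)))"
  show ?case
  proof (rule Ck_SucI)
    fix x
    have "((\<lambda>x. exp_recip n (r\<^sup>2 - (x - p) \<bullet> (x - p))) has_derivative
        (\<lambda>h. (0 - ((x - p) \<bullet> (h - 0) + (h - 0) \<bullet> (x - p))) * (exp_recip (n + 2) (r\<^sup>2 - (x - p) \<bullet> (x - p))
           - n * exp_recip (n + 1) (r\<^sup>2 - (x - p) \<bullet> (x - p))))) (at x)"
      by (rule DERIV_compose_FDERIV[OF exp_recip_has_derivative]) (intro derivative_intros)
    moreover have "(\<lambda>h. (0 - ((x - p) \<bullet> (h - 0) + (h - 0) \<bullet> (x - p))) * (exp_recip (n + 2) (r\<^sup>2 - (x - p) \<bullet> (x - p))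
           - n * exp_recip (n + 1) (r\<^sup>2 - (x - p) \<bullet> (x - p)))) = D x"
      by (rule ext) (simp add: D_def c_def inner_commute algebra_simps)
    ultimately show "((\<lambda>x. exp_recip n (r\<^sup>2 - (x - p) \<bullet> (x - p))) has_derivative D x) (at x)"
      by simp
  next
    show "Ck k (\<lambda>x. D x i)" for i
      unfolding D_def c_def by (intro Ck_mult Ck_add Ck_const Ck_inner_const Suc)
  qed
qed

lemma exists_smooth_bump:
  fixes p :: "'a::euclidean_space"
  assumes "0 < r"
  shows "\<exists>\<phi>. (\<forall>k. Ck k \<phi>) \<and> {x. \<phi> x \<noteq> 0} = ball p r"
proof (intro exI conjI allI)
  show "Ck k (\<lambda>x. exp_recip 0 (r\<^sup>2 - (x - p) \<bullet> (x - p)))" for k by (rule Ck_exp_recip_ball)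
  have "exp_recip 0 (r\<^sup>2 - (x - p) \<bullet> (x - p)) \<noteq> 0 \<longleftrightarrow> x \<in> ball p r" for x
  proof -
    have "(x - p) \<bullet> (x - p) = (dist p x)\<^sup>2"
      by (simp only: dist_norm norm_minus_commute[of p x] power2_norm_eq_inner)
    moreover have "dist p x < r \<longleftrightarrow> (dist p x)\<^sup>2 < r\<^sup>2"
      using assms by (auto intro: power_strict_mono power_less_imp_less_base)
    ultimately show ?thesis by (simp add: exp_recip_def not_le)
  qed
  then show "{x. exp_recip 0 (r\<^sup>2 - (x - p) \<bullet> (x - p)) \<noteq> 0} = ball p r"
    by (intro equalityI subsetI) simp_all
qed

lemma test_function_bump:
  fixes p :: "'a::euclidean_space"
  assumes "0 < r" "cball p r \<subseteq> \<Omega>"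
  shows "\<exists>\<phi>. test_function \<Omega> \<phi> \<and> {x. \<phi> x \<noteq> 0} = ball p r"
proof -
  obtain \<phi> where \<phi>: "\<forall>k. Ck k \<phi>" "{x. \<phi> x \<noteq> 0} = ball p r"
    using exists_smooth_bump[OF assms(1), of p] by (elim exE conjE)
  have "closure {x. \<phi> x \<noteq> 0} = cball p r"
    unfolding \<phi>(2) using assms(1) by (rule closure_ball)
  then have "test_function \<Omega> \<phi>"
    unfolding test_function_def using \<phi>(1) assms(2) by (simp only: compact_cball simp_thms)
  then show ?thesis using \<phi>(2) by (intro exI conjI)
qed

lemma test_function_Ck: "test_function \<Omega> \<phi> \<Longrightarrow> Ck k \<phi>"
  unfolding test_function_def by (elim conjE allE[of _ k])

lemma test_function_support_compact: "test_function \<Omega> \<phi> \<Longrightarrow> compact (closure {x. \<phi> x \<noteq> 0})"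
  unfolding test_function_def by (elim conjE)

lemma test_function_support_subset: "test_function \<Omega> \<phi> \<Longrightarrow> closure {x. \<phi> x \<noteq> 0} \<subseteq> \<Omega>"
  unfolding test_function_def by (elim conjE)

lemma test_function_eq_0:
  assumes "test_function \<Omega> \<phi>" "x \<notin> \<Omega>"
  shows "\<phi> x = 0"
proof (rule ccontr)
  assume "\<phi> x \<noteq> 0"
  then have "x \<in> closure {x. \<phi> x \<noteq> 0}" using closure_subset[of "{x. \<phi> x \<noteq> 0}"] by auto
  then show False using assms(2) subsetD[OF test_function_support_subset[OF assms(1)]] by simp
qed

lemma test_function_continuous: "test_function \<Omega> \<phi> \<Longrightarrow> continuous_on UNIV \<phi>"
  by (rule Ck_imp_continuous[OF test_function_Ck])

lemma test_function_has_derivative: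
  "test_function \<Omega> \<phi> \<Longrightarrow> (\<phi> has_derivative frechet_derivative \<phi> (at x)) (at x)"
  by (rule Ck_Suc_has_derivative[OF test_function_Ck])

lemma test_functionI:
  assumes "\<And>k. Ck k \<psi>" "closure {x. \<psi> x \<noteq> 0} \<subseteq> K" "compact K" "K \<subseteq> \<Omega>"
  shows "test_function \<Omega> \<psi>"
  unfolding test_function_def
proof (intro conjI allI)
  have "bounded (closure {x. \<psi> x \<noteq> 0})"
    using assms(2,3) by (rule bounded_subset[OF compact_imp_bounded, rotated])
  then show "compact (closure {x. \<psi> x \<noteq> 0})"
    by (simp add: compact_eq_bounded_closed)
  show "closure {x. \<psi> x \<noteq> 0} \<subseteq> \<Omega>"
    using assms(2,4) by (rule subset_trans)
qed (rule assms(1))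

lemma test_function_mono: "test_function \<omega> \<phi> \<Longrightarrow> \<omega> \<subseteq> \<Omega> \<Longrightarrow> test_function \<Omega> \<phi>"
  by (rule test_functionI[OF test_function_Ck subset_refl test_function_support_compact
        subset_trans[OF test_function_support_subset]])

lemma test_function_support:
  assumes "\<And>k. Ck k \<psi>" "{x. \<psi> x \<noteq> 0} \<subseteq> closure {x. \<phi> x \<noteq> 0}" "test_function \<Omega> \<phi>"
  shows "test_function \<Omega> \<psi>"
  using assms(1)
proof (rule test_functionI)
  show "closure {x. \<psi> x \<noteq> 0} \<subseteq> closure {x. \<phi> x \<noteq> 0}"
    using assms(2) by (rule closure_minimal) (rule closed_closure)
qed (rule test_function_support_compact[OF assms(3)] test_function_support_subset[OF assms(3)])+

lemma test_function_mult:
  assumes "test_function \<Omega> \<phi>" "\<And>k. Ck k \<psi>"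
  shows "test_function \<Omega> (\<lambda>x. \<psi> x * \<phi> x)"
proof (rule test_function_support[OF _ _ assms(1)])
  show "Ck k (\<lambda>x. \<psi> x * \<phi> x)" for k
    by (intro Ck_mult assms(2) test_function_Ck[OF assms(1)])
  have "{x. \<psi> x * \<phi> x \<noteq> 0} \<subseteq> {x. \<phi> x \<noteq> 0}" by auto
  then show "{x. \<psi> x * \<phi> x \<noteq> 0} \<subseteq> closure {x. \<phi> x \<noteq> 0}"
    by (rule subset_trans) (rule closure_subset)
qed

lemma test_function_scale: "test_function \<Omega> \<phi> \<Longrightarrow> test_function \<Omega> (\<lambda>x. c * \<phi> x)"
  by (rule test_function_mult[OF _ Ck_const])

lemma test_function_add:
  assumes "test_function \<Omega> \<phi>" "test_function \<Omega> \<psi>"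
  shows "test_function \<Omega> (\<lambda>x. \<phi> x + \<psi> x)"
proof (rule test_functionI)
  show "Ck k (\<lambda>x. \<phi> x + \<psi> x)" for k
    by (intro Ck_add test_function_Ck[OF assms(1)] test_function_Ck[OF assms(2)])
  have "{x. \<phi> x + \<psi> x \<noteq> 0} \<subseteq> {x. \<phi> x \<noteq> 0} \<union> {x. \<psi> x \<noteq> 0}" by auto
  then show "closure {x. \<phi> x + \<psi> x \<noteq> 0} \<subseteq> closure {x. \<phi> x \<noteq> 0} \<union> closure {x. \<psi> x \<noteq> 0}"
    unfolding closure_Un[symmetric] by (rule closure_mono)
  show "compact (closure {x. \<phi> x \<noteq> 0} \<union> closure {x. \<psi> x \<noteq> 0})"
    by (intro compact_Un test_function_support_compact[OF assms(1)] test_function_support_compact[OF assms(2)])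
  show "closure {x. \<phi> x \<noteq> 0} \<union> closure {x. \<psi> x \<noteq> 0} \<subseteq> \<Omega>"
    by (intro Un_least test_function_support_subset[OF assms(1)] test_function_support_subset[OF assms(2)])
qed

lemma test_function_zero: "test_function \<Omega> (\<lambda>x. 0)"
  by (simp add: test_function_def Ck_const)

lemma test_function_sum:
  "(\<And>i. i \<in> I \<Longrightarrow> test_function \<Omega> (f i)) \<Longrightarrow> test_function \<Omega> (\<lambda>x. \<Sum>i\<in>I. f i x)"
  by (induction I rule: infinite_finite_induct) (simp_all add: test_function_zero test_function_add)

lemma test_function_partial:
  assumes "test_function \<Omega> \<phi>" "i \<in> Basis"
  shows "test_function \<Omega> (\<lambda>x. frechet_derivative \<phi> (at x) i)"
proof (rule test_function_support[OF _ _ assms(1)])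
  show "Ck k (\<lambda>x. frechet_derivative \<phi> (at x) i)" for k
  proof -
    have "Ck (Suc k) \<phi>" using assms(1) by (rule test_function_Ck)
    then show ?thesis using assms(2) by simp
  qed
  show "{x. frechet_derivative \<phi> (at x) i \<noteq> 0} \<subseteq> closure {x. \<phi> x \<noteq> 0}"
  proof (rule subsetI, rule ccontr)
    fix x assume x: "x \<in> {x. frechet_derivative \<phi> (at x) i \<noteq> 0}" "x \<notin> closure {x. \<phi> x \<noteq> 0}"
    have "(\<phi> has_derivative (\<lambda>_. 0)) (at x)"
    proof (rule has_derivative_transform_within_open[where f = "\<lambda>_. 0" and s = "- closure {x. \<phi> x \<noteq> 0}"])
      show "0 = \<phi> y" if "y \<in> - closure {x. \<phi> x \<noteq> 0}" for y
        using that closure_subset[of "{x. \<phi> x \<noteq> 0}"] by auto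
    qed (use x in auto)
    then have "frechet_derivative \<phi> (at x) = (\<lambda>_. 0)" by (metis frechet_derivative_at)
    then show False using x by simp
  qed
qed

definition neg_laplacian :: "('a::euclidean_space \<Rightarrow> real) \<Rightarrow> 'a \<Rightarrow> real" where
  "neg_laplacian \<phi> x =
     - (\<Sum>i\<in>Basis. frechet_derivative (\<lambda>x. frechet_derivative \<phi> (at x) i) (at x) i)"

lemma test_function_neg_laplacian:
  assumes "test_function \<Omega> \<phi>" shows "test_function \<Omega> (neg_laplacian \<phi>)"
proof -
  have "test_function \<Omega> (\<lambda>x. (-1) * (\<Sum>i\<in>Basis. frechet_derivative (\<lambda>x. frechet_derivative \<phi> (at x) i) (at x) i))"
    by (intro test_function_scale test_function_sum test_function_partial assms)
  then show ?thesis by (simp add: neg_laplacian_def[abs_def])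
qed

text \<open>The gradient is assembled from partial derivatives, so it represents the derivative only
  where the derivative exists.\<close>

lemma grad_inner:
  assumes "(\<phi> has_derivative frechet_derivative \<phi> (at x)) (at x)"
  shows "frechet_derivative \<phi> (at x) h = grad \<phi> x \<bullet> h"
proof -
  interpret linear "frechet_derivative \<phi> (at x)"
    using assms has_derivative_linear by blast
  have "frechet_derivative \<phi> (at x) h = frechet_derivative \<phi> (at x) (\<Sum>i\<in>Basis. (h \<bullet> i) *\<^sub>R i)"
    by (simp add: euclidean_representation)
  also have "\<dots> = (\<Sum>i\<in>Basis. (h \<bullet> i) * frechet_derivative \<phi> (at x) i)"
    by (simp add: sum scale)
  also have "\<dots> = grad \<phi> x \<bullet> h"
    by (simp add: grad_def inner_sum_left inner_commute[of h] mult.commute)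
  finally show ?thesis .
qed

lemma grad_nth: "i \<in> Basis \<Longrightarrow> grad \<phi> x \<bullet> i = frechet_derivative \<phi> (at x) i"
  by (simp add: grad_def inner_sum_left inner_Basis if_distrib cong: if_cong)

lemma continuous_grad: "test_function \<Omega> \<phi> \<Longrightarrow> continuous_on UNIV (grad \<phi>)"
  unfolding grad_def[abs_def]
  by (intro continuous_intros test_function_continuous[OF test_function_partial])

lemma grad_eq_0: "test_function \<Omega> \<phi> \<Longrightarrow> x \<notin> \<Omega> \<Longrightarrow> grad \<phi> x = 0"
  unfolding grad_def by (intro sum.neutral ballI) (simp add: test_function_eq_0[OF test_function_partial])

lemma grad_add_scale:
  assumes "test_function \<Omega> \<phi>" "test_function \<Omega> \<psi>"
  shows "grad (\<lambda>x. \<phi> x + c * \<psi> x) x = grad \<phi> x + c *\<^sub>R grad \<psi> x"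
proof -
  have "((\<lambda>x. \<phi> x + c * \<psi> x) has_derivative
      (\<lambda>h. frechet_derivative \<phi> (at x) h + c * frechet_derivative \<psi> (at x) h)) (at x)"
    using assms by (intro derivative_intros test_function_has_derivative)
  then have "frechet_derivative (\<lambda>x. \<phi> x + c * \<psi> x) (at x)
      = (\<lambda>h. frechet_derivative \<phi> (at x) h + c * frechet_derivative \<psi> (at x) h)"
    by (metis frechet_derivative_at)
  then show ?thesis
    by (simp add: grad_def scaleR_add_left sum.distrib scaleR_sum_right)
qed

section \<open>Translates of test functions\<close>

lemma lborel_borel_measurable_restrict:
  "f \<in> borel_measurable borel \<Longrightarrow> f \<in> borel_measurable (lebesgue_on \<Omega>)"
  by (intro measurable_restrict_space1 measurable_completion) simp

lemma continuous_in_L2: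
  assumes "bounded \<Omega>" "\<Omega> \<in> sets lebesgue" "continuous_on UNIV f"
  shows "f \<in> L2 \<Omega>"
proof -
  have m: "f \<in> borel_measurable (lebesgue_on \<Omega>)"
    using assms(3) by (intro lborel_borel_measurable_restrict borel_measurable_continuous_onI)
  have "compact (f ` closure \<Omega>)"
    using assms by (intro compact_continuous_image continuous_on_subset[OF assms(3)]) auto
  then obtain B where B: "\<And>x. x \<in> closure \<Omega> \<Longrightarrow> norm (f x) \<le> B"
    by (meson bounded_iff compact_imp_bounded imageI)
  interpret finite_measure "lebesgue_on \<Omega>"
    using assms bounded_set_imp_lmeasurable by (intro finite_measure_lebesgue_on) auto
  have "integrable (lebesgue_on \<Omega>) (\<lambda>x. (norm (f x))\<^sup>2)"
  proof (rule integrable_const_bound[of _ "B\<^sup>2"])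
    show "AE x in lebesgue_on \<Omega>. norm ((norm (f x))\<^sup>2) \<le> B\<^sup>2"
      using B closure_subset[of \<Omega>] by (intro AE_I2) (auto intro!: power_mono)
  qed (use m in measurable)
  with m show ?thesis by (simp add: L2_def)
qed

lemma L2_inner_eq_lborel:
  assumes "\<Omega> \<in> sets borel" "f \<in> borel_measurable borel" "g \<in> borel_measurable borel"
  shows "L2_inner \<Omega> f g = (LINT x|lborel. indicator \<Omega> x *\<^sub>R (f x \<bullet> g x))"
proof -
  have "L2_inner \<Omega> f g = (LINT x|lebesgue. indicator \<Omega> x *\<^sub>R (f x \<bullet> g x))"
    using assms unfolding L2_inner_def by (subst integral_restrict_space) auto
  also have "\<dots> = (LINT x|lborel. indicator \<Omega> x *\<^sub>R (f x \<bullet> g x))"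
    using assms by (intro integral_completion) (auto intro!: borel_measurable_scaleR borel_measurable_indicator)
  finally show ?thesis .
qed

lemma L2_norm_eq_nn_integral_lborel:
  assumes "\<Omega> \<in> sets borel" "f \<in> L2 \<Omega>" "f \<in> borel_measurable borel"
  shows "ennreal ((L2_norm \<Omega> f)\<^sup>2) = (\<integral>\<^sup>+x. ennreal ((norm (f x))\<^sup>2) * indicator \<Omega> x \<partial>lborel)"
proof -
  have "ennreal ((L2_norm \<Omega> f)\<^sup>2) = (\<integral>\<^sup>+x. ennreal ((norm (f x))\<^sup>2) * indicator \<Omega> x \<partial>lebesgue)"
    using assms unfolding nn_integral_norm_power2[OF assms(2), symmetric]
    by (subst nn_integral_restrict_space) auto
  also have "\<dots> = (\<integral>\<^sup>+x. ennreal ((norm (f x))\<^sup>2) * indicator \<Omega> x \<partial>lborel)"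
    using assms by (intro nn_integral_completion)
  finally show ?thesis .
qed

lemma nn_integral_lborel_translate:
  fixes F :: "'a::euclidean_space \<Rightarrow> ennreal"
  assumes "F \<in> borel_measurable borel"
  shows "(\<integral>\<^sup>+x. F (x + a) \<partial>lborel) = (\<integral>\<^sup>+x. F x \<partial>lborel)"
proof -
  have "(\<integral>\<^sup>+x. F x \<partial>lborel) = (\<integral>\<^sup>+x. F x \<partial>distr lborel borel ((+) a))"
    by (simp add: lborel_distr_plus)
  also have "\<dots> = (\<integral>\<^sup>+x. F (a + x) \<partial>lborel)"
    using assms by (subst nn_integral_distr) auto
  finally show ?thesis by (simp add: add.commute)
qed

lemma integral_lborel_translate:
  fixes F :: "'a::euclidean_space \<Rightarrow> real"
  assumes "F \<in> borel_measurable borel"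
  shows "(LINT x|lborel. F (x + a)) = (LINT x|lborel. F x)"
proof -
  have "(LINT x|lborel. F x) = (LINT x|distr lborel borel ((+) a). F x)"
    by (simp add: lborel_distr_plus)
  also have "\<dots> = (LINT x|lborel. F (a + x))"
    using assms by (subst integral_distr) auto
  finally show ?thesis by (simp add: add.commute)
qed

text \<open>Fundamental theorem of calculus along the segment from \<open>x\<close> to \<open>x + h\<close>, followed by the
  Cauchy-Schwarz inequality on the unit interval.\<close>

lemma squared_increment_le_line_integral:
  fixes \<phi> :: "'a::euclidean_space \<Rightarrow> real"
  assumes d: "\<And>x. (\<phi> has_derivative (\<lambda>h. g x \<bullet> h)) (at x)" and c: "continuous_on UNIV g"
  shows "ennreal ((\<phi> (x + h) - \<phi> x)\<^sup>2)
      \<le> (\<integral>\<^sup>+t. ennreal ((norm h)\<^sup>2 * (norm (g (x + t *\<^sub>R h)))\<^sup>2) * indicator {0..1} t \<partial>lborel)"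
proof -
  define k where "k = (\<lambda>t. g (x + t *\<^sub>R h) \<bullet> h)"
  have kc: "continuous_on UNIV k"
    unfolding k_def by (intro continuous_intros continuous_on_compose2[OF c]) auto
  have k: "k \<in> L2 {0..1}" and one: "(\<lambda>t. 1::real) \<in> L2 {0..1::real}"
    by (auto intro!: continuous_in_L2 kc)
  have kb: "k \<in> borel_measurable borel" using kc by (rule borel_measurable_continuous_onI)
  have "(k has_integral (\<phi> (x + 1 *\<^sub>R h) - \<phi> (x + 0 *\<^sub>R h))) {0..1}"
  proof (rule fundamental_theorem_of_calculus)
    fix t :: real
    have "((\<lambda>t. \<phi> (x + t *\<^sub>R h)) has_derivative (\<lambda>s. g (x + t *\<^sub>R h) \<bullet> (s *\<^sub>R h))) (at t)"
      by (rule has_derivative_compose[of "\<lambda>t. x + t *\<^sub>R h", OF _ d]) (auto intro!: derivative_eq_intros)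
    then show "((\<lambda>t. \<phi> (x + t *\<^sub>R h)) has_vector_derivative k t) (at t within {0..1})"
      unfolding has_vector_derivative_def k_def by (auto intro: has_derivative_at_withinI)
  qed simp
  moreover have "integrable (lebesgue_on {0..1}) k"
    using integrable_inner_L2[OF k one] by simp
  ultimately have "\<phi> (x + h) - \<phi> x = L2_inner {0..1} k (\<lambda>t. 1)"
    unfolding L2_inner_def using lebesgue_integral_eq_integral[of "{0..1}" k] by (simp add: integral_unique)
  moreover have "L2_norm {0..1::real} (\<lambda>t. 1::real) = 1"
    by (simp add: L2_norm_def L2_inner_def measure_restrict_space)
  ultimately have "\<bar>\<phi> (x + h) - \<phi> x\<bar> \<le> L2_norm {0..1} k"
    using L2_Cauchy_Schwarz[OF k one] by simp
  then have "(\<phi> (x + h) - \<phi> x)\<^sup>2 \<le> (L2_norm {0..1} k)\<^sup>2"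
    using abs_le_square_iff[of "\<phi> (x + h) - \<phi> x" "L2_norm {0..1} k"] by (simp add: L2_norm_nonneg)
  then have "ennreal ((\<phi> (x + h) - \<phi> x)\<^sup>2) \<le> (\<integral>\<^sup>+t. ennreal ((norm (k t))\<^sup>2) * indicator {0..1} t \<partial>lborel)"
    unfolding L2_norm_eq_nn_integral_lborel[OF borel_closed[OF closed_atLeastAtMost] k kb, symmetric]
    by (rule ennreal_leI)
  also have "\<dots> \<le> (\<integral>\<^sup>+t. ennreal ((norm h)\<^sup>2 * (norm (g (x + t *\<^sub>R h)))\<^sup>2) * indicator {0..1} t \<partial>lborel)"
  proof (intro nn_integral_mono mult_right_mono ennreal_leI)
    fix t
    have "\<bar>k t\<bar> \<le> norm (g (x + t *\<^sub>R h)) * norm h"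
      unfolding k_def by (rule Cauchy_Schwarz_ineq2)
    then have "(norm (k t))\<^sup>2 \<le> (norm (g (x + t *\<^sub>R h)) * norm h)\<^sup>2"
      by (intro power_mono) auto
    then show "(norm (k t))\<^sup>2 \<le> (norm h)\<^sup>2 * (norm (g (x + t *\<^sub>R h)))\<^sup>2"
      by (simp add: power_mult_distrib mult.commute)
  qed simp
  finally show ?thesis .
qed

text \<open>Integrate the pointwise bound over \<open>x\<close> and exchange the integrals: for each fixed \<open>t\<close> the
  shift by \<open>t *\<^sub>R h\<close> does not change the integral over the whole space.\<close>

lemma translation_estimate:
  fixes \<phi> :: "'a::euclidean_space \<Rightarrow> real"
  assumes d: "\<And>x. (\<phi> has_derivative (\<lambda>h. g x \<bullet> h)) (at x)" and c: "continuous_on UNIV g"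
  shows "(\<integral>\<^sup>+x. ennreal ((\<phi> (x + h) - \<phi> x)\<^sup>2) \<partial>lborel)
      \<le> ennreal ((norm h)\<^sup>2) * (\<integral>\<^sup>+x. ennreal ((norm (g x))\<^sup>2) \<partial>lborel)"
proof -
  have [measurable]: "g \<in> borel_measurable borel"
    using c by (rule borel_measurable_continuous_onI)
  have "(\<integral>\<^sup>+x. ennreal ((\<phi> (x + h) - \<phi> x)\<^sup>2) \<partial>lborel)
    \<le> (\<integral>\<^sup>+x. \<integral>\<^sup>+t. ennreal ((norm h)\<^sup>2 * (norm (g (x + t *\<^sub>R h)))\<^sup>2) * indicator {0..1} t \<partial>lborel \<partial>lborel)"
    by (intro nn_integral_mono squared_increment_le_line_integral assms)
  also have "\<dots> = (\<integral>\<^sup>+t. \<integral>\<^sup>+x. ennreal ((norm h)\<^sup>2 * (norm (g (x + t *\<^sub>R h)))\<^sup>2) * indicator {0..1} t \<partial>lborel \<partial>lborel)"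
    by (rule lborel_pair.Fubini'[symmetric]) measurable
  also have "\<dots> = (\<integral>\<^sup>+t. (ennreal ((norm h)\<^sup>2) * (\<integral>\<^sup>+x. ennreal ((norm (g x))\<^sup>2) \<partial>lborel)) * indicator {0..1::real} t \<partial>lborel)"
  proof (intro nn_integral_cong)
    fix t :: real
    have "(\<integral>\<^sup>+x. ennreal ((norm (g (x + t *\<^sub>R h)))\<^sup>2) \<partial>lborel) = (\<integral>\<^sup>+x. ennreal ((norm (g x))\<^sup>2) \<partial>lborel)"
      by (rule nn_integral_lborel_translate[where F = "\<lambda>x. ennreal ((norm (g x))\<^sup>2)"]) measurable
    then show "(\<integral>\<^sup>+x. ennreal ((norm h)\<^sup>2 * (norm (g (x + t *\<^sub>R h)))\<^sup>2) * indicator {0..1} t \<partial>lborel)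
        = (ennreal ((norm h)\<^sup>2) * (\<integral>\<^sup>+x. ennreal ((norm (g x))\<^sup>2) \<partial>lborel)) * indicator {0..1} t"
      by (simp add: ennreal_mult nn_integral_multc nn_integral_cmult)
  qed
  also have "\<dots> = ennreal ((norm h)\<^sup>2) * (\<integral>\<^sup>+x. ennreal ((norm (g x))\<^sup>2) \<partial>lborel)"
    by (simp add: nn_integral_cmult)
  finally show ?thesis .
qed

lemma test_function_has_derivative_grad:
  "test_function \<Omega> \<phi> \<Longrightarrow> (\<phi> has_derivative (\<lambda>h. grad \<phi> x \<bullet> h)) (at x)"
  using test_function_has_derivative[of \<Omega> \<phi> x] grad_inner[OF test_function_has_derivative, of \<Omega> \<phi> x]
  by (metis (no_types, lifting) ext)

lemma test_function_L2:
  "bounded \<Omega> \<Longrightarrow> open \<Omega> \<Longrightarrow> test_function \<Omega> \<phi> \<Longrightarrow> \<phi> \<in> L2 \<Omega>"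
  by (intro continuous_in_L2 test_function_continuous) auto

lemma grad_L2:
  "bounded \<Omega> \<Longrightarrow> open \<Omega> \<Longrightarrow> test_function \<Omega> \<phi> \<Longrightarrow> grad \<phi> \<in> L2 \<Omega>"
  by (intro continuous_in_L2 continuous_grad) auto

lemma nn_integral_test_function:
  assumes "bounded \<Omega>" "open \<Omega>" "test_function \<Omega> \<phi>"
  shows "(\<integral>\<^sup>+x. ennreal ((\<phi> x)\<^sup>2) \<partial>lborel) = ennreal ((L2_norm \<Omega> \<phi>)\<^sup>2)"
    and "(\<integral>\<^sup>+x. ennreal ((norm (grad \<phi> x))\<^sup>2) \<partial>lborel) = ennreal ((L2_norm \<Omega> (grad \<phi>))\<^sup>2)"
proof -
  have m: "\<phi> \<in> borel_measurable borel" "grad \<phi> \<in> borel_measurable borel"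
    using assms(3) by (auto intro!: borel_measurable_continuous_onI test_function_continuous continuous_grad)
  note * = L2_norm_eq_nn_integral_lborel[OF borel_open[OF assms(2)] test_function_L2[OF assms] m(1)]
    L2_norm_eq_nn_integral_lborel[OF borel_open[OF assms(2)] grad_L2[OF assms] m(2)]
  show "(\<integral>\<^sup>+x. ennreal ((\<phi> x)\<^sup>2) \<partial>lborel) = ennreal ((L2_norm \<Omega> \<phi>)\<^sup>2)"
    unfolding * using test_function_eq_0[OF assms(3)] by (intro nn_integral_cong) (auto simp: indicator_def)
  show "(\<integral>\<^sup>+x. ennreal ((norm (grad \<phi> x))\<^sup>2) \<partial>lborel) = ennreal ((L2_norm \<Omega> (grad \<phi>))\<^sup>2)"
    unfolding * using grad_eq_0[OF assms(3)] by (intro nn_integral_cong) (auto simp: indicator_def)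
qed

text \<open>A shift by \<open>2 * r\<close> makes the support disjoint from itself, so the squared norm of the
  difference of the two translates is twice that of \<open>\<phi>\<close>, and the translation estimate bounds it by the gradient.
  For a large ball this is the Poincare inequality; for a small one it says that functions with small support
  have a large Rayleigh quotient.\<close>

lemma test_function_Poincare:
  fixes \<phi> :: "'a::euclidean_space \<Rightarrow> real"
  assumes "bounded \<Omega>" "open \<Omega>" "test_function \<Omega> \<phi>" "{x. \<phi> x \<noteq> 0} \<subseteq> ball p r" "0 < r"
  shows "(L2_norm \<Omega> \<phi>)\<^sup>2 \<le> 2 * r\<^sup>2 * (L2_norm \<Omega> (grad \<phi>))\<^sup>2"
proof -
  have [measurable]: "\<phi> \<in> borel_measurable borel"
    using assms(3) by (intro borel_measurable_continuous_onI test_function_continuous)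
  obtain b :: 'a where b: "b \<in> Basis" using nonempty_Basis by blast
  define h where "h = (2 * r) *\<^sub>R b"
  have h: "norm h = 2 * r" using b assms(5) by (simp add: h_def)
  have "\<phi> (x + h) * \<phi> x = 0" for x
  proof (rule ccontr)
    assume "\<phi> (x + h) * \<phi> x \<noteq> 0"
    then have "dist p (x + h) < r" "dist p x < r" using assms(4) by auto
    then have "dist (x + h) x < 2 * r" using dist_triangle3[of "x + h" x p] by simp
    then show False using h by (simp add: dist_norm)
  qed
  then have "(\<phi> (x + h))\<^sup>2 + (\<phi> x)\<^sup>2 = (\<phi> (x + h) - \<phi> x)\<^sup>2" for x
    by (simp add: power2_diff mult.assoc)
  then have "(\<integral>\<^sup>+x. ennreal ((\<phi> (x + h) - \<phi> x)\<^sup>2) \<partial>lborel)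
      = (\<integral>\<^sup>+x. ennreal ((\<phi> (x + h))\<^sup>2) + ennreal ((\<phi> x)\<^sup>2) \<partial>lborel)"
    by (simp flip: ennreal_plus)
  also have "\<dots> = (\<integral>\<^sup>+x. ennreal ((\<phi> (x + h))\<^sup>2) \<partial>lborel) + (\<integral>\<^sup>+x. ennreal ((\<phi> x)\<^sup>2) \<partial>lborel)"
    by (intro nn_integral_add) measurable
  also have "(\<integral>\<^sup>+x. ennreal ((\<phi> (x + h))\<^sup>2) \<partial>lborel) = (\<integral>\<^sup>+x. ennreal ((\<phi> x)\<^sup>2) \<partial>lborel)"
    by (rule nn_integral_lborel_translate[where F = "\<lambda>x. ennreal ((\<phi> x)\<^sup>2)"]) measurable
  finally have "ennreal ((L2_norm \<Omega> \<phi>)\<^sup>2) + ennreal ((L2_norm \<Omega> \<phi>)\<^sup>2)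
     \<le> ennreal ((norm h)\<^sup>2) * ennreal ((L2_norm \<Omega> (grad \<phi>))\<^sup>2)"
    using translation_estimate[of \<phi> "grad \<phi>" h] assms
    by (simp add: nn_integral_test_function[OF assms(1-3)] test_function_has_derivative_grad[OF assms(3)]
        continuous_grad[OF assms(3)])
  then have "(L2_norm \<Omega> \<phi>)\<^sup>2 + (L2_norm \<Omega> \<phi>)\<^sup>2 \<le> (norm h)\<^sup>2 * (L2_norm \<Omega> (grad \<phi>))\<^sup>2"
    by (simp flip: ennreal_plus ennreal_mult)
  then show ?thesis by (simp add: h power_mult_distrib)
qed

section \<open>Compactness\<close>

lemma indicator_in_L2:
  assumes "bounded \<Omega>" "\<Omega> \<in> sets borel" "A \<in> sets borel"
  shows "(\<lambda>x. c * indicator A x :: real) \<in> L2 \<Omega>"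
proof -
  have "(\<lambda>x. c * indicator A x :: real) \<in> borel_measurable (lebesgue_on \<Omega>)"
    using assms(3) by (intro lborel_borel_measurable_restrict borel_measurable_times borel_measurable_indicator) auto
  moreover have "integrable (lebesgue_on \<Omega>) (\<lambda>x. (norm (c * indicator A x :: real))\<^sup>2)"
  proof (rule finite_measure.integrable_const_bound[of _ _ "c\<^sup>2"])
    show "finite_measure (lebesgue_on \<Omega>)"
      using assms by (intro finite_measure_lebesgue_on bounded_set_imp_lmeasurable) auto
    show "AE x in lebesgue_on \<Omega>. norm ((norm (c * indicator A x :: real))\<^sup>2) \<le> c\<^sup>2"
      by (intro AE_I2) (auto simp: indicator_def)
  qed (use calculation in measurable)
  ultimately show ?thesis by (simp add: L2_def)
qed

text \<open>Compare \<open>\<phi> x\<close> with the mean of \<open>\<phi>\<close> over a ball containing \<open>x\<close>.  The deviation is an average of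
  differences \<open>\<phi> y - \<phi> x\<close>; since \<open>y\<close> lies within \<open>2 * r\<close> of \<open>x\<close>, the ball may be replaced by one centred at \<open>x\<close>,
  which no longer depends on \<open>p\<close>.\<close>

lemma ball_average_deviation:
  fixes \<phi> :: "'a::euclidean_space \<Rightarrow> real"
  assumes c: "continuous_on UNIV \<phi>" and x: "x \<in> ball p r"
  defines "v \<equiv> measure lborel (ball (0::'a) r)" and "A \<equiv> (LINT y|lborel. indicator (ball p r) y *\<^sub>R \<phi> y)"
  shows "ennreal ((\<phi> x)\<^sup>2) \<le> ennreal (2 * A\<^sup>2 / v\<^sup>2)
     + ennreal (2 / v) * (\<integral>\<^sup>+h. ennreal ((\<phi> (x + h) - \<phi> x)\<^sup>2) * indicator (ball 0 (2 * r)) h \<partial>lborel)"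
proof -
  let ?B = "ball p r"
  have [measurable]: "ball x (2 * r) \<in> sets borel" by simp
  have r: "0 < r" using x by (auto intro: le_less_trans[OF zero_le_dist])
  have [measurable]: "\<phi> \<in> borel_measurable borel" using c by (rule borel_measurable_continuous_onI)
  have v: "measure lborel ?B = v" "0 < v"
    using r by (simp_all add: v_def content_ball_pos content_ball)
  define k where "k = (\<lambda>y. \<phi> y - \<phi> x)"
  have kb [measurable]: "k \<in> borel_measurable borel" unfolding k_def by measurable
  have k: "k \<in> L2 ?B" and one: "(\<lambda>y. 1::real) \<in> L2 ?B" and phi: "\<phi> \<in> L2 ?B"
    unfolding k_def by (auto intro!: continuous_in_L2 continuous_intros c)
  have n1: "(L2_norm ?B (\<lambda>y. 1::real))\<^sup>2 = v"
    unfolding L2_norm_power2 by (subst L2_inner_eq_lborel) (simp_all add: v)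
  have c1: "L2_inner ?B (\<lambda>y. \<phi> x) (\<lambda>y. 1) = \<phi> x * v"
    using L2_inner_scaleR_left[of ?B "\<phi> x" "\<lambda>y. 1::real" "\<lambda>y. 1"] n1 by (simp add: L2_norm_power2)
  have A: "L2_inner ?B \<phi> (\<lambda>y. 1) = A"
    unfolding A_def by (subst L2_inner_eq_lborel) simp_all
  have "L2_inner ?B k (\<lambda>y. 1) = A - \<phi> x * v"
    unfolding k_def using L2_inner_diff_left[OF phi L2_scaleR[OF one, of "\<phi> x"] one] by (simp add: A c1)
  then have "\<bar>A - \<phi> x * v\<bar> \<le> L2_norm ?B k * L2_norm ?B (\<lambda>y. 1::real)"
    using L2_Cauchy_Schwarz[OF k one] by simp
  then have "(A - \<phi> x * v)\<^sup>2 \<le> (L2_norm ?B k * L2_norm ?B (\<lambda>y. 1::real))\<^sup>2"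
    using abs_le_square_iff[of "A - \<phi> x * v" "L2_norm ?B k * L2_norm ?B (\<lambda>y. 1::real)"]
    by (simp add: L2_norm_nonneg)
  then have dev: "(A - \<phi> x * v)\<^sup>2 \<le> (L2_norm ?B k)\<^sup>2 * v"
    by (simp add: power_mult_distrib n1)
  have "(\<phi> x * v)\<^sup>2 \<le> 2 * A\<^sup>2 + 2 * (A - \<phi> x * v)\<^sup>2"
    using zero_le_power2[of "A + (A - \<phi> x * v)"] by (simp add: power2_eq_square algebra_simps)
  also have "\<dots> \<le> 2 * A\<^sup>2 + 2 * ((L2_norm ?B k)\<^sup>2 * v)" using dev by simp
  finally have "(\<phi> x)\<^sup>2 * v\<^sup>2 \<le> (2 * A\<^sup>2 / v\<^sup>2 + 2 / v * (L2_norm ?B k)\<^sup>2) * v\<^sup>2"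
    using v(2) by (simp add: power_mult_distrib algebra_simps power2_eq_square)
  then have "(\<phi> x)\<^sup>2 \<le> 2 * A\<^sup>2 / v\<^sup>2 + 2 / v * (L2_norm ?B k)\<^sup>2"
    using v(2) by (simp add: mult_le_cancel_right)
  then have "ennreal ((\<phi> x)\<^sup>2) \<le> ennreal (2 * A\<^sup>2 / v\<^sup>2 + 2 / v * (L2_norm ?B k)\<^sup>2)"
    by (rule ennreal_leI)
  also have "\<dots> = ennreal (2 * A\<^sup>2 / v\<^sup>2) + ennreal (2 / v) * ennreal ((L2_norm ?B k)\<^sup>2)"
    using v(2) ennreal_mult[of "2 / v" "(L2_norm ?B k)\<^sup>2"] by (subst ennreal_plus) auto
  also have "ennreal ((L2_norm ?B k)\<^sup>2) = (\<integral>\<^sup>+y. ennreal ((k y)\<^sup>2) * indicator ?B y \<partial>lborel)"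
    using L2_norm_eq_nn_integral_lborel[OF borel_open[OF open_ball] k kb] by simp
  also have "\<dots> \<le> (\<integral>\<^sup>+y. ennreal ((k y)\<^sup>2) * indicator (ball x (2 * r)) y \<partial>lborel)"
  proof (intro nn_integral_mono mult_left_mono)
    fix y
    have "y \<in> ball x (2 * r)" if "y \<in> ?B"
      using that x dist_triangle3[of x y p] by simp
    then show "indicator ?B y \<le> (indicator (ball x (2 * r)) y :: ennreal)"
      by (auto simp: indicator_def)
  qed simp
  also have "\<dots> = (\<integral>\<^sup>+h. ennreal ((k (h + x))\<^sup>2) * indicator (ball x (2 * r)) (h + x) \<partial>lborel)"
    by (rule nn_integral_lborel_translate[symmetric, where F = "\<lambda>y. ennreal ((k y)\<^sup>2) * indicator (ball x (2 * r)) y"])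
       measurable
  also have "\<dots> = (\<integral>\<^sup>+h. ennreal ((\<phi> (x + h) - \<phi> x)\<^sup>2) * indicator (ball 0 (2 * r)) h \<partial>lborel)"
    by (intro nn_integral_cong) (simp add: k_def indicator_def dist_norm add.commute)
  finally show ?thesis by (simp add: add_left_mono mult_left_mono)
qed

text \<open>The quantitative form of Rellich's theorem: up to a small multiple of the gradient, finitely
  many ball averages control the norm.  At each point one ball of the cover suffices, but summing over all of them
  avoids choosing a measurable partition.  The deviation terms are integrated with Fubini and the
  translation estimate; the factor \<open>2 ^ DIM('a)\<close> is the ratio of the volumes of balls of radii \<open>2 * r\<close> and \<open>r\<close>.\<close>

lemma ball_average_estimate:
  fixes \<Omega> :: "'a::euclidean_space set" and k :: "'a set"
  assumes \<Omega>: "bounded \<Omega>" "open \<Omega>" and r: "0 < r" and k: "finite k" "\<Omega> \<subseteq> (\<Union>p\<in>k. ball p r)"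
  shows "\<exists>l. (\<forall>p\<in>k. l p \<in> L2 \<Omega>) \<and> (\<forall>\<phi>. test_function \<Omega> \<phi> \<longrightarrow>
      (L2_norm \<Omega> \<phi>)\<^sup>2 \<le> 2 ^ DIM('a) * 8 * r\<^sup>2 * (L2_norm \<Omega> (grad \<phi>))\<^sup>2 + (\<Sum>p\<in>k. (L2_inner \<Omega> \<phi> (l p))\<^sup>2))"
proof -
  define v where "v = measure lborel (ball (0::'a) r)"
  define W where "W = measure lborel \<Omega>"
  define l where "l = (\<lambda>(p :: 'a) (x :: 'a). (sqrt (2 * W) / v) * indicator (ball p r) x :: real)"
  have v: "0 < v" using r by (simp add: v_def content_ball_pos)
  have W: "emeasure lborel \<Omega> = ennreal W" "0 \<le> W"
    using \<Omega> emeasure_bounded_finite[of \<Omega>] by (auto simp: W_def emeasure_eq_ennreal_measure)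
  have v2: "emeasure lborel (ball (0::'a) (2 * r)) = ennreal (2 ^ DIM('a) * v)"
    using r by (simp add: v_def emeasure_ball content_ball power_mult_distrib mult_ac)
  have l: "l p \<in> L2 \<Omega>" for p
    unfolding l_def using \<Omega> by (intro indicator_in_L2) auto
  have "(L2_norm \<Omega> \<phi>)\<^sup>2 \<le> 2 ^ DIM('a) * 8 * r\<^sup>2 * (L2_norm \<Omega> (grad \<phi>))\<^sup>2 + (\<Sum>p\<in>k. (L2_inner \<Omega> \<phi> (l p))\<^sup>2)"
    if \<phi>: "test_function \<Omega> \<phi>" for \<phi>
  proof -
    have c: "continuous_on UNIV \<phi>" using \<phi> by (rule test_function_continuous)
    have [measurable]: "\<phi> \<in> borel_measurable borel" using c by (rule borel_measurable_continuous_onI)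
    have [measurable]: "\<Omega> \<in> sets borel" "ball (0::'a) (2 * r) \<in> sets borel" using \<Omega> by auto
    define A where "A = (\<lambda>p. LINT y|lborel. indicator (ball p r) y *\<^sub>R \<phi> y)"
    define S where "S = (\<Sum>p\<in>k. 2 * (A p)\<^sup>2 / v\<^sup>2)"
    define G where "G = (L2_norm \<Omega> (grad \<phi>))\<^sup>2"
    have S: "0 \<le> S" unfolding S_def by (intro sum_nonneg) auto
    define I where "I = (\<lambda>x. \<integral>\<^sup>+h. ennreal ((\<phi> (x + h) - \<phi> x)\<^sup>2) * indicator (ball 0 (2 * r)) h \<partial>lborel)"
    have [measurable]: "I \<in> borel_measurable lborel"
      unfolding I_def by measurable
    have "ennreal ((L2_norm \<Omega> \<phi>)\<^sup>2) = (\<integral>\<^sup>+x. ennreal ((\<phi> x)\<^sup>2) \<partial>lborel)"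
      by (simp add: nn_integral_test_function[OF \<Omega> \<phi>])
    also have "\<dots> \<le> (\<integral>\<^sup>+x. ennreal S * indicator \<Omega> x + ennreal (2 / v) * I x \<partial>lborel)"
    proof (intro nn_integral_mono)
      fix x
      show "ennreal ((\<phi> x)\<^sup>2) \<le> ennreal S * indicator \<Omega> x + ennreal (2 / v) * I x"
      proof (cases "x \<in> \<Omega>")
        case False
        then show ?thesis using test_function_eq_0[OF \<phi>, of x] by simp
      next
        case True
        then obtain p where p: "p \<in> k" "x \<in> ball p r" using k by blast
        have "2 * (A p)\<^sup>2 / v\<^sup>2 \<le> S"
          unfolding S_def using p k(1) by (intro member_le_sum) auto
        then have "ennreal (2 * (A p)\<^sup>2 / v\<^sup>2) \<le> ennreal S" by (rule ennreal_leI)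
        moreover have "ennreal ((\<phi> x)\<^sup>2) \<le> ennreal (2 * (A p)\<^sup>2 / v\<^sup>2) + ennreal (2 / v) * I x"
          unfolding A_def v_def I_def by (rule ball_average_deviation[OF c p(2)])
        ultimately have "ennreal ((\<phi> x)\<^sup>2) \<le> ennreal S + ennreal (2 / v) * I x"
          by (meson add_right_mono order_trans)
        then show ?thesis using True by simp
      qed
    qed
    also have "\<dots> = ennreal S * ennreal W + ennreal (2 / v) * (\<integral>\<^sup>+x. I x \<partial>lborel)"
      by (subst nn_integral_add) (auto simp: nn_integral_cmult W)
    also have "(\<integral>\<^sup>+x. I x \<partial>lborel)
        = (\<integral>\<^sup>+h. \<integral>\<^sup>+x. ennreal ((\<phi> (x + h) - \<phi> x)\<^sup>2) * indicator (ball 0 (2 * r)) h \<partial>lborel \<partial>lborel)"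
      unfolding I_def by (rule lborel_pair.Fubini'[symmetric]) measurable
    also have "\<dots> = (\<integral>\<^sup>+h. (\<integral>\<^sup>+x. ennreal ((\<phi> (x + h) - \<phi> x)\<^sup>2) \<partial>lborel) * indicator (ball 0 (2 * r)) h \<partial>lborel)"
      by (intro nn_integral_cong nn_integral_multc) measurable
    also have "\<dots> \<le> (\<integral>\<^sup>+h. ennreal ((2 * r)\<^sup>2 * G) * indicator (ball (0::'a) (2 * r)) h \<partial>lborel)"
    proof (intro nn_integral_mono)
      fix h :: 'a
      show "(\<integral>\<^sup>+x. ennreal ((\<phi> (x + h) - \<phi> x)\<^sup>2) \<partial>lborel) * indicator (ball 0 (2 * r)) h
         \<le> ennreal ((2 * r)\<^sup>2 * G) * indicator (ball 0 (2 * r)) h"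
      proof (cases "h \<in> ball 0 (2 * r)")
        case True
        have "(\<integral>\<^sup>+x. ennreal ((\<phi> (x + h) - \<phi> x)\<^sup>2) \<partial>lborel) \<le> ennreal ((norm h)\<^sup>2) * ennreal G"
          using translation_estimate[of \<phi> "grad \<phi>" h]
          by (simp add: G_def nn_integral_test_function[OF \<Omega> \<phi>] test_function_has_derivative_grad[OF \<phi>]
              continuous_grad[OF \<phi>])
        also have "\<dots> \<le> ennreal ((2 * r)\<^sup>2) * ennreal G"
          using True r by (intro mult_right_mono ennreal_leI power_mono) auto
        finally show ?thesis using True by (simp add: ennreal_mult G_def)
      qed simp
    qed
    also have "\<dots> = ennreal ((2 * r)\<^sup>2 * G) * ennreal (2 ^ DIM('a) * v)"
      by (simp add: nn_integral_cmult v2)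
    finally have "ennreal ((L2_norm \<Omega> \<phi>)\<^sup>2)
       \<le> ennreal S * ennreal W + ennreal (2 / v) * (ennreal ((2 * r)\<^sup>2 * G) * ennreal (2 ^ DIM('a) * v))"
      by (simp add: add_left_mono mult_left_mono)
    also have "\<dots> = ennreal (S * W + (2 / v) * (((2 * r)\<^sup>2 * G) * (2 ^ DIM('a) * v)))"
    proof -
      have "ennreal a * ennreal b + ennreal c * (ennreal d * ennreal e) = ennreal (a * b + c * (d * e))"
        if "0 \<le> a" "0 \<le> b" "0 \<le> c" "0 \<le> d" "0 \<le> e" for a b c d e
        using that by (simp flip: ennreal_mult ennreal_plus)
      then show ?thesis using S W v by (simp add: G_def)
    qed
    finally have "(L2_norm \<Omega> \<phi>)\<^sup>2 \<le> S * W + (2 / v) * (((2 * r)\<^sup>2 * G) * (2 ^ DIM('a) * v))"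
      using S W v by (subst (asm) ennreal_le_iff) (auto simp: G_def)
    also have "(2 / v) * (((2 * r)\<^sup>2 * G) * (2 ^ DIM('a) * v)) = 2 ^ DIM('a) * 8 * r\<^sup>2 * G"
      using v by (simp add: power_mult_distrib)
    also have "S * W = (\<Sum>p\<in>k. (L2_inner \<Omega> \<phi> (l p))\<^sup>2)"
      unfolding S_def sum_distrib_right
    proof (rule sum.cong[OF refl])
      fix p
      have "L2_inner \<Omega> \<phi> (\<lambda>x. indicator (ball p r) x :: real) = A p"
        unfolding A_def
        by (subst L2_inner_eq_lborel)
           (auto intro!: Bochner_Integration.integral_cong borel_measurable_indicator
              simp: indicator_def test_function_eq_0[OF \<phi>])
      then have "L2_inner \<Omega> \<phi> (l p) = (sqrt (2 * W) / v) * A p"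
        unfolding l_def L2_inner_mult_right by simp
      then show "2 * (A p)\<^sup>2 / v\<^sup>2 * W = (L2_inner \<Omega> \<phi> (l p))\<^sup>2"
        using W by (simp add: power_mult_distrib power_divide)
    qed
    finally show ?thesis by (simp add: G_def)
  qed
  with l show ?thesis by (intro exI[of _ l]) simp
qed

lemma test_function_finite_rank_estimate:
  fixes \<Omega> :: "'a::euclidean_space set"
  assumes \<Omega>: "bounded \<Omega>" "open \<Omega>" and \<eta>: "0 < \<eta>"
  shows "\<exists>(k :: 'a set) l. finite k \<and> (\<forall>p\<in>k. l p \<in> L2 \<Omega>) \<and> (\<forall>\<phi>. test_function \<Omega> \<phi> \<longrightarrow>
      (L2_norm \<Omega> \<phi>)\<^sup>2 \<le> \<eta> * (L2_norm \<Omega> (grad \<phi>))\<^sup>2 + (\<Sum>p\<in>k. (L2_inner \<Omega> \<phi> (l p))\<^sup>2))"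
proof -
  define C where "C = 2 ^ DIM('a) * (8::real)"
  \<comment> \<open>The radius for which the gradient term of the preceding estimate has coefficient \<open>\<eta>\<close>.\<close>
  define r where "r = sqrt (\<eta> / C)"
  have r: "0 < r" "C * r\<^sup>2 = \<eta>" using \<eta> by (auto simp: r_def C_def)
  have "compact (closure \<Omega>)" using \<Omega> by simp
  then obtain k where k: "finite k" "closure \<Omega> \<subseteq> (\<Union>p\<in>k. ball p r)"
    using r(1) unfolding compact_eq_totally_bounded by blast
  then have "\<Omega> \<subseteq> (\<Union>p\<in>k. ball p r)" using closure_subset[of \<Omega>] by simp
  from ball_average_estimate[OF \<Omega> r(1) k(1) this]
  show ?thesis using k(1) unfolding C_def[symmetric] r(2) by blast
qed

section \<open>Integration by parts\<close>

lemma integrable_continuous_bounded_support: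
  fixes f :: "'a::euclidean_space \<Rightarrow> real"
  assumes "bounded S" "continuous_on UNIV f" "\<And>x. x \<notin> S \<Longrightarrow> f x = 0"
  shows "integrable lborel f"
proof -
  have "integrable lborel (\<lambda>x. indicator (closure S) x *\<^sub>R f x)"
    using assms(1) by (intro borel_integrable_compact continuous_on_subset[OF assms(2)]) auto
  moreover have "(\<lambda>x. indicator (closure S) x *\<^sub>R f x) = f"
    using assms(3) closure_subset[of S] by (auto simp: fun_eq_iff indicator_def)
  ultimately show ?thesis by simp
qed

lemma test_function_grad_bounded:
  assumes "bounded \<Omega>" "test_function \<Omega> \<phi>"
  shows "\<exists>C. 0 \<le> C \<and> (\<forall>x. norm (grad \<phi> x) \<le> C)"
proof -
  have "compact (grad \<phi> ` closure \<Omega>)"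
    using assms by (intro compact_continuous_image continuous_on_subset[OF continuous_grad]) auto
  then obtain B where B: "\<And>x. x \<in> closure \<Omega> \<Longrightarrow> norm (grad \<phi> x) \<le> B"
    by (meson bounded_iff compact_imp_bounded imageI)
  have "norm (grad \<phi> x) \<le> max B 0" for x
    using B[of x] grad_eq_0[OF assms(2), of x] closure_subset[of \<Omega>] by (cases "x \<in> \<Omega>") force+
  then show ?thesis by (intro exI[of _ "max B 0"]) simp
qed

lemma test_function_Lipschitz:
  assumes "test_function \<Omega> \<phi>" "\<And>x. norm (grad \<phi> x) \<le> C" "0 \<le> C"
  shows "\<bar>\<phi> x - \<phi> y\<bar> \<le> C * norm (x - y)"
proof -
  have "norm (\<phi> x - \<phi> y) \<le> C * norm (x - y)"
  proof (rule differentiable_bound[of UNIV \<phi> "\<lambda>x h. grad \<phi> x \<bullet> h"])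
    fix x
    show "(\<phi> has_derivative (\<lambda>h. grad \<phi> x \<bullet> h)) (at x within UNIV)"
      using test_function_has_derivative_grad[OF assms(1)] by simp
    show "onorm (\<lambda>h. grad \<phi> x \<bullet> h) \<le> C"
    proof (rule onorm_bound[OF assms(3)])
      fix h
      have "norm (grad \<phi> x \<bullet> h) \<le> norm (grad \<phi> x) * norm h" by (rule Cauchy_Schwarz_ineq2[simplified real_norm_def[symmetric]])
      also have "\<dots> \<le> C * norm h" by (intro mult_right_mono assms) simp
      finally show "norm (grad \<phi> x \<bullet> h) \<le> C * norm h" .
    qed
  qed auto
  then show ?thesis by simp
qed

text \<open>The integral of a difference quotient vanishes because Lebesgue measure is translation
  invariant; the quotients converge to the partial derivative boundedly and with uniformly bounded support.\<close>

lemma integral_partial_derivative_eq_0: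
  fixes \<psi> :: "'a::euclidean_space \<Rightarrow> real"
  assumes "bounded \<Omega>" "test_function \<Omega> \<psi>" "i \<in> Basis"
  shows "(LINT x|lborel. frechet_derivative \<psi> (at x) i) = 0"
proof -
  obtain C where C': "0 \<le> C" "\<forall>x. norm (grad \<psi> x) \<le> C"
    using test_function_grad_bounded[OF assms(1,2)] by (elim exE conjE)
  note C = C'(1) C'(2)[rule_format]
  obtain R where R: "\<Omega> \<subseteq> cball 0 R" 
    using bounded_subset_ballD[OF assms(1), of 0] ball_subset_cball by (metis order_trans)
  have c: "continuous_on UNIV \<psi>" using assms(2) by (rule test_function_continuous)
  have [measurable]: "\<psi> \<in> borel_measurable borel" using c by (rule borel_measurable_continuous_onI)
  define s where "s = (\<lambda>n x. (\<psi> (x + (1 / Suc n) *\<^sub>R i) - \<psi> x) * Suc n)"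
  have "(\<lambda>n. LINT x|lborel. s n x) \<longlonglongrightarrow> (LINT x|lborel. frechet_derivative \<psi> (at x) i)"
  proof (rule integral_dominated_convergence[where w = "\<lambda>x. C * indicator (cball 0 (R + 1)) x"])
    have "continuous_on UNIV (\<lambda>x. frechet_derivative \<psi> (at x) i)"
      by (rule test_function_continuous[OF test_function_partial[OF assms(2,3)]])
    then show "(\<lambda>x. frechet_derivative \<psi> (at x) i) \<in> borel_measurable lborel"
      using borel_measurable_continuous_onI by auto
    show "s n \<in> borel_measurable lborel" for n
      unfolding s_def by measurable
    show "integrable lborel (\<lambda>x. C * indicator (cball (0::'a) (R + 1)) x)"
      by (intro integrable_mult_right integrable_real_indicator emeasure_lborel_cball_finite) auto
    show "AE x in lborel. (\<lambda>n. s n x) \<longlonglongrightarrow> frechet_derivative \<psi> (at x) i"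
    proof (rule AE_I2)
      fix x
      have "((\<lambda>t. \<psi> (x + t *\<^sub>R i)) has_derivative (\<lambda>t. grad \<psi> (x + 0 *\<^sub>R i) \<bullet> (t *\<^sub>R i))) (at 0)"
        by (rule has_derivative_compose[of "\<lambda>t. x + t *\<^sub>R i", OF _ test_function_has_derivative_grad[OF assms(2)]])
           (auto intro!: derivative_eq_intros)
      then have "((\<lambda>t. \<psi> (x + t *\<^sub>R i)) has_real_derivative (grad \<psi> x \<bullet> i)) (at 0)"
      proof -
        have "(*) (grad \<psi> x \<bullet> i) = (\<lambda>t. t * (grad \<psi> x \<bullet> i))" by (simp add: fun_eq_iff)
        then show ?thesis
          using \<open>((\<lambda>t. \<psi> (x + t *\<^sub>R i)) has_derivative (\<lambda>t. grad \<psi> (x + 0 *\<^sub>R i) \<bullet> (t *\<^sub>R i))) (at 0)\<close>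
          unfolding has_field_derivative_def by simp
      qed
      then have "((\<lambda>h. (\<psi> (x + h *\<^sub>R i) - \<psi> x) / h) \<longlongrightarrow> frechet_derivative \<psi> (at x) i) (at 0)"
        using assms(3) by (simp add: DERIV_def grad_nth)
      moreover have "filterlim (\<lambda>n. 1 / real (Suc n)) (at 0) sequentially"
        using LIMSEQ_Suc[OF lim_1_over_n] by (intro filterlim_atI) auto
      ultimately have "(\<lambda>n. (\<psi> (x + (1 / Suc n) *\<^sub>R i) - \<psi> x) / (1 / Suc n)) \<longlonglongrightarrow> frechet_derivative \<psi> (at x) i"
        by (rule filterlim_compose)
      then show "(\<lambda>n. s n x) \<longlonglongrightarrow> frechet_derivative \<psi> (at x) i"
        by (simp add: s_def)
    qed
    show "AE x in lborel. norm (s n x) \<le> C * indicator (cball 0 (R + 1)) x" for n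
    proof (rule AE_I2)
      fix x
      define a where "a = (1 / Suc n) *\<^sub>R i"
      have a: "norm a = 1 / Suc n" "norm a \<le> 1" using assms(3) by (auto simp: a_def)
      show "norm (s n x) \<le> C * indicator (cball 0 (R + 1)) x"
      proof (cases "x \<in> cball 0 (R + 1)")
        case True
        have "norm (s n x) = \<bar>\<psi> (x + a) - \<psi> x\<bar> * Suc n"
          by (simp add: s_def a_def abs_mult)
        also have "\<dots> \<le> C * norm a * Suc n"
          using test_function_Lipschitz[OF assms(2) C(2,1), of "x + a" x] by (intro mult_right_mono) auto
        also have "\<dots> = C" using a by simp
        finally show ?thesis using True by simp
      next
        case False
        then have "norm x > R + 1" by simp
        moreover have "norm x \<le> norm (x + a) + norm a" using norm_triangle_ineq4[of "x + a" a] by simp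
        ultimately have "\<not> norm x \<le> R" "\<not> norm (x + a) \<le> R" using a(2) by linarith+
        then have "x \<notin> \<Omega>" "x + a \<notin> \<Omega>" using R by auto
        then have "\<psi> x = 0" "\<psi> (x + a) = 0" by (simp_all add: test_function_eq_0[OF assms(2)])
        then have "s n x = 0" by (simp add: s_def a_def)
        then show ?thesis using C by simp
      qed
    qed
  qed
  moreover have "(LINT x|lborel. s n x) = 0" for n
  proof -
    let ?a = "(1 / Suc n) *\<^sub>R i"
    have "integrable lborel \<psi>"
      by (rule integrable_continuous_bounded_support[OF assms(1) c test_function_eq_0[OF assms(2)]])
    moreover have "integrable lborel (\<lambda>x. \<psi> (x + ?a))"
    proof (rule integrable_continuous_bounded_support)
      show "bounded ((\<lambda>x. x - ?a) ` \<Omega>)" using bounded_translation_minus[OF assms(1)] .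
      show "continuous_on UNIV (\<lambda>x. \<psi> (x + ?a))"
        by (intro continuous_on_compose2[OF c] continuous_intros) auto
      show "\<psi> (x + ?a) = 0" if "x \<notin> (\<lambda>x. x - ?a) ` \<Omega>" for x
      proof (rule test_function_eq_0[OF assms(2)])
        show "x + ?a \<notin> \<Omega>"
        proof
          assume "x + ?a \<in> \<Omega>"
          then have "(x + ?a) - ?a \<in> (\<lambda>x. x - ?a) ` \<Omega>" by (rule imageI)
          then show False using that by simp
        qed
      qed
    qed
    ultimately show ?thesis
      using integral_lborel_translate[of \<psi> ?a] by (simp add: s_def)
  qed
  ultimately have "(\<lambda>n. 0::real) \<longlonglongrightarrow> (LINT x|lborel. frechet_derivative \<psi> (at x) i)" by simp
  then show ?thesis using LIMSEQ_unique tendsto_const by blast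
qed

text \<open>Sum over \<open>i\<close> the vanishing integrals of \<open>\<partial>\<^sub>i (\<partial>\<^sub>i \<phi> * \<eta>)\<close>.\<close>

lemma test_function_integration_by_parts:
  fixes \<phi> \<eta> :: "'a::euclidean_space \<Rightarrow> real"
  assumes \<Omega>: "bounded \<Omega>" "open \<Omega>" and \<phi>: "test_function \<Omega> \<phi>" and \<eta>: "test_function \<Omega> \<eta>"
  shows "L2_inner \<Omega> (grad \<phi>) (grad \<eta>) = L2_inner \<Omega> (neg_laplacian \<phi>) \<eta>"
proof -
  let ?D = "\<lambda>i \<phi> x. frechet_derivative \<phi> (at x) i"
  have cont: "continuous_on UNIV \<phi>" "continuous_on UNIV \<eta>" "continuous_on UNIV (neg_laplacian \<phi>)"
    using \<phi> \<eta> test_function_neg_laplacian[OF \<phi>] by (auto intro: test_function_continuous)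
  have cg: "continuous_on UNIV (grad \<phi>)" "continuous_on UNIV (grad \<eta>)"
    using \<phi> \<eta> by (auto intro: continuous_grad)
  have int1: "integrable lborel (\<lambda>x. grad \<phi> x \<bullet> grad \<eta> x)"
    by (rule integrable_continuous_bounded_support[OF \<Omega>(1)])
       (auto intro!: continuous_intros cg simp: grad_eq_0[OF \<phi>])
  have int2: "integrable lborel (\<lambda>x. neg_laplacian \<phi> x * \<eta> x)"
    by (rule integrable_continuous_bounded_support[OF \<Omega>(1)])
       (auto intro!: continuous_intros cont simp: test_function_eq_0[OF \<eta>])
  have part: "test_function \<Omega> (\<lambda>x. ?D i \<phi> x * \<eta> x)" if "i \<in> Basis" for i
    by (rule test_function_mult[OF \<eta> test_function_Ck[OF test_function_partial[OF \<phi> that]]])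
  have prod: "?D i (\<lambda>x. ?D i \<phi> x * \<eta> x) x = ?D i \<phi> x * ?D i \<eta> x + ?D i (?D i \<phi>) x * \<eta> x"
    if "i \<in> Basis" for i x
  proof -
    have "((\<lambda>x. ?D i \<phi> x * \<eta> x) has_derivative
        (\<lambda>h. ?D i \<phi> x * frechet_derivative \<eta> (at x) h + frechet_derivative (?D i \<phi>) (at x) h * \<eta> x)) (at x)"
      by (intro has_derivative_mult test_function_has_derivative[OF \<eta>]
          test_function_has_derivative[OF test_function_partial[OF \<phi> that]])
    note frechet_derivative_at[OF this, symmetric]
    then show ?thesis by (simp only:)
  qed
  have pp: "test_function \<Omega> (?D i (\<lambda>x. ?D i \<phi> x * \<eta> x))" if "i \<in> Basis" for i
    by (rule test_function_partial[OF part[OF that] that])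
  have "0 = (\<Sum>i\<in>Basis. (LINT x|lborel. ?D i (\<lambda>x. ?D i \<phi> x * \<eta> x) x))"
    by (rule sum.neutral[symmetric]) (rule ballI, rule integral_partial_derivative_eq_0[OF \<Omega>(1) part])
  also have "\<dots> = (LINT x|lborel. (\<Sum>i\<in>Basis. ?D i (\<lambda>x. ?D i \<phi> x * \<eta> x) x))"
  proof (rule Bochner_Integration.integral_sum[symmetric])
    fix i :: 'a assume "i \<in> Basis"
    note t = pp[OF this]
    show "integrable lborel (?D i (\<lambda>x. ?D i \<phi> x * \<eta> x))"
      by (rule integrable_continuous_bounded_support[OF \<Omega>(1) test_function_continuous[OF t] test_function_eq_0[OF t]])
  qed
  also have "\<dots> = (LINT x|lborel. grad \<phi> x \<bullet> grad \<eta> x - neg_laplacian \<phi> x * \<eta> x)"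
  proof (intro Bochner_Integration.integral_cong refl)
    fix x
    have "grad \<phi> x \<bullet> grad \<eta> x = (\<Sum>i\<in>Basis. ?D i \<phi> x * ?D i \<eta> x)"
      by (subst euclidean_inner) (simp add: grad_nth)
    then show "(\<Sum>i\<in>Basis. ?D i (\<lambda>x. ?D i \<phi> x * \<eta> x) x) = grad \<phi> x \<bullet> grad \<eta> x - neg_laplacian \<phi> x * \<eta> x"
      by (simp add: prod sum.distrib neg_laplacian_def sum_distrib_right)
  qed
  also have "\<dots> = (LINT x|lborel. grad \<phi> x \<bullet> grad \<eta> x) - (LINT x|lborel. neg_laplacian \<phi> x * \<eta> x)"
    by (rule Bochner_Integration.integral_diff[OF int1 int2])
  also have "(LINT x|lborel. grad \<phi> x \<bullet> grad \<eta> x) = L2_inner \<Omega> (grad \<phi>) (grad \<eta>)"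
    using \<Omega> cg
    by (subst L2_inner_eq_lborel)
       (auto intro!: Bochner_Integration.integral_cong borel_measurable_continuous_onI simp: indicator_def grad_eq_0[OF \<phi>])
  also have "(LINT x|lborel. neg_laplacian \<phi> x * \<eta> x) = L2_inner \<Omega> (neg_laplacian \<phi>) \<eta>"
    using \<Omega> cont
    by (subst L2_inner_eq_lborel)
       (auto intro!: Bochner_Integration.integral_cong borel_measurable_continuous_onI simp: indicator_def test_function_eq_0[OF \<eta>])
  finally show ?thesis by simp
qed

section \<open>The space $H^1_0$\<close>

lemma H10_gradient_L2:
  assumes "H10_gradient \<Omega> f g" shows "f \<in> L2 \<Omega>" "g \<in> L2 \<Omega>"
  using assms by (auto simp: H10_gradient_def)

lemma H10_gradient_approx:
  assumes "H10_gradient \<Omega> f g"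
  shows "\<exists>\<phi>. (\<forall>k::nat. test_function \<Omega> (\<phi> k)) \<and> (\<lambda>k. L2_dist \<Omega> (\<phi> k) f) \<longlonglongrightarrow> 0 \<and>
    (\<lambda>k. L2_dist \<Omega> (grad (\<phi> k)) g) \<longlonglongrightarrow> 0"
  using assms unfolding H10_gradient_def by (elim conjE)

context
  fixes \<Omega> :: "'a::euclidean_space set"
  assumes \<Omega>: "bounded \<Omega>" "open \<Omega>"
begin

lemma H10_test_function: "test_function \<Omega> \<phi> \<Longrightarrow> H10_gradient \<Omega> \<phi> (grad \<phi>)"
  unfolding H10_gradient_def using \<Omega>
  by (auto intro!: test_function_L2 grad_L2 exI[of _ "\<lambda>_. \<phi>"] simp: L2_norm_zero)

lemma H10_gradient_add_scaleR:
  assumes "H10_gradient \<Omega> f g" "H10_gradient \<Omega> f' g'"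
  shows "H10_gradient \<Omega> (\<lambda>x. f x + c * f' x) (\<lambda>x. g x + c *\<^sub>R g' x)"
proof -
  note L = H10_gradient_L2[OF assms(1)] H10_gradient_L2[OF assms(2)]
  obtain \<phi> where \<phi>': "\<forall>k::nat. test_function \<Omega> (\<phi> k)" "(\<lambda>k. L2_dist \<Omega> (\<phi> k) f) \<longlonglongrightarrow> 0"
    "(\<lambda>k. L2_dist \<Omega> (grad (\<phi> k)) g) \<longlonglongrightarrow> 0"
    using H10_gradient_approx[OF assms(1)] by (elim exE conjE)
  note \<phi> = \<phi>'(1)[rule_format] \<phi>'(2,3)
  obtain \<psi> where \<psi>': "\<forall>k::nat. test_function \<Omega> (\<psi> k)" "(\<lambda>k. L2_dist \<Omega> (\<psi> k) f') \<longlonglongrightarrow> 0"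
    "(\<lambda>k. L2_dist \<Omega> (grad (\<psi> k)) g') \<longlonglongrightarrow> 0"
    using H10_gradient_approx[OF assms(2)] by (elim exE conjE)
  note \<psi> = \<psi>'(1)[rule_format] \<psi>'(2,3)
  have a: "(\<lambda>k. L2_dist \<Omega> (\<lambda>x. \<phi> k x + c *\<^sub>R \<psi> k x) (\<lambda>x. f x + c *\<^sub>R f' x)) \<longlonglongrightarrow> 0"
    by (intro L2_dist_scaleR_add_tendsto test_function_L2[OF \<Omega>] L \<phi> \<psi>)
  have b: "(\<lambda>k. L2_dist \<Omega> (\<lambda>x. grad (\<phi> k) x + c *\<^sub>R grad (\<psi> k) x) (\<lambda>x. g x + c *\<^sub>R g' x)) \<longlonglongrightarrow> 0"
    by (intro L2_dist_scaleR_add_tendsto grad_L2[OF \<Omega>] L \<phi> \<psi>)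
  show ?thesis
    unfolding H10_gradient_def
  proof (intro conjI exI[of _ "\<lambda>k x. \<phi> k x + c * \<psi> k x"] allI)
    show "(\<lambda>x. f x + c * f' x) \<in> L2 \<Omega>" "(\<lambda>x. g x + c *\<^sub>R g' x) \<in> L2 \<Omega>"
      by (intro L2_add L2_mult L2_scaleR L)+
    show "test_function \<Omega> (\<lambda>x. \<phi> k x + c * \<psi> k x)" for k
      by (intro test_function_add test_function_scale \<phi> \<psi>)
    show "(\<lambda>k. L2_dist \<Omega> (\<lambda>x. \<phi> k x + c * \<psi> k x) (\<lambda>x. f x + c * f' x)) \<longlonglongrightarrow> 0"
      using a by simp
    show "(\<lambda>k. L2_dist \<Omega> (grad (\<lambda>x. \<phi> k x + c * \<psi> k x)) (\<lambda>x. g x + c *\<^sub>R g' x)) \<longlonglongrightarrow> 0"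
      using b by (simp add: grad_add_scale[OF \<phi>(1) \<psi>(1)])
  qed
qed

lemma H10_gradient_add_sum:
  assumes "H10_gradient \<Omega> f g" "\<And>j. j \<in> J \<Longrightarrow> H10_gradient \<Omega> (e j) (\<gamma> j)" "finite J"
  shows "H10_gradient \<Omega> (\<lambda>x. f x + (\<Sum>j\<in>J. c j * e j x)) (\<lambda>x. g x + (\<Sum>j\<in>J. c j *\<^sub>R \<gamma> j x))"
  using assms(3,2)
proof (induction J rule: finite_induct)
  case empty
  then show ?case using assms(1) by simp
next
  case (insert j J)
  have "H10_gradient \<Omega> (\<lambda>x. (f x + (\<Sum>j\<in>J. c j * e j x)) + c j * e j x)
      (\<lambda>x. (g x + (\<Sum>j\<in>J. c j *\<^sub>R \<gamma> j x)) + c j *\<^sub>R \<gamma> j x)"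
    using insert by (intro H10_gradient_add_scaleR) auto
  then show ?case using insert(1,2) by (simp add: add_ac)
qed

lemma H10_gradient_sum:
  assumes "\<And>j. j \<in> J \<Longrightarrow> H10_gradient \<Omega> (e j) (\<gamma> j)" "finite J"
  shows "H10_gradient \<Omega> (\<lambda>x. \<Sum>j\<in>J. c j * e j x) (\<lambda>x. \<Sum>j\<in>J. c j *\<^sub>R \<gamma> j x)"
proof -
  have z: "test_function \<Omega> (\<lambda>x. 0)" by (rule test_function_zero)
  have "H10_gradient \<Omega> (\<lambda>x. 0 + (-1) * 0) (\<lambda>x. grad (\<lambda>x. 0) x + (-1) *\<^sub>R grad (\<lambda>x. 0) x)"
    by (intro H10_gradient_add_scaleR H10_test_function z)
  from H10_gradient_add_sum[OF this assms] show ?thesis by simp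
qed

text \<open>A diagonal choice among the approximating sequences of test functions.\<close>

lemma H10_gradient_closed:
  assumes H: "\<And>k::nat. H10_gradient \<Omega> (f k) (g k)" and f': "f' \<in> L2 \<Omega>" "g' \<in> L2 \<Omega>"
    and lim: "(\<lambda>k. L2_dist \<Omega> (f k) f') \<longlonglongrightarrow> 0" "(\<lambda>k. L2_dist \<Omega> (g k) g') \<longlonglongrightarrow> 0"
  shows "H10_gradient \<Omega> f' g'"
proof -
  have "\<exists>\<phi>. test_function \<Omega> \<phi> \<and> L2_dist \<Omega> \<phi> (f k) < 1 / Suc k \<and> L2_dist \<Omega> (grad \<phi>) (g k) < 1 / Suc k" for k
  proof -
    obtain \<phi> where \<phi>': "\<forall>k::nat. test_function \<Omega> (\<phi> k)" "(\<lambda>n. L2_dist \<Omega> (\<phi> n) (f k)) \<longlonglongrightarrow> 0"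
      "(\<lambda>n. L2_dist \<Omega> (grad (\<phi> n)) (g k)) \<longlonglongrightarrow> 0"
      using H10_gradient_approx[OF H[of k]] by (elim exE conjE)
    note \<phi> = \<phi>'(1)[rule_format] \<phi>'(2,3)
    have "\<forall>\<^sub>F n in sequentially. L2_dist \<Omega> (\<phi> n) (f k) < 1 / Suc k"
      "\<forall>\<^sub>F n in sequentially. L2_dist \<Omega> (grad (\<phi> n)) (g k) < 1 / Suc k"
      using order_tendstoD(2)[OF \<phi>(2), of "1 / Suc k"] order_tendstoD(2)[OF \<phi>(3), of "1 / Suc k"] by auto
    then have "\<forall>\<^sub>F n in sequentially. L2_dist \<Omega> (\<phi> n) (f k) < 1 / Suc k \<and> L2_dist \<Omega> (grad (\<phi> n)) (g k) < 1 / Suc k"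
      by eventually_elim simp
    then obtain n where "L2_dist \<Omega> (\<phi> n) (f k) < 1 / Suc k \<and> L2_dist \<Omega> (grad (\<phi> n)) (g k) < 1 / Suc k"
      using eventually_happens'[OF sequentially_bot] by blast
    with \<phi>(1) show ?thesis by (intro exI[of _ "\<phi> n"]) simp
  qed
  then obtain \<phi> where \<phi>: "\<And>k. test_function \<Omega> (\<phi> k)" "\<And>k. L2_dist \<Omega> (\<phi> k) (f k) < 1 / Suc k"
    "\<And>k. L2_dist \<Omega> (grad (\<phi> k)) (g k) < 1 / Suc k" by metis
  have n: "(\<lambda>k. 1 / real (Suc k)) \<longlonglongrightarrow> 0" by (rule LIMSEQ_Suc[OF lim_1_over_n])
  note L = H10_gradient_L2[OF H] test_function_L2[OF \<Omega> \<phi>(1)] grad_L2[OF \<Omega> \<phi>(1)] f'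
  have a: "(\<lambda>k. L2_dist \<Omega> (\<phi> k) f') \<longlonglongrightarrow> 0"
  proof (rule Lim_null_comparison)
    show "(\<lambda>k. 1 / real (Suc k) + L2_dist \<Omega> (f k) f') \<longlonglongrightarrow> 0" using tendsto_add[OF n lim(1)] by simp
    show "\<forall>\<^sub>F k in sequentially. norm (L2_dist \<Omega> (\<phi> k) f') \<le> 1 / real (Suc k) + L2_dist \<Omega> (f k) f'"
    proof (intro always_eventually allI)
      fix k
      show "norm (L2_dist \<Omega> (\<phi> k) f') \<le> 1 / real (Suc k) + L2_dist \<Omega> (f k) f'"
        using L2_dist_triangle[of "\<phi> k" \<Omega> "f k" f'] \<phi>(2)[of k] L by (simp add: L2_norm_nonneg)
    qed
  qed
  have b: "(\<lambda>k. L2_dist \<Omega> (grad (\<phi> k)) g') \<longlonglongrightarrow> 0"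
  proof (rule Lim_null_comparison)
    show "(\<lambda>k. 1 / real (Suc k) + L2_dist \<Omega> (g k) g') \<longlonglongrightarrow> 0" using tendsto_add[OF n lim(2)] by simp
    show "\<forall>\<^sub>F k in sequentially. norm (L2_dist \<Omega> (grad (\<phi> k)) g') \<le> 1 / real (Suc k) + L2_dist \<Omega> (g k) g'"
    proof (intro always_eventually allI)
      fix k
      show "norm (L2_dist \<Omega> (grad (\<phi> k)) g') \<le> 1 / real (Suc k) + L2_dist \<Omega> (g k) g'"
        using L2_dist_triangle[of "grad (\<phi> k)" \<Omega> "g k" g'] \<phi>(3)[of k] L by (simp add: L2_norm_nonneg)
    qed
  qed
  show ?thesis
    unfolding H10_gradient_def by (intro conjI f' exI[of _ \<phi>] allI \<phi>(1) a b)
qed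

lemma H10_integration_by_parts:
  assumes "test_function \<Omega> \<phi>" "H10_gradient \<Omega> f g"
  shows "L2_inner \<Omega> (grad \<phi>) g = L2_inner \<Omega> (neg_laplacian \<phi>) f"
proof -
  obtain \<psi> where \<psi>': "\<forall>k::nat. test_function \<Omega> (\<psi> k)" "(\<lambda>n. L2_dist \<Omega> (\<psi> n) f) \<longlonglongrightarrow> 0"
      "(\<lambda>n. L2_dist \<Omega> (grad (\<psi> n)) g) \<longlonglongrightarrow> 0"
    using H10_gradient_approx[OF assms(2)] by (elim exE conjE)
  note \<psi> = \<psi>'(1)[rule_format] \<psi>'(2,3)
  have "(\<lambda>n. L2_inner \<Omega> (grad (\<psi> n)) (grad \<phi>)) \<longlonglongrightarrow> L2_inner \<Omega> g (grad \<phi>)"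
    by (intro L2_inner_tendsto grad_L2[OF \<Omega>] \<psi> H10_gradient_L2[OF assms(2)] assms(1))
  moreover have "(\<lambda>n. L2_inner \<Omega> (\<psi> n) (neg_laplacian \<phi>)) \<longlonglongrightarrow> L2_inner \<Omega> f (neg_laplacian \<phi>)"
    by (intro L2_inner_tendsto test_function_L2[OF \<Omega>] test_function_neg_laplacian
        \<psi> H10_gradient_L2[OF assms(2)] assms(1))
  moreover have "L2_inner \<Omega> (grad (\<psi> n)) (grad \<phi>) = L2_inner \<Omega> (\<psi> n) (neg_laplacian \<phi>)" for n
    using test_function_integration_by_parts[OF \<Omega> assms(1) \<psi>(1)[of n]] by (simp add: L2_inner_commute)
  ultimately have "L2_inner \<Omega> g (grad \<phi>) = L2_inner \<Omega> f (neg_laplacian \<phi>)"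
    using LIMSEQ_unique by simp
  then show ?thesis by (simp add: L2_inner_commute)
qed

text \<open>Both sides are continuous along the sequences of test functions that define $H^1_0$.\<close>

lemma H10_quadratic_inequality:
  assumes k: "finite k" "\<And>p. p \<in> k \<Longrightarrow> l p \<in> L2 \<Omega>"
    and test: "\<And>\<phi>. test_function \<Omega> \<phi> \<Longrightarrow>
      (L2_norm \<Omega> \<phi>)\<^sup>2 \<le> \<eta> * (L2_norm \<Omega> (grad \<phi>))\<^sup>2 + (\<Sum>p\<in>k. (L2_inner \<Omega> \<phi> (l p))\<^sup>2)"
    and f: "H10_gradient \<Omega> f g"
  shows "(L2_norm \<Omega> f)\<^sup>2 \<le> \<eta> * (L2_norm \<Omega> g)\<^sup>2 + (\<Sum>p\<in>k. (L2_inner \<Omega> f (l p))\<^sup>2)"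
proof -
  obtain \<psi> where \<psi>': "\<forall>k::nat. test_function \<Omega> (\<psi> k)" "(\<lambda>n. L2_dist \<Omega> (\<psi> n) f) \<longlonglongrightarrow> 0"
      "(\<lambda>n. L2_dist \<Omega> (grad (\<psi> n)) g) \<longlonglongrightarrow> 0"
    using H10_gradient_approx[OF f] by (elim exE conjE)
  note \<psi> = \<psi>'(1)[rule_format] \<psi>'(2,3)
  show ?thesis
  proof (rule LIMSEQ_le)
    show "(\<lambda>n. (L2_norm \<Omega> (\<psi> n))\<^sup>2) \<longlonglongrightarrow> (L2_norm \<Omega> f)\<^sup>2"
      by (intro tendsto_power L2_norm_tendsto test_function_L2[OF \<Omega>] \<psi> H10_gradient_L2[OF f])
    show "(\<lambda>n. \<eta> * (L2_norm \<Omega> (grad (\<psi> n)))\<^sup>2 + (\<Sum>p\<in>k. (L2_inner \<Omega> (\<psi> n) (l p))\<^sup>2))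
      \<longlonglongrightarrow> \<eta> * (L2_norm \<Omega> g)\<^sup>2 + (\<Sum>p\<in>k. (L2_inner \<Omega> f (l p))\<^sup>2)"
      by (intro tendsto_add tendsto_mult tendsto_const tendsto_sum tendsto_power L2_norm_tendsto L2_inner_tendsto
         test_function_L2[OF \<Omega>] grad_L2[OF \<Omega>] \<psi> H10_gradient_L2[OF f] k)
  qed (use test \<psi>(1) in blast)
qed

text \<open>The only form in which compactness of the embedding of $H^1_0$ into $L^2$ is used.\<close>

lemma H10_finite_rank_estimate:
  assumes "0 < \<eta>"
  obtains k :: "'a set" and l where "finite k" "\<And>p. p \<in> k \<Longrightarrow> l p \<in> L2 \<Omega>"
    "\<And>f g. H10_gradient \<Omega> f g \<Longrightarrow>
      (L2_norm \<Omega> f)\<^sup>2 \<le> \<eta> * (L2_norm \<Omega> g)\<^sup>2 + (\<Sum>p\<in>k. (L2_inner \<Omega> f (l p))\<^sup>2)"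
  using test_function_finite_rank_estimate[OF \<Omega> assms] H10_quadratic_inequality that
  by metis

lemma H10_Poincare:
  obtains C where "0 < C" "\<And>f g. H10_gradient \<Omega> f g \<Longrightarrow> (L2_norm \<Omega> f)\<^sup>2 \<le> C * (L2_norm \<Omega> g)\<^sup>2"
proof -
  obtain r where r: "0 < r" "\<Omega> \<subseteq> ball 0 r"
    using \<Omega>(1) bounded_subset_ballD by blast
  have "(L2_norm \<Omega> f)\<^sup>2 \<le> 2 * r\<^sup>2 * (L2_norm \<Omega> g)\<^sup>2" if f: "H10_gradient \<Omega> f g" for f g
  proof -
    have "(L2_norm \<Omega> f)\<^sup>2 \<le> 2 * r\<^sup>2 * (L2_norm \<Omega> g)\<^sup>2 + (\<Sum>p\<in>{}. (L2_inner \<Omega> f p)\<^sup>2)"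
    proof (rule H10_quadratic_inequality[OF _ _ _ f, where l = "\<lambda>p. p"])
      fix \<phi> assume \<phi>: "test_function \<Omega> \<phi>"
      have "{x. \<phi> x \<noteq> 0} \<subseteq> ball 0 r" using r test_function_eq_0[OF \<phi>] by auto
      from test_function_Poincare[OF \<Omega> \<phi> this r(1)]
      show "(L2_norm \<Omega> \<phi>)\<^sup>2 \<le> 2 * r\<^sup>2 * (L2_norm \<Omega> (grad \<phi>))\<^sup>2 + (\<Sum>p\<in>{}. (L2_inner \<Omega> \<phi> p)\<^sup>2)" by simp
    qed auto
    then show ?thesis by simp
  qed
  with r(1) show ?thesis by (intro that[of "2 * r\<^sup>2"]) auto
qed

end

section \<open>Dirichlet eigenfunctions\<close>

text \<open>Normalised weak eigenfunctions of the Dirichlet Laplacian.  The gradient is part of the data, since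
  \<open>H10_gradient\<close> is a relation between a function and its gradient.\<close>

definition eigenpair :: "'a::euclidean_space set \<Rightarrow> ('a \<Rightarrow> real) \<Rightarrow> ('a \<Rightarrow> 'a) \<Rightarrow> real \<Rightarrow> bool" where
  "eigenpair \<Omega> e \<gamma> \<mu> \<longleftrightarrow> H10_gradient \<Omega> e \<gamma> \<and> L2_norm \<Omega> e = 1 \<and>
     (\<forall>\<phi> \<psi>. H10_gradient \<Omega> \<phi> \<psi> \<longrightarrow> L2_inner \<Omega> \<gamma> \<psi> = \<mu> * L2_inner \<Omega> e \<phi>)"

lemma eigenpairD:
  assumes "eigenpair \<Omega> e \<gamma> \<mu>"
  shows "H10_gradient \<Omega> e \<gamma>" "e \<in> L2 \<Omega>" "\<gamma> \<in> L2 \<Omega>" "L2_norm \<Omega> e = 1" "L2_inner \<Omega> e e = 1"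
  using assms H10_gradient_L2[of \<Omega> e \<gamma>] L2_norm_power2[of \<Omega> e] by (simp_all add: eigenpair_def)

lemma eigenpair_eq:
  "eigenpair \<Omega> e \<gamma> \<mu> \<Longrightarrow> H10_gradient \<Omega> \<phi> \<psi> \<Longrightarrow> L2_inner \<Omega> \<gamma> \<psi> = \<mu> * L2_inner \<Omega> e \<phi>"
  by (simp add: eigenpair_def)

lemma eigenpair_gradient_norm: "eigenpair \<Omega> e \<gamma> \<mu> \<Longrightarrow> (L2_norm \<Omega> \<gamma>)\<^sup>2 = \<mu>"
  using eigenpair_eq[of \<Omega> e \<gamma> \<mu> e \<gamma>] by (simp add: L2_norm_power2 eigenpairD)

lemma eigenpair_orthogonal:
  assumes "eigenpair \<Omega> e \<gamma> \<mu>" "eigenpair \<Omega> e' \<gamma>' \<nu>" "\<mu> \<noteq> \<nu>"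
  shows "L2_inner \<Omega> e e' = 0"
  using eigenpair_eq[OF assms(1) eigenpairD(1)[OF assms(2)]] eigenpair_eq[OF assms(2) eigenpairD(1)[OF assms(1)]] assms(3)
  by (simp add: L2_inner_commute[of \<Omega> e' e] L2_inner_commute[of \<Omega> \<gamma>' \<gamma>])

definition orthonormal_family :: "'a::euclidean_space set \<Rightarrow> nat \<Rightarrow> (nat \<Rightarrow> 'a \<Rightarrow> real) \<Rightarrow> bool" where
  "orthonormal_family \<Omega> N e \<longleftrightarrow> (\<forall>i<N. e i \<in> L2 \<Omega>) \<and>
     (\<forall>i<N. \<forall>j<N. L2_inner \<Omega> (e i) (e j) = (if i = j then 1 else 0))"

text \<open>The remainder after orthogonal projection, and Bessel's inequality.\<close>

lemma orthonormal_remainder: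
  assumes "orthonormal_family \<Omega> N e" "f \<in> L2 \<Omega>"
  shows "j < N \<Longrightarrow> L2_inner \<Omega> (\<lambda>x. f x + (\<Sum>i<N. - L2_inner \<Omega> f (e i) * e i x)) (e j) = 0"
    and "(\<Sum>i<N. (L2_inner \<Omega> f (e i))\<^sup>2) \<le> (L2_norm \<Omega> f)\<^sup>2"
proof -
  have e: "\<And>i. i < N \<Longrightarrow> e i \<in> L2 \<Omega>"
    and o: "\<And>i j. i < N \<Longrightarrow> j < N \<Longrightarrow> L2_inner \<Omega> (e i) (e j) = (if i = j then 1 else 0)"
    using assms(1) by (auto simp: orthonormal_family_def)
  define s where "s = (\<lambda>x. \<Sum>i<N. - L2_inner \<Omega> f (e i) * e i x)"
  have s: "s \<in> L2 \<Omega>" unfolding s_def by (intro L2_sum L2_mult e) auto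
  have se: "L2_inner \<Omega> s (e j) = - L2_inner \<Omega> f (e j)" if "j < N" for j
  proof -
    have "L2_inner \<Omega> s (e j) = (\<Sum>i<N. L2_inner \<Omega> (\<lambda>x. - L2_inner \<Omega> f (e i) * e i x) (e j))"
      unfolding s_def by (rule L2_inner_sum_left) (auto intro!: L2_mult L2_uminus e that)
    also have "\<dots> = (\<Sum>i<N. if i = j then - L2_inner \<Omega> f (e i) else 0)"
      by (intro sum.cong refl) (simp only: L2_inner_mult_left, simp add: o that)
    finally show ?thesis using that by simp
  qed
  show orth: "L2_inner \<Omega> (\<lambda>x. f x + (\<Sum>i<N. - L2_inner \<Omega> f (e i) * e i x)) (e j) = 0" if "j < N" for j
    using L2_inner_add_left[OF assms(2) s e[OF that]] se[OF that] by (simp add: s_def)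
  have hs: "L2_inner \<Omega> h s = (\<Sum>i<N. L2_inner \<Omega> h (\<lambda>x. - L2_inner \<Omega> f (e i) * e i x))"
    if "h \<in> L2 \<Omega>" for h
    unfolding s_def by (rule L2_inner_sum_right) (auto intro!: L2_mult L2_uminus e that)
  have fs: "L2_inner \<Omega> f s = - (\<Sum>i<N. (L2_inner \<Omega> f (e i))\<^sup>2)"
    unfolding hs[OF assms(2)] L2_inner_mult_right by (simp add: power2_eq_square sum_negf)
  have ss: "(L2_norm \<Omega> s)\<^sup>2 = (\<Sum>i<N. (L2_inner \<Omega> f (e i))\<^sup>2)"
    unfolding L2_norm_power2 hs[OF s] L2_inner_mult_right by (simp add: power2_eq_square se)
  have "0 \<le> (L2_norm \<Omega> (\<lambda>x. f x + s x))\<^sup>2" by simp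
  then show "(\<Sum>i<N. (L2_inner \<Omega> f (e i))\<^sup>2) \<le> (L2_norm \<Omega> f)\<^sup>2"
    unfolding L2_norm_add_power2[OF assms(2) s] by (simp add: fs ss)
qed

lemma bounded_sequences_common_subsequence:
  fixes a :: "'p \<Rightarrow> nat \<Rightarrow> real"
  assumes "finite k" "\<And>p. p \<in> k \<Longrightarrow> bounded (range (a p))"
  shows "\<exists>r L. strict_mono r \<and> (\<forall>p\<in>k. (\<lambda>n. a p (r n)) \<longlonglongrightarrow> L p)"
  using assms
proof (induction k rule: finite_induct)
  case empty
  show ?case by (intro exI[of _ id]) (auto simp: strict_mono_def)
next
  case (insert q k)
  then obtain r L where r: "strict_mono (r :: nat \<Rightarrow> nat)" "\<And>p. p \<in> k \<Longrightarrow> (\<lambda>n. a p (r n)) \<longlonglongrightarrow> L p"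
    by (metis insertCI)
  have "bounded (range (\<lambda>n. a q (r n)))"
    by (rule bounded_subset[OF insert.prems[of q]]) auto
  then obtain l s where s: "strict_mono (s :: nat \<Rightarrow> nat)" "((\<lambda>n. a q (r n)) \<circ> s) \<longlonglongrightarrow> l"
    using bounded_imp_convergent_subsequence by metis
  show ?case
  proof (intro exI[of _ "r \<circ> s"] exI[of _ "L(q := l)"] conjI ballI)
    show "strict_mono (r \<circ> s)" using r s by (simp add: strict_mono_o)
    fix p assume "p \<in> insert q k"
    then show "(\<lambda>n. a p ((r \<circ> s) n)) \<longlonglongrightarrow> (L(q := l)) p"
      using s(2) LIMSEQ_subseq_LIMSEQ[OF r(2) s(1), of p] insert.hyps by (cases "p = q") (auto simp: o_def)
  qed
qed

lemma L2_complete_rate: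
  fixes f :: "nat \<Rightarrow> 'a::euclidean_space \<Rightarrow> 'b::euclidean_space"
  assumes \<Omega>: "bounded \<Omega>" "open \<Omega>" and f: "\<And>k. f k \<in> L2 \<Omega>" and \<delta>: "\<delta> \<longlonglongrightarrow> 0"
    and d: "\<And>a b. (L2_dist \<Omega> (f a) (f b))\<^sup>2 \<le> \<delta> a + \<delta> b"
  shows "\<exists>g\<in>L2 \<Omega>. (\<lambda>k. L2_dist \<Omega> (f k) g) \<longlonglongrightarrow> 0"
proof (rule L2_complete[OF _ f])
  show "emeasure (lebesgue_on \<Omega>) (space (lebesgue_on \<Omega>)) < \<infinity>"
    using \<Omega> emeasure_bounded_finite[of \<Omega>] by (simp add: emeasure_restrict_space)
  fix \<epsilon> :: real assume \<epsilon>: "0 < \<epsilon>"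
  then have "\<forall>\<^sub>F n in sequentially. \<delta> n < \<epsilon>\<^sup>2 / 2"
    using order_tendstoD(2)[OF \<delta>, of "\<epsilon>\<^sup>2 / 2"] by simp
  then obtain K where K: "\<And>n. n \<ge> K \<Longrightarrow> \<delta> n < \<epsilon>\<^sup>2 / 2"
    by (auto simp: eventually_sequentially)
  have "L2_dist \<Omega> (f m) (f n) < \<epsilon>" if "m \<ge> K" "n \<ge> K" for m n
  proof -
    have "(L2_dist \<Omega> (f m) (f n))\<^sup>2 < \<epsilon>\<^sup>2"
      using d[of m n] K[OF that(1)] K[OF that(2)] by simp
    then show ?thesis using \<epsilon> by (simp add: power_less_imp_less_base)
  qed
  then show "\<exists>K. \<forall>m\<ge>K. \<forall>n\<ge>K. L2_dist \<Omega> (f m) (f n) < \<epsilon>" by blast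
qed

context
  fixes \<Omega> :: "'a::euclidean_space set"
  assumes \<Omega>: "bounded \<Omega>" "open \<Omega>"
begin

text \<open>The Rayleigh quotient attains its infimum \<open>m\<close> on a closed nontrivial subspace, here given as a
  relation \<open>V\<close> between functions and gradients.  Put
  \<open>J f = (norm of the gradient)\<^sup>2 - m * (norm of f)\<^sup>2 \<ge> 0\<close>; along a normalised minimising sequence \<open>J\<close> tends to zero, and the
  parallelogram law makes \<open>J\<close> of the differences tend to zero.  The gradient of a difference is therefore controlled by
  its norm, and the finite rank estimate with \<open>\<eta> * m \<le> 1/2\<close> absorbs that norm, leaving finitely many numbers that converge
  along a subsequence.  So that subsequence is a Cauchy sequence, in norm together with the gradients.\<close>

lemma exists_constrained_minimiser:
  fixes V :: "('a \<Rightarrow> real) \<Rightarrow> ('a \<Rightarrow> 'a) \<Rightarrow> bool"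
  assumes H: "\<And>f g. V f g \<Longrightarrow> H10_gradient \<Omega> f g"
    and lin: "\<And>f g f' g' c. V f g \<Longrightarrow> V f' g' \<Longrightarrow> V (\<lambda>x. f x + c * f' x) (\<lambda>x. g x + c *\<^sub>R g' x)"
    and closed: "\<And>f g f' g'. (\<And>k::nat. V (f k) (g k)) \<Longrightarrow> f' \<in> L2 \<Omega> \<Longrightarrow> g' \<in> L2 \<Omega> \<Longrightarrow>
        (\<lambda>k. L2_dist \<Omega> (f k) f') \<longlonglongrightarrow> 0 \<Longrightarrow> (\<lambda>k. L2_dist \<Omega> (g k) g') \<longlonglongrightarrow> 0 \<Longrightarrow> V f' g'"
    and nontrivial: "V f0 g0" "L2_norm \<Omega> f0 \<noteq> 0"
  shows "\<exists>e \<gamma> m. V e \<gamma> \<and> L2_norm \<Omega> e = 1 \<and>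
    (\<forall>f g. V f g \<longrightarrow> m * (L2_norm \<Omega> f)\<^sup>2 \<le> (L2_norm \<Omega> g)\<^sup>2 \<and> L2_inner \<Omega> \<gamma> g = m * L2_inner \<Omega> e f)"
proof -
  have VL: "f \<in> L2 \<Omega>" "g \<in> L2 \<Omega>" if "V f g" for f g
    using H10_gradient_L2[OF H[OF that]] by auto
  have scale: "V (\<lambda>x. c * f x) (\<lambda>x. c *\<^sub>R g x)" if "V f g" for f g c
    using lin[OF that that, of "c - 1"] by (simp add: algebra_simps)
  define A where "A = {(L2_norm \<Omega> g)\<^sup>2 | f g. V f g \<and> L2_norm \<Omega> f = 1}"
  define m where "m = Inf A"
  have bdd: "bdd_below A" by (rule bdd_belowI[of _ 0]) (auto simp: A_def)
  have normalise: "\<exists>f' g'. V f' g' \<and> L2_norm \<Omega> f' = 1 \<and> (L2_norm \<Omega> g')\<^sup>2 = (L2_norm \<Omega> g)\<^sup>2 / (L2_norm \<Omega> f)\<^sup>2"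
    if "V f g" "L2_norm \<Omega> f \<noteq> 0" for f g
    using scale[OF that(1), of "1 / L2_norm \<Omega> f"] that(2)
    by (intro exI[of _ "\<lambda>x. (1 / L2_norm \<Omega> f) * f x"] exI[of _ "\<lambda>x. (1 / L2_norm \<Omega> f) *\<^sub>R g x"] conjI)
       (simp_all only: L2_norm_mult L2_norm_scaleR, simp_all add: L2_norm_nonneg power_divide)
  have ne: "A \<noteq> {}" using normalise[OF nontrivial] by (auto simp: A_def)
  have m0: "0 \<le> m" unfolding m_def by (rule cInf_greatest[OF ne]) (auto simp: A_def)
  have lower: "m * (L2_norm \<Omega> f)\<^sup>2 \<le> (L2_norm \<Omega> g)\<^sup>2" if fg: "V f g" for f g
  proof (cases "L2_norm \<Omega> f = 0")
    case False
    from normalise[OF fg this] have "(L2_norm \<Omega> g)\<^sup>2 / (L2_norm \<Omega> f)\<^sup>2 \<in> A" by (force simp: A_def)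
    then have "m \<le> (L2_norm \<Omega> g)\<^sup>2 / (L2_norm \<Omega> f)\<^sup>2" unfolding m_def by (rule cInf_lower[OF _ bdd])
    then show ?thesis using False by (simp add: pos_le_divide_eq)
  qed simp
  have "\<exists>f g. V f g \<and> L2_norm \<Omega> f = 1 \<and> (L2_norm \<Omega> g)\<^sup>2 < m + 1 / Suc n" for n
    using cInf_lessD[OF ne, of "m + 1 / Suc n"] unfolding m_def[symmetric] by (auto simp: A_def)
  then obtain F G where FG: "\<And>n. V (F n) (G n)" "\<And>n. L2_norm \<Omega> (F n) = 1"
    "\<And>n. (L2_norm \<Omega> (G n))\<^sup>2 < m + 1 / Suc n" by metis
  define \<eta> where "\<eta> = 1 / (2 * (m + 1))"
  have \<eta>: "0 < \<eta>" "\<eta> * m \<le> 1/2" "\<eta> \<le> 1/2" using m0 by (auto simp: \<eta>_def field_simps)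
  obtain k :: "'a set" and l where k: "finite k" "\<And>p. p \<in> k \<Longrightarrow> l p \<in> L2 \<Omega>"
    "\<And>f g. H10_gradient \<Omega> f g \<Longrightarrow> (L2_norm \<Omega> f)\<^sup>2 \<le> \<eta> * (L2_norm \<Omega> g)\<^sup>2 + (\<Sum>p\<in>k. (L2_inner \<Omega> f (l p))\<^sup>2)"
    using H10_finite_rank_estimate[OF \<Omega> \<eta>(1)] by metis
  have "bounded (range (\<lambda>n. L2_inner \<Omega> (F n) (l p)))" if "p \<in> k" for p
    unfolding bounded_iff using L2_Cauchy_Schwarz[OF VL(1)[OF FG(1)] k(2)[OF that]]
    by (intro exI[of _ "L2_norm \<Omega> (l p)"]) (auto simp: FG(2))
  from bounded_sequences_common_subsequence[OF k(1), of "\<lambda>p n. L2_inner \<Omega> (F n) (l p)", OF this]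
  obtain r L where r: "strict_mono (r :: nat \<Rightarrow> nat)"
    and L: "\<And>p. p \<in> k \<Longrightarrow> (\<lambda>n. L2_inner \<Omega> (F (r n)) (l p)) \<longlonglongrightarrow> L p" by metis
  define f where "f = (\<lambda>n. F (r n))"
  define g where "g = (\<lambda>n. G (r n))"
  have fg: "V (f n) (g n)" "L2_norm \<Omega> (f n) = 1" for n unfolding f_def g_def using FG by auto
  have gn: "(L2_norm \<Omega> (g n))\<^sup>2 \<le> m + 1 / Suc n" for n
  proof -
    have "1 / real (Suc (r n)) \<le> 1 / Suc n" using seq_suble[OF r, of n] by (simp add: field_simps)
    then show ?thesis using FG(3)[of "r n"] by (simp add: g_def)
  qed
  define c where "c = (\<lambda>p n. L2_inner \<Omega> (f n) (l p))"
  \<comment> \<open>The squared distance of \<open>f a\<close> and \<open>f b\<close> will be at most \<open>\<delta> a + \<delta> b\<close>.\<close>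
  define \<delta> where "\<delta> = (\<lambda>n. 2 / real (Suc n) + 4 * (\<Sum>p\<in>k. (c p n - L p)\<^sup>2))"
  have inv: "(\<lambda>n. 1 / real (Suc n)) \<longlonglongrightarrow> 0" by (rule LIMSEQ_Suc[OF lim_1_over_n])
  have "(\<lambda>n. 2 * (1 / real (Suc n)) + 4 * (\<Sum>p\<in>k. (c p n - L p)\<^sup>2)) \<longlonglongrightarrow> 2 * 0 + 4 * (\<Sum>p\<in>k. (L p - L p)\<^sup>2)"
    unfolding c_def f_def by (intro tendsto_intros inv L)
  then have \<delta>: "\<delta> \<longlonglongrightarrow> 0" by (simp add: \<delta>_def)
  have dist: "(L2_dist \<Omega> (f a) (f b))\<^sup>2 \<le> \<delta> a + \<delta> b \<and> (L2_dist \<Omega> (g a) (g b))\<^sup>2 \<le> (m + 1) * \<delta> a + (m + 1) * \<delta> b" for a b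
  proof -
    let ?D = "(L2_dist \<Omega> (f a) (f b))\<^sup>2" and ?E = "(L2_dist \<Omega> (g a) (g b))\<^sup>2"
    let ?i = "1 / real (Suc a) + 1 / real (Suc b)"
    note La = VL[OF fg(1)[of a]] and Lb = VL[OF fg(1)[of b]]
    \<comment> \<open>Nonnegativity of \<open>J\<close> on the sum bounds \<open>J\<close> on the difference, by the parallelogram law.\<close>
    have "V (\<lambda>x. f a x + 1 * f b x) (\<lambda>x. g a x + 1 *\<^sub>R g b x)" by (intro lin fg)
    then have "m * (L2_norm \<Omega> (\<lambda>x. f a x + f b x))\<^sup>2 \<le> (L2_norm \<Omega> (\<lambda>x. g a x + g b x))\<^sup>2"
      using lower by simp
    then have "m * (2 + 2 * L2_inner \<Omega> (f a) (f b))
        \<le> (L2_norm \<Omega> (g a))\<^sup>2 + 2 * L2_inner \<Omega> (g a) (g b) + (L2_norm \<Omega> (g b))\<^sup>2"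
      by (simp add: L2_norm_add_power2 La Lb fg(2))
    then have E: "?E \<le> m * ?D + 2 * ?i"
      using gn[of a] gn[of b] by (simp add: L2_norm_diff_power2 La Lb fg(2) algebra_simps)
    have "V (\<lambda>x. f a x + (-1) * f b x) (\<lambda>x. g a x + (-1) *\<^sub>R g b x)" by (intro lin fg)
    then have Vd: "V (\<lambda>x. f a x - f b x) (\<lambda>x. g a x - g b x)" by simp
    define S where "S = (\<Sum>p\<in>k. (L2_inner \<Omega> (\<lambda>x. f a x - f b x) (l p))\<^sup>2)"
    have "S \<le> (\<Sum>p\<in>k. 2 * (c p a - L p)\<^sup>2 + 2 * (c p b - L p)\<^sup>2)"
      unfolding S_def
    proof (rule sum_mono)
      fix p assume "p \<in> k"
      then have eq: "L2_inner \<Omega> (\<lambda>x. f a x - f b x) (l p) = (c p a - L p) - (c p b - L p)"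
        using La Lb k(2) by (simp add: c_def L2_inner_diff_left)
      have sq: "(u - v)\<^sup>2 \<le> 2 * u\<^sup>2 + 2 * v\<^sup>2" for u v :: real
        using zero_le_power2[of "u + v"] by (simp add: power2_eq_square algebra_simps)
      show "(L2_inner \<Omega> (\<lambda>x. f a x - f b x) (l p))\<^sup>2 \<le> 2 * (c p a - L p)\<^sup>2 + 2 * (c p b - L p)\<^sup>2"
        unfolding eq by (rule sq)
    qed
    then have S: "2 * ?i + 2 * S \<le> \<delta> a + \<delta> b"
      by (simp add: \<delta>_def sum.distrib sum_distrib_left[symmetric] algebra_simps)
    have "0 \<le> S" unfolding S_def by (intro sum_nonneg) auto
    have "?D \<le> \<eta> * ?E + S" using k(3)[OF H[OF Vd]] by (simp add: S_def)
    also have "\<eta> * ?E \<le> \<eta> * (m * ?D + 2 * ?i)" using E \<eta> by (intro mult_left_mono) auto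
    also have "\<dots> = (\<eta> * m) * ?D + \<eta> * (2 * ?i)" by (simp add: algebra_simps)
    also have "\<dots> \<le> 1/2 * ?D + 1/2 * (2 * ?i)" using \<eta> by (intro add_mono mult_right_mono) auto
    finally have D: "?D \<le> 2 * ?i + 2 * S" by linarith
    have "?E \<le> m * (\<delta> a + \<delta> b) + 2 * ?i"
      using E D S m0 by (smt (verit) mult_left_mono)
    also have "\<dots> \<le> m * (\<delta> a + \<delta> b) + (\<delta> a + \<delta> b)" using S \<open>0 \<le> S\<close> by simp
    finally show ?thesis using D S by (simp add: algebra_simps)
  qed
  have "\<exists>e\<in>L2 \<Omega>. (\<lambda>n. L2_dist \<Omega> (f n) e) \<longlonglongrightarrow> 0"
    by (rule L2_complete_rate[OF \<Omega> VL(1)[OF fg(1)] \<delta>]) (use dist in blast)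
  then obtain e where e: "e \<in> L2 \<Omega>" "(\<lambda>n. L2_dist \<Omega> (f n) e) \<longlonglongrightarrow> 0" by blast
  have "(\<lambda>n. (m + 1) * \<delta> n) \<longlonglongrightarrow> 0" using tendsto_mult_left[OF \<delta>, of "m + 1"] by simp
  then have "\<exists>\<gamma>\<in>L2 \<Omega>. (\<lambda>n. L2_dist \<Omega> (g n) \<gamma>) \<longlonglongrightarrow> 0"
    by (rule L2_complete_rate[OF \<Omega> VL(2)[OF fg(1)]]) (use dist in blast)
  then obtain \<gamma> where \<gamma>: "\<gamma> \<in> L2 \<Omega>" "(\<lambda>n. L2_dist \<Omega> (g n) \<gamma>) \<longlonglongrightarrow> 0" by blast
  have V: "V e \<gamma>" by (rule closed[OF fg(1) e(1) \<gamma>(1) e(2) \<gamma>(2)])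
  have "(\<lambda>n. L2_norm \<Omega> (f n)) \<longlonglongrightarrow> L2_norm \<Omega> e"
    by (rule L2_norm_tendsto[OF VL(1)[OF fg(1)] e])
  then have e1: "L2_norm \<Omega> e = 1"
    unfolding fg(2) using LIMSEQ_unique[OF _ tendsto_const] by metis
  have "(L2_norm \<Omega> \<gamma>)\<^sup>2 \<le> m"
  proof (rule LIMSEQ_le)
    show "(\<lambda>n. (L2_norm \<Omega> (g n))\<^sup>2) \<longlonglongrightarrow> (L2_norm \<Omega> \<gamma>)\<^sup>2"
      by (intro tendsto_power L2_norm_tendsto VL(2)[OF fg(1)] \<gamma>)
    show "(\<lambda>n. m + 1 / Suc n) \<longlonglongrightarrow> m" using tendsto_add[OF tendsto_const inv, of m] by simp
  qed (use gn in blast)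
  with lower[OF V] e1 have gm: "(L2_norm \<Omega> \<gamma>)\<^sup>2 = m" by simp
  \<comment> \<open>First-order optimality: \<open>J (e + s * \<phi>)\<close> is a nonnegative quadratic in \<open>s\<close> that vanishes at \<open>s = 0\<close>.\<close>
  have EL: "L2_inner \<Omega> \<gamma> \<psi> = m * L2_inner \<Omega> e \<phi>" if \<phi>: "V \<phi> \<psi>" for \<phi> \<psi>
  proof -
    have "(L2_inner \<Omega> \<gamma> \<psi> - m * L2_inner \<Omega> e \<phi>)\<^sup>2 \<le> 0 * ((L2_norm \<Omega> \<psi>)\<^sup>2 - m * (L2_norm \<Omega> \<phi>)\<^sup>2)"
    proof (rule nonneg_quadratic_imp_discriminant)
      fix s
      have "m * (L2_norm \<Omega> (\<lambda>x. e x + s * \<phi> x))\<^sup>2 \<le> (L2_norm \<Omega> (\<lambda>x. \<gamma> x + s *\<^sub>R \<psi> x))\<^sup>2"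
        by (rule lower[OF lin[OF V \<phi>]])
      then show "0 \<le> 0 + 2 * s * (L2_inner \<Omega> \<gamma> \<psi> - m * L2_inner \<Omega> e \<phi>)
          + s\<^sup>2 * ((L2_norm \<Omega> \<psi>)\<^sup>2 - m * (L2_norm \<Omega> \<phi>)\<^sup>2)"
        using VL[OF V] VL[OF \<phi>] gm e1
        by (simp add: L2_norm_add_power2 L2_mult L2_scaleR L2_inner_mult_right L2_inner_scaleR_right
            L2_norm_mult L2_norm_scaleR power_mult_distrib algebra_simps)
    qed (use lower[OF \<phi>] in simp)
    then show ?thesis by simp
  qed
  show ?thesis
    by (intro exI[of _ e] exI[of _ \<gamma>] exI[of _ m] conjI V e1 allI impI) (auto intro: lower EL)
qed

text \<open>Minimise on the orthogonal complement of the known eigenfunctions.  The Euler-Lagrange equation then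
  holds only against that complement; subtracting projections extends it to all of $H^1_0$, because each known
  eigenfunction, tested with the minimiser, contributes zero.\<close>

lemma exists_orthogonal_eigenpair:
  assumes on: "orthonormal_family \<Omega> N e" and eig: "\<And>j. j < N \<Longrightarrow> eigenpair \<Omega> (e j) (\<gamma> j) (\<mu> j)"
    and f0: "H10_gradient \<Omega> f0 g0" "\<And>j. j < N \<Longrightarrow> L2_inner \<Omega> f0 (e j) = 0" "L2_norm \<Omega> f0 \<noteq> 0"
  shows "\<exists>e' \<gamma>' \<nu>. eigenpair \<Omega> e' \<gamma>' \<nu> \<and> (\<forall>j<N. L2_inner \<Omega> e' (e j) = 0) \<and>
     (\<forall>f g. H10_gradient \<Omega> f g \<longrightarrow> (\<forall>j<N. L2_inner \<Omega> f (e j) = 0) \<longrightarrow>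
        \<nu> * (L2_norm \<Omega> f)\<^sup>2 \<le> (L2_norm \<Omega> g)\<^sup>2)"
proof -
  define V where "V = (\<lambda>f g. H10_gradient \<Omega> f g \<and> (\<forall>j<N. L2_inner \<Omega> f (e j) = 0))"
  have eL: "e j \<in> L2 \<Omega>" "\<gamma> j \<in> L2 \<Omega>" if "j < N" for j using eigenpairD[OF eig[OF that]] by auto
  have "\<exists>e' \<gamma>' m. V e' \<gamma>' \<and> L2_norm \<Omega> e' = 1 \<and>
    (\<forall>f g. V f g \<longrightarrow> m * (L2_norm \<Omega> f)\<^sup>2 \<le> (L2_norm \<Omega> g)\<^sup>2 \<and> L2_inner \<Omega> \<gamma>' g = m * L2_inner \<Omega> e' f)"
  proof (rule exists_constrained_minimiser[of V f0 g0])
    show "V (\<lambda>x. f x + c * f' x) (\<lambda>x. g x + c *\<^sub>R g' x)" if "V f g" "V f' g'" for f g f' g' c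
      using that eL(1) H10_gradient_add_scaleR[OF \<Omega>, of f g f' g' c] H10_gradient_L2[of \<Omega> f g] H10_gradient_L2[of \<Omega> f' g']
      by (simp add: V_def L2_inner_add_left L2_mult L2_inner_mult_left)
    show "V f' g'" if V: "\<And>k::nat. V (f k) (g k)" and L: "f' \<in> L2 \<Omega>" "g' \<in> L2 \<Omega>"
      and lim: "(\<lambda>k. L2_dist \<Omega> (f k) f') \<longlonglongrightarrow> 0" "(\<lambda>k. L2_dist \<Omega> (g k) g') \<longlonglongrightarrow> 0" for f g f' g'
    proof -
      have Hk: "H10_gradient \<Omega> (f k) (g k)" for k using V by (simp add: V_def)
      have "L2_inner \<Omega> f' (e j) = 0" if "j < N" for j
      proof -
        have "(\<lambda>k. L2_inner \<Omega> (f k) (e j)) \<longlonglongrightarrow> L2_inner \<Omega> f' (e j)"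
          by (rule L2_inner_tendsto[OF H10_gradient_L2(1)[OF Hk] L(1) eL(1)[OF that] lim(1)])
        moreover have "L2_inner \<Omega> (f k) (e j) = 0" for k using V that by (simp add: V_def)
        ultimately show ?thesis using LIMSEQ_unique[OF _ tendsto_const] by (simp add: LIMSEQ_const_iff)
      qed
      with H10_gradient_closed[OF \<Omega> Hk L lim] show ?thesis by (simp add: V_def)
    qed
  qed (use f0 in \<open>auto simp: V_def\<close>)
  then obtain e' \<gamma>' m where m: "V e' \<gamma>'" "L2_norm \<Omega> e' = 1"
    "\<And>f g. V f g \<Longrightarrow> m * (L2_norm \<Omega> f)\<^sup>2 \<le> (L2_norm \<Omega> g)\<^sup>2" "\<And>f g. V f g \<Longrightarrow> L2_inner \<Omega> \<gamma>' g = m * L2_inner \<Omega> e' f"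
    by metis
  have H': "H10_gradient \<Omega> e' \<gamma>'" and o': "\<And>j. j < N \<Longrightarrow> L2_inner \<Omega> e' (e j) = 0"
    using m(1) by (auto simp: V_def)
  note L' = H10_gradient_L2[OF H']
  have "L2_inner \<Omega> \<gamma>' \<psi> = m * L2_inner \<Omega> e' \<phi>" if \<phi>: "H10_gradient \<Omega> \<phi> \<psi>" for \<phi> \<psi>
  proof -
    note L = H10_gradient_L2[OF \<phi>]
    define c where "c = (\<lambda>i. - L2_inner \<Omega> \<phi> (e i))"
    have "V (\<lambda>x. \<phi> x + (\<Sum>i<N. c i * e i x)) (\<lambda>x. \<psi> x + (\<Sum>i<N. c i *\<^sub>R \<gamma> i x))"
      unfolding V_def
    proof
      show "H10_gradient \<Omega> (\<lambda>x. \<phi> x + (\<Sum>i<N. c i * e i x)) (\<lambda>x. \<psi> x + (\<Sum>i<N. c i *\<^sub>R \<gamma> i x))"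
        by (rule H10_gradient_add_sum[OF \<Omega> \<phi>]) (auto intro: eigenpairD eig)
    qed (use orthonormal_remainder(1)[OF on L(1)] in \<open>auto simp: c_def\<close>)
    from m(4)[OF this]
    have "L2_inner \<Omega> \<gamma>' (\<lambda>x. \<psi> x + (\<Sum>i<N. c i *\<^sub>R \<gamma> i x)) = m * L2_inner \<Omega> e' (\<lambda>x. \<phi> x + (\<Sum>i<N. c i * e i x))" .
    moreover have "L2_inner \<Omega> \<gamma>' (\<lambda>x. \<psi> x + (\<Sum>i<N. c i *\<^sub>R \<gamma> i x))
        = L2_inner \<Omega> \<gamma>' \<psi> + (\<Sum>i<N. L2_inner \<Omega> \<gamma>' (\<lambda>x. c i *\<^sub>R \<gamma> i x))"
      using eL L L' by (subst L2_inner_add_right) (auto intro!: L2_sum L2_scaleR L2_inner_sum_right)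
    moreover have "L2_inner \<Omega> \<gamma>' (\<lambda>x. c i *\<^sub>R \<gamma> i x) = 0" if "i < N" for i
      using eigenpair_eq[OF eig[OF that] H'] o'[OF that]
      by (simp add: L2_inner_scaleR_right L2_inner_commute[of \<Omega> \<gamma>'] L2_inner_commute[of \<Omega> "e i"])
    moreover have "L2_inner \<Omega> e' (\<lambda>x. \<phi> x + (\<Sum>i<N. c i * e i x))
        = L2_inner \<Omega> e' \<phi> + (\<Sum>i<N. L2_inner \<Omega> e' (\<lambda>x. c i * e i x))"
      using eL L L' by (subst L2_inner_add_right) (auto intro!: L2_sum L2_mult L2_inner_sum_right)
    moreover have "L2_inner \<Omega> e' (\<lambda>x. c i * e i x) = 0" if "i < N" for i
      using o'[OF that] by (simp add: L2_inner_mult_right)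
    ultimately show ?thesis by simp
  qed
  then have "eigenpair \<Omega> e' \<gamma>' m" using H' m(2) by (simp add: eigenpair_def)
  then show ?thesis using o' m(3) by (intro exI[of _ e'] exI[of _ \<gamma>'] exI[of _ m]) (auto simp: V_def)
qed

end

context
  fixes \<Omega> :: "'a::euclidean_space set"
  assumes \<Omega>: "bounded \<Omega>" "open \<Omega>"
begin

text \<open>With \<open>\<eta> = 1 / (2 * \<Lambda>)\<close> the finite rank estimate says that each such eigenfunction has squared coefficients
  of total size at least one half against the finitely many test vectors; Bessel's inequality bounds the sum of all of them.\<close>

lemma eigenfamily_size_bounded:
  assumes "0 < \<Lambda>"
  shows "\<exists>B::real. \<forall>N e \<gamma> \<mu>. orthonormal_family \<Omega> N e \<longrightarrow>
     (\<forall>j<N. eigenpair \<Omega> (e j) (\<gamma> j) (\<mu> j) \<and> \<mu> j \<le> \<Lambda>) \<longrightarrow> real N \<le> B"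
proof -
  define \<eta> where "\<eta> = 1 / (2 * \<Lambda>)"
  have "0 < \<eta>" using assms by (simp add: \<eta>_def)
  from H10_finite_rank_estimate[OF \<Omega> this]
  obtain k :: "'a set" and l where k: "finite k" "\<And>p. p \<in> k \<Longrightarrow> l p \<in> L2 \<Omega>"
    "\<And>f g. H10_gradient \<Omega> f g \<Longrightarrow> (L2_norm \<Omega> f)\<^sup>2 \<le> \<eta> * (L2_norm \<Omega> g)\<^sup>2 + (\<Sum>p\<in>k. (L2_inner \<Omega> f (l p))\<^sup>2)"
    by metis
  have "real N \<le> 2 * (\<Sum>p\<in>k. (L2_norm \<Omega> (l p))\<^sup>2)"
    if on: "orthonormal_family \<Omega> N e" and eig: "\<And>j. j < N \<Longrightarrow> eigenpair \<Omega> (e j) (\<gamma> j) (\<mu> j)" "\<And>j. j < N \<Longrightarrow> \<mu> j \<le> \<Lambda>"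
    for N e \<gamma> \<mu>
  proof -
    have "1 / 2 \<le> (\<Sum>p\<in>k. (L2_inner \<Omega> (e j) (l p))\<^sup>2)" if j: "j < N" for j
    proof -
      have "\<eta> * \<mu> j \<le> \<eta> * \<Lambda>" using eig(2)[OF j] assms by (intro mult_left_mono) (auto simp: \<eta>_def)
      also have "\<dots> = 1 / 2" using assms by (simp add: \<eta>_def)
      finally show ?thesis
        using k(3)[OF eigenpairD(1)[OF eig(1)[OF j]]] eigenpairD(4)[OF eig(1)[OF j]]
          eigenpair_gradient_norm[OF eig(1)[OF j]] by simp
    qed
    then have "(\<Sum>j<N. 1 / 2) \<le> (\<Sum>j<N. \<Sum>p\<in>k. (L2_inner \<Omega> (e j) (l p))\<^sup>2)"
      by (intro sum_mono) auto
    also have "\<dots> = (\<Sum>p\<in>k. \<Sum>j<N. (L2_inner \<Omega> (l p) (e j))\<^sup>2)"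
      by (subst sum.swap) (simp add: L2_inner_commute)
    also have "\<dots> \<le> (\<Sum>p\<in>k. (L2_norm \<Omega> (l p))\<^sup>2)"
      by (intro sum_mono orthonormal_remainder(2)[OF on] k(2))
    finally show ?thesis by simp
  qed
  then show ?thesis by (intro exI[of _ "2 * (\<Sum>p\<in>k. (L2_norm \<Omega> (l p))\<^sup>2)"]) blast
qed

text \<open>By maximality, a further eigenfunction produced by minimisation must have eigenvalue above \<open>\<Lambda>\<close>.
  So a function orthogonal to the family has a Rayleigh quotient above \<open>\<Lambda>\<close>.\<close>

lemma exists_maximal_eigenfamily:
  assumes "0 < \<Lambda>"
  shows "\<exists>N e \<gamma> \<mu>. orthonormal_family \<Omega> N e \<and> (\<forall>j<N. eigenpair \<Omega> (e j) (\<gamma> j) (\<mu> j) \<and> \<mu> j \<le> \<Lambda>) \<and>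
     (\<forall>f g. H10_gradient \<Omega> f g \<longrightarrow> (\<forall>j<N. L2_inner \<Omega> f (e j) = 0) \<longrightarrow> L2_norm \<Omega> f \<noteq> 0 \<longrightarrow>
        (\<exists>e' \<gamma>' \<nu>. eigenpair \<Omega> e' \<gamma>' \<nu> \<and> \<Lambda> < \<nu> \<and> \<nu> * (L2_norm \<Omega> f)\<^sup>2 \<le> (L2_norm \<Omega> g)\<^sup>2))"
proof -
  define P where "P = (\<lambda>N. \<exists>e \<gamma> \<mu>. orthonormal_family \<Omega> N e \<and>
      (\<forall>j<N. eigenpair \<Omega> (e j) (\<gamma> j) (\<mu> j) \<and> \<mu> j \<le> \<Lambda>))"
  obtain B :: real where B: "\<And>N. P N \<Longrightarrow> real N \<le> B"
    using eigenfamily_size_bounded[OF assms] unfolding P_def by blast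
  have "P 0" by (simp add: P_def orthonormal_family_def)
  have "\<exists>N. P N \<and> \<not> P (Suc N)"
  proof (rule ccontr)
    assume "\<nexists>N. P N \<and> \<not> P (Suc N)"
    then have "P N" for N using \<open>P 0\<close> by (induction N) auto
    then have "real (nat \<lceil>B\<rceil> + 1) \<le> B" by (rule B)
    then show False by linarith
  qed
  then obtain N where N: "P N" "\<not> P (Suc N)" by blast
  then obtain e \<gamma> \<mu> where on: "orthonormal_family \<Omega> N e"
    and eig: "\<And>j. j < N \<Longrightarrow> eigenpair \<Omega> (e j) (\<gamma> j) (\<mu> j)" "\<And>j. j < N \<Longrightarrow> \<mu> j \<le> \<Lambda>"
    unfolding P_def by blast
  have "\<exists>e' \<gamma>' \<nu>. eigenpair \<Omega> e' \<gamma>' \<nu> \<and> \<Lambda> < \<nu> \<and> \<nu> * (L2_norm \<Omega> f)\<^sup>2 \<le> (L2_norm \<Omega> g)\<^sup>2"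
    if f: "H10_gradient \<Omega> f g" "\<And>j. j < N \<Longrightarrow> L2_inner \<Omega> f (e j) = 0" "L2_norm \<Omega> f \<noteq> 0" for f g
  proof -
    from exists_orthogonal_eigenpair[OF \<Omega> on eig(1) f]
    obtain e' \<gamma>' \<nu> where e': "eigenpair \<Omega> e' \<gamma>' \<nu>" "\<And>j. j < N \<Longrightarrow> L2_inner \<Omega> e' (e j) = 0"
      and low: "\<nu> * (L2_norm \<Omega> f)\<^sup>2 \<le> (L2_norm \<Omega> g)\<^sup>2"
      using f by metis
    have "\<Lambda> < \<nu>"
    proof (rule ccontr)
      assume "\<not> \<Lambda> < \<nu>"
      moreover have "orthonormal_family \<Omega> (Suc N) (e(N := e'))"
      proof -
        have "L2_inner \<Omega> (e j) e' = 0" if "j < N" for j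
          using e'(2)[OF that] by (subst L2_inner_commute)
        then show ?thesis
          using on e'(2) eigenpairD(2,5)[OF e'(1)]
          by (auto simp: orthonormal_family_def less_Suc_eq)
      qed
      ultimately have "P (Suc N)"
        unfolding P_def using eig e'(1)
        by (intro exI[of _ "e(N := e')"] exI[of _ "\<gamma>(N := \<gamma>')"] exI[of _ "\<mu>(N := \<nu>)"])
           (auto simp: less_Suc_eq)
      with N(2) show False by blast
    qed
    with e'(1) low show ?thesis by blast
  qed
  with on eig show ?thesis by (intro exI[of _ N] exI[of _ e] exI[of _ \<gamma>] exI[of _ \<mu>]) blast
qed

lemma test_function_norm_pos:
  assumes "test_function \<Omega> \<phi>" "{x. \<phi> x \<noteq> 0} = ball p r" "0 < r"
  shows "0 < L2_norm \<Omega> \<phi>"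
proof (rule ccontr)
  assume "\<not> 0 < L2_norm \<Omega> \<phi>"
  then have "L2_norm \<Omega> \<phi> = 0" using L2_norm_nonneg[of \<Omega> \<phi>] by simp
  then have z: "(\<integral>\<^sup>+x. ennreal ((\<phi> x)\<^sup>2) \<partial>lborel) = 0"
    by (simp add: nn_integral_test_function[OF \<Omega> assms(1)])
  have [measurable]: "\<phi> \<in> borel_measurable borel"
    by (intro borel_measurable_continuous_onI test_function_continuous[OF assms(1)])
  have "AE x in lborel. ennreal ((\<phi> x)\<^sup>2) = 0"
    using z by (subst (asm) nn_integral_0_iff_AE) auto
  then have "AE x in lborel. x \<notin> ball p r"
  proof eventually_elim
    case (elim x)
    then have "x \<notin> {x. \<phi> x \<noteq> 0}" by simp
    then show ?case unfolding assms(2) .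
  qed
  then have "ball p r \<in> null_sets lborel"
    by (simp add: AE_iff_null_sets)
  then have "measure lborel (ball p r) = 0" by (simp add: measure_def null_setsD1)
  then show False using content_ball_pos[OF assms(3), of p] by simp
qed

text \<open>The pair \<open>e\<^sub>1\<close> is visible from \<open>\<omega>\<close>, and \<open>e\<^sub>2\<close> decays faster.  To see the former, fix a
  bump \<open>\<phi>\<close> supported in \<open>\<omega>\<close> and take \<open>\<Lambda>\<close> above its Rayleigh quotient.  If \<open>\<phi>\<close> were orthogonal to all eigenfunctions of
  eigenvalue at most \<open>\<Lambda>\<close>, its Rayleigh quotient would exceed \<open>\<Lambda>\<close>.  A second bump \<open>f\<close> with tiny support has a Rayleigh quotient
  larger than \<open>\<Lambda>\<close>, so it is not in the span of those eigenfunctions, and its remainder \<open>h\<close> yields an eigenvalue above \<open>\<Lambda>\<close>.\<close>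

theorem exist_two_eigenpairs:
  assumes \<omega>: "open \<omega>" "\<omega> \<noteq> {}" "\<omega> \<subseteq> \<Omega>"
  shows "\<exists>\<phi> e\<^sub>1 \<gamma>\<^sub>1 \<mu>\<^sub>1 e\<^sub>2 \<gamma>\<^sub>2 \<mu>\<^sub>2. test_function \<omega> \<phi> \<and> eigenpair \<Omega> e\<^sub>1 \<gamma>\<^sub>1 \<mu>\<^sub>1 \<and> eigenpair \<Omega> e\<^sub>2 \<gamma>\<^sub>2 \<mu>\<^sub>2 \<and>
     0 < \<mu>\<^sub>1 \<and> \<mu>\<^sub>1 < \<mu>\<^sub>2 \<and> L2_inner \<Omega> \<phi> e\<^sub>1 \<noteq> 0"
proof -
  obtain p where "p \<in> \<omega>" using \<omega>(2) by blast
  then obtain r where r: "0 < r" "cball p r \<subseteq> \<omega>" using \<omega>(1) open_contains_cball by blast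
  from test_function_bump[OF r] obtain \<phi> where \<phi>: "test_function \<omega> \<phi>" "{x. \<phi> x \<noteq> 0} = ball p r"
    by (elim exE conjE)
  have \<phi>\<Omega>: "test_function \<Omega> \<phi>" using test_function_mono[OF \<phi>(1) \<omega>(3)] .
  have pos: "0 < L2_norm \<Omega> \<phi>" by (rule test_function_norm_pos[OF \<phi>\<Omega> \<phi>(2) r(1)])
  define \<Lambda> where "\<Lambda> = (L2_norm \<Omega> (grad \<phi>))\<^sup>2 / (L2_norm \<Omega> \<phi>)\<^sup>2 + 1"
  have \<Lambda>: "0 < \<Lambda>" unfolding \<Lambda>_def by (rule add_nonneg_pos) auto
  from exists_maximal_eigenfamily[OF \<Lambda>]
  obtain N e \<gamma> \<mu> where on: "orthonormal_family \<Omega> N e"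
    and eig: "\<And>j. j < N \<Longrightarrow> eigenpair \<Omega> (e j) (\<gamma> j) (\<mu> j)" "\<And>j. j < N \<Longrightarrow> \<mu> j \<le> \<Lambda>"
    and next_pair: "\<And>f g. H10_gradient \<Omega> f g \<Longrightarrow> (\<And>j. j < N \<Longrightarrow> L2_inner \<Omega> f (e j) = 0) \<Longrightarrow> L2_norm \<Omega> f \<noteq> 0 \<Longrightarrow>
        \<exists>e' \<gamma>' \<nu>. eigenpair \<Omega> e' \<gamma>' \<nu> \<and> \<Lambda> < \<nu> \<and> \<nu> * (L2_norm \<Omega> f)\<^sup>2 \<le> (L2_norm \<Omega> g)\<^sup>2"
    by metis
  have "\<exists>j<N. L2_inner \<Omega> \<phi> (e j) \<noteq> 0"
  proof (rule ccontr)
    assume "\<not> (\<exists>j<N. L2_inner \<Omega> \<phi> (e j) \<noteq> 0)"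
    then obtain \<nu> where "\<Lambda> < \<nu>" "\<nu> * (L2_norm \<Omega> \<phi>)\<^sup>2 \<le> (L2_norm \<Omega> (grad \<phi>))\<^sup>2"
      using next_pair[OF H10_test_function[OF \<Omega> \<phi>\<Omega>]] pos by auto
    then have "\<nu> \<le> (L2_norm \<Omega> (grad \<phi>))\<^sup>2 / (L2_norm \<Omega> \<phi>)\<^sup>2"
      using pos by (simp add: pos_le_divide_eq)
    then show False using \<open>\<Lambda> < \<nu>\<close> by (simp add: \<Lambda>_def)
  qed
  then obtain j where j: "j < N" "L2_inner \<Omega> \<phi> (e j) \<noteq> 0" by blast
  obtain C where C: "0 < C" "\<And>f g. H10_gradient \<Omega> f g \<Longrightarrow> (L2_norm \<Omega> f)\<^sup>2 \<le> C * (L2_norm \<Omega> g)\<^sup>2"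
    using H10_Poincare[OF \<Omega>] by metis
  have "1 \<le> C * \<mu> j"
    using C(2)[OF eigenpairD(1)[OF eig(1)[OF j(1)]]] eigenpairD(4)[OF eig(1)[OF j(1)]]
      eigenpair_gradient_norm[OF eig(1)[OF j(1)]] by simp
  then have \<mu>j: "0 < \<mu> j" using C(1) by (metis linorder_not_le mult_nonneg_nonpos not_one_le_zero order.strict_implies_order order_trans)
  \<comment> \<open>A radius so small that \<open>test_function_Poincare\<close> gives a Rayleigh quotient of at least \<open>2 * \<Lambda>\<close>.\<close>
  define s where "s = min r (1 / (2 * sqrt \<Lambda>))"
  have s: "0 < s" "s \<le> r" using r \<Lambda> by (auto simp: s_def)
  have s2: "2 * s\<^sup>2 * \<Lambda> \<le> 1 / 2"
  proof -
    have "s\<^sup>2 \<le> (1 / (2 * sqrt \<Lambda>))\<^sup>2" using s(1) by (intro power_mono) (auto simp: s_def)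
    also have "\<dots> = 1 / (4 * \<Lambda>)" using \<Lambda> by (simp add: power_divide power_mult_distrib)
    finally show ?thesis using \<Lambda> by (simp add: field_simps)
  qed
  have "cball p s \<subseteq> \<Omega>" using r(2) \<omega>(3) s by force
  from test_function_bump[OF s(1) this] obtain f where f: "test_function \<Omega> f" "{x. f x \<noteq> 0} = ball p s"
    by (elim exE conjE)
  have fpos: "0 < L2_norm \<Omega> f" by (rule test_function_norm_pos[OF f s(1)])
  have Hf: "H10_gradient \<Omega> f (grad f)" by (rule H10_test_function[OF \<Omega> f(1)])
  note Lf = H10_gradient_L2[OF Hf]
  have "(L2_norm \<Omega> f)\<^sup>2 \<le> 2 * s\<^sup>2 * (L2_norm \<Omega> (grad f))\<^sup>2"
    using test_function_Poincare[OF \<Omega> f(1) _ s(1), of p] f(2) by simp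
  then have "\<Lambda> * (L2_norm \<Omega> f)\<^sup>2 \<le> \<Lambda> * (2 * s\<^sup>2 * (L2_norm \<Omega> (grad f))\<^sup>2)"
    using \<Lambda> by (intro mult_left_mono) auto
  also have "\<dots> = (2 * s\<^sup>2 * \<Lambda>) * (L2_norm \<Omega> (grad f))\<^sup>2" by simp
  also have "\<dots> \<le> 1 / 2 * (L2_norm \<Omega> (grad f))\<^sup>2" using s2 by (intro mult_right_mono) auto
  finally have steep: "\<Lambda> * (L2_norm \<Omega> f)\<^sup>2 \<le> 1 / 2 * (L2_norm \<Omega> (grad f))\<^sup>2" .
  define c where "c = (\<lambda>i. - L2_inner \<Omega> f (e i))"
  define h where "h = (\<lambda>x. f x + (\<Sum>i<N. c i * e i x))"
  define \<psi> where "\<psi> = (\<lambda>x. grad f x + (\<Sum>i<N. c i *\<^sub>R \<gamma> i x))"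
  have Hh: "H10_gradient \<Omega> h \<psi>"
    unfolding h_def \<psi>_def by (rule H10_gradient_add_sum[OF \<Omega> Hf]) (auto intro: eigenpairD eig)
  have orth: "L2_inner \<Omega> h (e i) = 0" if "i < N" for i
    unfolding h_def c_def by (rule orthonormal_remainder(1)[OF on Lf(1) that])
  have "L2_norm \<Omega> h \<noteq> 0"
  proof
    \<comment> \<open>If \<open>h\<close> vanished almost everywhere, integration by parts would make the gradient of \<open>f\<close>
    orthogonal to the gradient of \<open>h\<close>, and the Rayleigh quotient of \<open>f\<close> would be a mean of eigenvalues up to \<open>\<Lambda>\<close>.\<close>
    assume h0: "L2_norm \<Omega> h = 0"
    have "\<bar>L2_inner \<Omega> (neg_laplacian f) h\<bar> \<le> L2_norm \<Omega> (neg_laplacian f) * L2_norm \<Omega> h"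
      by (intro L2_Cauchy_Schwarz test_function_L2[OF \<Omega>] test_function_neg_laplacian f H10_gradient_L2(1)[OF Hh])
    then have "0 = L2_inner \<Omega> (grad f) \<psi>"
      using H10_integration_by_parts[OF \<Omega> f(1) Hh] h0 by simp
    also have "\<dots> = (L2_norm \<Omega> (grad f))\<^sup>2 + (\<Sum>i<N. L2_inner \<Omega> (grad f) (\<lambda>x. c i *\<^sub>R \<gamma> i x))"
      unfolding \<psi>_def using Lf eigenpairD(3)[OF eig(1)]
      by (subst L2_inner_add_right)
         (auto intro!: L2_sum L2_scaleR L2_inner_sum_right simp: L2_norm_power2)
    also have "(\<Sum>i<N. L2_inner \<Omega> (grad f) (\<lambda>x. c i *\<^sub>R \<gamma> i x)) = (\<Sum>i<N. - (\<mu> i * (L2_inner \<Omega> f (e i))\<^sup>2))"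
    proof (rule sum.cong[OF refl])
      fix i assume "i \<in> {..<N}"
      then have "L2_inner \<Omega> (grad f) (\<gamma> i) = \<mu> i * L2_inner \<Omega> f (e i)"
        using eigenpair_eq[OF eig(1) Hf, of i] by (simp add: L2_inner_commute)
      then show "L2_inner \<Omega> (grad f) (\<lambda>x. c i *\<^sub>R \<gamma> i x) = - (\<mu> i * (L2_inner \<Omega> f (e i))\<^sup>2)"
        unfolding L2_inner_scaleR_right by (simp add: c_def power2_eq_square)
    qed
    finally have "(L2_norm \<Omega> (grad f))\<^sup>2 = (\<Sum>i<N. \<mu> i * (L2_inner \<Omega> f (e i))\<^sup>2)"
      by (simp add: sum_negf)
    also have "\<dots> \<le> (\<Sum>i<N. \<Lambda> * (L2_inner \<Omega> f (e i))\<^sup>2)"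
      using eig(2) by (intro sum_mono mult_right_mono) auto
    also have "\<dots> \<le> \<Lambda> * (L2_norm \<Omega> f)\<^sup>2"
      unfolding sum_distrib_left[symmetric] using \<Lambda> orthonormal_remainder(2)[OF on Lf(1)]
      by (intro mult_left_mono) auto
    finally have "\<Lambda> * (L2_norm \<Omega> f)\<^sup>2 \<le> 0" using steep by simp
    then show False using \<Lambda> fpos by (simp add: mult_le_0_iff)
  qed
  from next_pair[OF Hh orth this] obtain e' \<gamma>' \<nu> where "eigenpair \<Omega> e' \<gamma>' \<nu>" "\<Lambda> < \<nu>" by blast
  moreover have "\<mu> j < \<nu>" using eig(2)[OF j(1)] \<open>\<Lambda> < \<nu>\<close> by simp
  ultimately show ?thesis
    using \<phi>(1) eig(1)[OF j(1)] \<mu>j j(2) by blast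
qed

end

section \<open>Integrals over time\<close>

lemma time_integral_continuous:
  fixes f :: "real \<Rightarrow> real"
  assumes "continuous_on {0..t} f"
  shows "integrable (lebesgue_on {0<..<t}) f"
    and "(LINT s|lebesgue_on {0<..<t}. f s) = integral {0..t} f"
proof -
  have "set_integrable lebesgue {0..t} f"
    by (rule absolutely_integrable_continuous_real[OF assms])
  then have "set_integrable lebesgue {0<..<t} f"
    by (rule set_integrable_subset) auto
  then show i: "integrable (lebesgue_on {0<..<t}) f"
    unfolding set_integrable_def by (subst integrable_restrict_space) auto
  show "(LINT s|lebesgue_on {0<..<t}. f s) = integral {0..t} f"
    using lebesgue_integral_eq_integral[OF i] integral_open_interval_real[of 0 t f] by simp
qed

lemma time_integral_derivative:
  assumes "0 \<le> t" "\<And>s. (A has_real_derivative a s) (at s)" "continuous_on UNIV a"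
  shows "(LINT s|lebesgue_on {0<..<t}. a s) = A t - A 0"
proof -
  have "(a has_integral (A t - A 0)) {0..t}"
    using assms by (intro fundamental_theorem_of_calculus)
      (auto intro: has_field_derivative_at_within simp flip: has_real_derivative_iff_has_vector_derivative)
  then show ?thesis
    using time_integral_continuous(2)[OF continuous_on_subset[OF assms(3)], of t] by (simp add: integral_unique)
qed

text \<open>Since Lebesgue measure is complete, \<open>k\<close> inherits measurability from \<open>f\<close>.\<close>

lemma time_integral_cong_AE:
  fixes f k :: "real \<Rightarrow> real"
  assumes f: "integrable (lebesgue_on {0<..<t}) f" and ae: "AE s in lebesgue_on {0<..<T}. k s = f s" and "t \<le> T"
  shows "(LINT s|lebesgue_on {0<..<t}. k s) = (LINT s|lebesgue_on {0<..<t}. f s)"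
proof -
  have "AE s in lebesgue. s \<in> {0<..<T} \<longrightarrow> k s = f s"
    using ae by (subst (asm) AE_restrict_space_iff) auto
  then obtain N where N: "N \<in> null_sets lebesgue"
    "{s \<in> space lebesgue. \<not> (s \<in> {0<..<T} \<longrightarrow> k s = f s)} \<subseteq> N"
    unfolding eventually_ae_filter by (elim bexE)
  then have neg: "negligible N" and eq: "\<And>s. s \<in> {0<..<t} - N \<Longrightarrow> k s = f s"
    using \<open>t \<le> T\<close> by (auto simp: negligible_iff_null_sets)
  have "f absolutely_integrable_on {0<..<t}"
    using f unfolding set_integrable_def by (subst (asm) integrable_restrict_space) auto
  then have "k absolutely_integrable_on {0<..<t}"
    by (rule absolutely_integrable_spike[OF _ neg eq])
  then have k: "integrable (lebesgue_on {0<..<t}) k"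
    unfolding set_integrable_def by (subst integrable_restrict_space) auto
  show ?thesis
    using lebesgue_integral_eq_integral[OF f] lebesgue_integral_eq_integral[OF k]
      integral_spike[OF neg, of "{0<..<t}" k f] eq by simp
qed

text \<open>When \<open>k\<close> is not integrable the integral is zero by convention, and the bound still holds.\<close>

lemma abs_time_integral_le:
  fixes k :: "real \<Rightarrow> real"
  assumes "AE s in lebesgue_on {0<..<T}. \<bar>k s\<bar> \<le> M" "0 \<le> t" "t \<le> T" "0 \<le> M"
  shows "\<bar>LINT s|lebesgue_on {0<..<t}. k s\<bar> \<le> M * t"
proof (cases "integrable (lebesgue_on {0<..<t}) k")
  case False
  then show ?thesis using assms by (simp add: not_integrable_integral_eq)
next
  case True
  have "AE s in lebesgue. s \<in> {0<..<T} \<longrightarrow> \<bar>k s\<bar> \<le> M"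
    using assms(1) by (subst (asm) AE_restrict_space_iff) auto
  then have "AE s in lebesgue. s \<in> {0<..<t} \<longrightarrow> \<bar>k s\<bar> \<le> M"
    by eventually_elim (use assms in auto)
  then have ae: "AE s in lebesgue_on {0<..<t}. \<bar>k s\<bar> \<le> M"
    by (subst AE_restrict_space_iff) auto
  have "\<bar>LINT s|lebesgue_on {0<..<t}. k s\<bar> \<le> (LINT s|lebesgue_on {0<..<t}. \<bar>k s\<bar>)"
    by (rule integral_abs_bound)
  also have "\<dots> \<le> (LINT s|lebesgue_on {0<..<t}. M)"
    using True ae time_integral_continuous(1)[OF continuous_on_const] by (intro integral_mono_AE) auto
  also have "\<dots> = M * t"
    using time_integral_continuous(2)[OF continuous_on_const, of t M] assms by simp
  finally show ?thesis .
qed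

section \<open>Solutions with finitely many modes\<close>

lemma strongly_measurable_scaleR:
  assumes "a \<in> borel_measurable (lebesgue_on I)" "\<gamma> \<in> L2 \<Omega>"
  shows "strongly_measurable I \<Omega> (\<lambda>t x. a t *\<^sub>R \<gamma> x)"
proof -
  obtain F :: "nat \<Rightarrow> real \<Rightarrow> real" where F: "\<And>i. simple_function (lebesgue_on I) (F i)"
    "\<And>t. t \<in> space (lebesgue_on I) \<Longrightarrow> (\<lambda>i. F i t) \<longlonglongrightarrow> a t"
    using borel_measurable_implies_sequence_metric[OF assms(1), of 0] by metis
  show ?thesis
    unfolding strongly_measurable_def
  proof (intro conjI ballI exI[of _ "\<lambda>k t x. F k t *\<^sub>R \<gamma> x"] allI)
    show "(\<lambda>x. a t *\<^sub>R \<gamma> x) \<in> L2 \<Omega>" "(\<lambda>x. F k t *\<^sub>R \<gamma> x) \<in> L2 \<Omega>" for k t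
      by (intro L2_scaleR assms)+
    show "simple_function (lebesgue_on I) (\<lambda>t x. F k t *\<^sub>R \<gamma> x)" for k
      by (rule simple_function_compose1[OF F(1), of "\<lambda>c x. c *\<^sub>R \<gamma> x"])
    show "AE t in lebesgue_on I. (\<lambda>k. L2_dist \<Omega> (\<lambda>x. F k t *\<^sub>R \<gamma> x) (\<lambda>x. a t *\<^sub>R \<gamma> x)) \<longlonglongrightarrow> 0"
    proof (rule AE_I2)
      fix t assume "t \<in> space (lebesgue_on I)"
      from F(2)[OF this] have "(\<lambda>k. \<bar>F k t - a t\<bar> * L2_norm \<Omega> \<gamma>) \<longlonglongrightarrow> \<bar>a t - a t\<bar> * L2_norm \<Omega> \<gamma>"
        by (intro tendsto_intros)
      moreover have "L2_dist \<Omega> (\<lambda>x. F k t *\<^sub>R \<gamma> x) (\<lambda>x. a t *\<^sub>R \<gamma> x) = \<bar>F k t - a t\<bar> * L2_norm \<Omega> \<gamma>" for k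
        by (simp add: L2_norm_scaleR flip: scaleR_diff_left)
      ultimately show "(\<lambda>k. L2_dist \<Omega> (\<lambda>x. F k t *\<^sub>R \<gamma> x) (\<lambda>x. a t *\<^sub>R \<gamma> x)) \<longlonglongrightarrow> 0" by simp
    qed
  qed
qed

lemma strongly_measurable_add:
  assumes "strongly_measurable I \<Omega> u" "strongly_measurable I \<Omega> v" "I \<in> sets lebesgue"
  shows "strongly_measurable I \<Omega> (\<lambda>t x. u t x + v t x)"
proof -
  obtain s where s': "\<forall>k::nat. simple_function (lebesgue_on I) (s k) \<and> (\<forall>t\<in>I. s k t \<in> L2 \<Omega>)"
    "AE t in lebesgue_on I. (\<lambda>k. L2_dist \<Omega> (s k t) (u t)) \<longlonglongrightarrow> 0"
    using assms(1) unfolding strongly_measurable_def by (elim conjE exE)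
  have s: "\<And>k. simple_function (lebesgue_on I) (s k)" "\<And>k t. t \<in> I \<Longrightarrow> s k t \<in> L2 \<Omega>"
    using s'(1) by auto
  obtain r where r': "\<forall>k::nat. simple_function (lebesgue_on I) (r k) \<and> (\<forall>t\<in>I. r k t \<in> L2 \<Omega>)"
    "AE t in lebesgue_on I. (\<lambda>k. L2_dist \<Omega> (r k t) (v t)) \<longlonglongrightarrow> 0"
    using assms(2) unfolding strongly_measurable_def by (elim conjE exE)
  have r: "\<And>k. simple_function (lebesgue_on I) (r k)" "\<And>k t. t \<in> I \<Longrightarrow> r k t \<in> L2 \<Omega>"
    using r'(1) by auto
  have uv: "\<And>t. t \<in> I \<Longrightarrow> u t \<in> L2 \<Omega>" "\<And>t. t \<in> I \<Longrightarrow> v t \<in> L2 \<Omega>"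
    using assms(1,2) by (auto simp: strongly_measurable_def)
  show ?thesis
    unfolding strongly_measurable_def
  proof (intro conjI ballI exI[of _ "\<lambda>k t x. s k t x + r k t x"] allI)
    show "(\<lambda>x. u t x + v t x) \<in> L2 \<Omega>" if "t \<in> I" for t using uv[OF that] by (rule L2_add)
    show "(\<lambda>x. s k t x + r k t x) \<in> L2 \<Omega>" if "t \<in> I" for k t
      by (intro L2_add s r that)
    show "simple_function (lebesgue_on I) (\<lambda>t x. s k t x + r k t x)" for k
      by (rule simple_function_compose2[OF s(1) r(1), of "\<lambda>f g x. f x + g x"])
    have "AE t in lebesgue_on I. t \<in> I" using assms(3) by (intro AE_I2) simp
    with s'(2) r'(2)
    show "AE t in lebesgue_on I. (\<lambda>k. L2_dist \<Omega> (\<lambda>x. s k t x + r k t x) (\<lambda>x. u t x + v t x)) \<longlonglongrightarrow> 0"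
    proof eventually_elim
      case (elim t)
      have "(\<lambda>k. L2_dist \<Omega> (\<lambda>x. s k t x + 1 *\<^sub>R r k t x) (\<lambda>x. u t x + 1 *\<^sub>R v t x)) \<longlonglongrightarrow> 0"
        by (rule L2_dist_scaleR_add_tendsto) (use elim s r uv in auto)
      then show ?case by simp
    qed
  qed
qed

lemma strongly_measurable_sum:
  assumes "finite J" "\<And>j. j \<in> J \<Longrightarrow> a j \<in> borel_measurable (lebesgue_on I)" "\<And>j. j \<in> J \<Longrightarrow> \<gamma> j \<in> L2 \<Omega>"
    "I \<in> sets lebesgue"
  shows "strongly_measurable I \<Omega> (\<lambda>t x. \<Sum>j\<in>J. a j t *\<^sub>R \<gamma> j x)"
  using assms(1-3)
proof (induction J rule: finite_induct)
  case empty
  show ?case using strongly_measurable_scaleR[of "\<lambda>_. 0" I "\<lambda>_. 0" \<Omega>] by (simp add: L2_zero)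
next
  case (insert j J)
  then show ?case
    using strongly_measurable_add[OF strongly_measurable_scaleR[of "a j" I "\<gamma> j" \<Omega>] insert.IH assms(4)] by simp
qed

lemma continuous_lebesgue_on_measurable:
  fixes a :: "real \<Rightarrow> real"
  shows "continuous_on UNIV a \<Longrightarrow> a \<in> borel_measurable (lebesgue_on I)"
  by (intro lborel_borel_measurable_restrict borel_measurable_continuous_onI)

text \<open>A finite sum of functions of time multiplied by fixed elements of $H^1_0$, each with an $L^2$ Laplacian
  (here \<open>- p j\<close>), solves the heat equation with exactly the control that balances it.  The weak form is checked mode by mode
  with the fundamental theorem of calculus.\<close>

theorem modal_heat_solution:
  fixes \<Omega> \<omega> :: "'a::euclidean_space set" and g :: "'k \<Rightarrow> 'a \<Rightarrow> real"
  assumes \<Omega>: "bounded \<Omega>" "open \<Omega>" and J: "finite J"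
    and H: "\<And>j. j \<in> J \<Longrightarrow> H10_gradient \<Omega> (g j) (\<gamma> j)"
    and p: "\<And>j. j \<in> J \<Longrightarrow> p j \<in> L2 \<Omega>"
      "\<And>j \<phi> \<psi>. j \<in> J \<Longrightarrow> H10_gradient \<Omega> \<phi> \<psi> \<Longrightarrow> L2_inner \<Omega> (\<gamma> j) \<psi> = L2_inner \<Omega> (p j) \<phi>"
    and a: "\<And>j t. j \<in> J \<Longrightarrow> (a j has_real_derivative a' j t) (at t)"
      "\<And>j. j \<in> J \<Longrightarrow> continuous_on UNIV (a' j)"
    and u: "\<And>t x. indicator \<omega> x * u t x = (\<Sum>j\<in>J. a' j t * g j x + a j t * p j x)"
  shows "heat_solution \<Omega> \<omega> T (\<lambda>x. \<Sum>j\<in>J. a j 0 * g j x) u (\<lambda>t x. \<Sum>j\<in>J. a j t * g j x)"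
proof -
  note L = H10_gradient_L2[OF H]
  define y where "y = (\<lambda>t x. \<Sum>j\<in>J. a j t * g j x)"
  define G where "G = (\<lambda>t x. \<Sum>j\<in>J. a j t *\<^sub>R \<gamma> j x)"
  have ac: "continuous_on UNIV (a j)" if "j \<in> J" for j
    by (rule DERIV_continuous_on) (rule has_field_derivative_at_within[OF a(1)[OF that]])
  have yL: "y t \<in> L2 \<Omega>" for t unfolding y_def by (intro L2_sum L2_mult L)
  have GL: "G t \<in> L2 \<Omega>" for t unfolding G_def by (intro L2_sum L2_scaleR L)
  have yH: "H10_gradient \<Omega> (y t) (G t)" for t
    unfolding y_def G_def by (rule H10_gradient_sum[OF \<Omega> H J])
  have y_inner: "L2_inner \<Omega> (y t) \<phi> = (\<Sum>j\<in>J. a j t * L2_inner \<Omega> (g j) \<phi>)" if "\<phi> \<in> L2 \<Omega>" for t \<phi>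
    unfolding y_def using that L by (subst L2_inner_sum_left) (auto intro!: L2_mult simp: L2_inner_mult_left)
  have G_inner: "L2_inner \<Omega> (G t) \<psi> = (\<Sum>j\<in>J. a j t * L2_inner \<Omega> (\<gamma> j) \<psi>)" if "\<psi> \<in> L2 \<Omega>" for t \<psi>
    unfolding G_def using that L by (subst L2_inner_sum_left) (auto intro!: L2_scaleR simp: L2_inner_scaleR_left)
  show ?thesis
    unfolding heat_solution_def y_def[symmetric]
  proof (intro conjI ballI)
    show "y t \<in> L2 \<Omega>" for t by (rule yL)
    show "((\<lambda>s. L2_dist \<Omega> (y s) (y t)) \<longlongrightarrow> 0) (at t within {0..T})" if "t \<in> {0..T}" for t
    proof (rule Lim_null_comparison)
      have "((\<lambda>s. \<Sum>j\<in>J. \<bar>a j s - a j t\<bar> * L2_norm \<Omega> (g j)) \<longlongrightarrow> (\<Sum>j\<in>J. \<bar>a j t - a j t\<bar> * L2_norm \<Omega> (g j)))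
          (at t within {0..T})"
        using ac by (intro tendsto_intros) (auto simp: continuous_on_def intro: tendsto_within_subset)
      then show "((\<lambda>s. \<Sum>j\<in>J. \<bar>a j s - a j t\<bar> * L2_norm \<Omega> (g j)) \<longlongrightarrow> 0) (at t within {0..T})" by simp
      show "\<forall>\<^sub>F s in at t within {0..T}. norm (L2_dist \<Omega> (y s) (y t)) \<le> (\<Sum>j\<in>J. \<bar>a j s - a j t\<bar> * L2_norm \<Omega> (g j))"
      proof (intro always_eventually allI)
        fix s
        have "(\<lambda>x. y s x - y t x) = (\<lambda>x. \<Sum>j\<in>J. (a j s - a j t) *\<^sub>R g j x)"
          by (simp add: y_def left_diff_distrib flip: sum_subtractf)
        then show "norm (L2_dist \<Omega> (y s) (y t)) \<le> (\<Sum>j\<in>J. \<bar>a j s - a j t\<bar> * L2_norm \<Omega> (g j))"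
          using L2_norm_sum_scaleR_le[of J g \<Omega> "\<lambda>j. a j s - a j t"] L by (simp add: L2_norm_nonneg)
      qed
    qed
    show "AE x in lebesgue_on \<Omega>. y 0 x = (\<Sum>j\<in>J. a j 0 * g j x)" by (simp add: y_def)
    show "\<exists>G. strongly_measurable {0<..<T} \<Omega> G \<and>
        integrable (lebesgue_on {0<..<T}) (\<lambda>t. (L2_norm \<Omega> (G t))\<^sup>2) \<and>
        (AE t in lebesgue_on {0<..<T}. H10_gradient \<Omega> (y t) (G t)) \<and>
        (\<forall>\<phi> \<psi>. H10_gradient \<Omega> \<phi> \<psi> \<longrightarrow> (\<forall>t\<in>{0..T}.
              L2_inner \<Omega> (y t) \<phi> - L2_inner \<Omega> (\<lambda>x. \<Sum>j\<in>J. a j 0 * g j x) \<phi>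
                + (LINT s|lebesgue_on {0<..<t}. L2_inner \<Omega> (G s) \<psi>)
              = (LINT s|lebesgue_on {0<..<t}. L2_inner \<Omega> (\<lambda>x. indicator \<omega> x * u s x) \<phi>)))"
    proof (intro exI[of _ G] conjI allI impI ballI)
      show "strongly_measurable {0<..<T} \<Omega> G"
        unfolding G_def by (intro strongly_measurable_sum J L continuous_lebesgue_on_measurable ac) auto
      have n2: "(\<lambda>t. (L2_norm \<Omega> (G t))\<^sup>2) = (\<lambda>t. \<Sum>j\<in>J. a j t * (\<Sum>i\<in>J. a i t * L2_inner \<Omega> (\<gamma> i) (\<gamma> j)))"
        by (simp add: L2_norm_power2 G_inner[OF GL] L2_inner_commute[of \<Omega> "\<gamma> _" "G _"] G_inner[OF L(2)] cong: sum.cong)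
      have nc: "continuous_on {0..T} (\<lambda>t. \<Sum>j\<in>J. a j t * (\<Sum>i\<in>J. a i t * L2_inner \<Omega> (\<gamma> i) (\<gamma> j)))"
        by (intro continuous_intros continuous_on_subset[OF ac]) auto
      show "integrable (lebesgue_on {0<..<T}) (\<lambda>t. (L2_norm \<Omega> (G t))\<^sup>2)"
        unfolding n2 by (rule time_integral_continuous(1)[OF nc])
      show "AE t in lebesgue_on {0<..<T}. H10_gradient \<Omega> (y t) (G t)" by (simp add: yH)
      fix \<phi> \<psi> t assume \<phi>: "H10_gradient \<Omega> \<phi> \<psi>" and t: "t \<in> {0..T}"
      note L\<phi> = H10_gradient_L2[OF \<phi>]
      define P where "P = (\<lambda>s. \<Sum>j\<in>J. a j s * L2_inner \<Omega> (p j) \<phi>)"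
      define D where "D = (\<lambda>s. \<Sum>j\<in>J. a' j s * L2_inner \<Omega> (g j) \<phi>)"
      have Pc: "continuous_on UNIV P" unfolding P_def by (intro continuous_intros ac)
      have Dc: "continuous_on UNIV D" unfolding D_def by (intro continuous_intros a(2))
      have "L2_inner \<Omega> (G s) \<psi> = P s" for s
        unfolding G_inner[OF L\<phi>(2)] P_def using p(2)[OF _ \<phi>] by simp
      moreover have "L2_inner \<Omega> (\<lambda>x. indicator \<omega> x * u s x) \<phi> = D s + P s" for s
      proof -
        have "L2_inner \<Omega> (\<lambda>x. indicator \<omega> x * u s x) \<phi> = (\<Sum>j\<in>J. L2_inner \<Omega> (\<lambda>x. a' j s * g j x + a j s * p j x) \<phi>)"
          unfolding u using L p L\<phi> by (intro L2_inner_sum_left) (auto intro!: L2_add L2_mult)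
        also have "\<dots> = (\<Sum>j\<in>J. a' j s * L2_inner \<Omega> (g j) \<phi> + a j s * L2_inner \<Omega> (p j) \<phi>)"
          using L p L\<phi> by (intro sum.cong refl) (simp add: L2_inner_add_left L2_mult L2_inner_mult_left)
        finally show ?thesis by (simp add: D_def P_def sum.distrib)
      qed
      moreover have "(LINT s|lebesgue_on {0<..<t}. D s) = L2_inner \<Omega> (y t) \<phi> - L2_inner \<Omega> (y 0) \<phi>"
        unfolding y_inner[OF L\<phi>(1)]
        by (rule time_integral_derivative[OF _ _ Dc])
           (use t in \<open>auto simp: D_def intro!: derivative_eq_intros a(1)\<close>)
      moreover have "(LINT s|lebesgue_on {0<..<t}. D s + P s)
          = (LINT s|lebesgue_on {0<..<t}. D s) + (LINT s|lebesgue_on {0<..<t}. P s)"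
        by (intro Bochner_Integration.integral_add time_integral_continuous(1) continuous_on_subset[OF Pc] continuous_on_subset[OF Dc]) auto
      ultimately show "L2_inner \<Omega> (y t) \<phi> - L2_inner \<Omega> (\<lambda>x. \<Sum>j\<in>J. a j 0 * g j x) \<phi>
                + (LINT s|lebesgue_on {0<..<t}. L2_inner \<Omega> (G s) \<psi>)
              = (LINT s|lebesgue_on {0<..<t}. L2_inner \<Omega> (\<lambda>x. indicator \<omega> x * u s x) \<phi>)"
        by (simp add: y_def)
    qed
  qed
qed

section \<open>The effect of a control on a single mode\<close>

text \<open>Gronwall's argument for \<open>c' = - \<mu> * c + F'\<close> in integrated form.  Only \<open>F\<close> is controlled, not its
  derivative, so the estimate is made for the integral of the deviation from the free decay: after multiplication by
  \<open>exp (\<mu> * t)\<close> its excess over \<open>M * t\<^sup>2\<close> is nonincreasing.\<close>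

lemma perturbed_decay_integral_le:
  fixes c F :: "real \<Rightarrow> real"
  assumes c: "continuous_on {0..T} c" and \<mu>: "0 < \<mu>" and M: "0 \<le> M"
    and eq: "\<And>t. t \<in> {0..T} \<Longrightarrow> c t = c0 - \<mu> * integral {0..t} c + F t"
    and F: "\<And>t. t \<in> {0..T} \<Longrightarrow> F t \<le> M * t" and t: "t \<in> {0..T}"
  shows "integral {0..t} c - c0 * (1 - exp (- \<mu> * t)) / \<mu> \<le> M * t\<^sup>2"
proof -
  define g where "g = (\<lambda>s. exp (\<mu> * s) * (integral {0..s} c - c0 * (1 - exp (- \<mu> * s)) / \<mu> - M * s\<^sup>2))"
  have C: "((\<lambda>s. integral {0..s} c) has_real_derivative c s) (at s within {0..T})" if "s \<in> {0..T}" for s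
    by (rule integral_has_real_derivative[OF c that])
  have "g t \<le> g 0"
  proof (rule DERIV_nonpos_imp_decreasing_open[of 0 t g])
    show "0 \<le> t" using t by simp
    have "continuous_on {0..T} (\<lambda>s. integral {0..s} c)"
      by (rule DERIV_continuous_on[OF C])
    then have "continuous_on {0..t} (\<lambda>s. integral {0..s} c)" using t by (auto elim: continuous_on_subset)
    then show "continuous_on {0..t} g" unfolding g_def using \<mu> by (intro continuous_intros) auto
    fix s assume s: "0 < s" "s < t"
    have "((\<lambda>s. integral {0..s} c) has_real_derivative c s) (at s)"
      using C[of s] s t by (simp add: at_within_Icc_at)
    then have "(g has_real_derivative
        exp (\<mu> * s) * \<mu> * (integral {0..s} c - c0 * (1 - exp (- \<mu> * s)) / \<mu> - M * s\<^sup>2)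
        + exp (\<mu> * s) * (c s - c0 * exp (- \<mu> * s) - M * (2 * s))) (at s)"
      unfolding g_def using \<mu> by (auto intro!: derivative_eq_intros simp: field_simps)
    moreover have "exp (\<mu> * s) * \<mu> * (integral {0..s} c - c0 * (1 - exp (- \<mu> * s)) / \<mu> - M * s\<^sup>2)
        + exp (\<mu> * s) * (c s - c0 * exp (- \<mu> * s) - M * (2 * s))
        = exp (\<mu> * s) * (F s - \<mu> * M * s\<^sup>2 - 2 * M * s)"
    proof -
      have es: "c s = c0 - \<mu> * integral {0..s} c + F s" using eq[of s] s t by simp
      show ?thesis unfolding es using \<mu> by (simp add: field_simps)
    qed
    moreover have "exp (\<mu> * s) * (F s - \<mu> * M * s\<^sup>2 - 2 * M * s) \<le> 0"
    proof (rule mult_nonneg_nonpos)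
      have "0 \<le> M * s" "0 \<le> \<mu> * M * s\<^sup>2" using M s \<mu> by auto
      then show "F s - \<mu> * M * s\<^sup>2 - 2 * M * s \<le> 0" using F[of s] s t by simp
    qed simp
    ultimately show "\<exists>y. (g has_real_derivative y) (at s) \<and> y \<le> 0" by metis
  qed
  then show ?thesis by (simp add: g_def mult_le_0_iff)
qed

lemma perturbed_decay:
  fixes c F :: "real \<Rightarrow> real"
  assumes c: "continuous_on {0..T} c" and \<mu>: "0 < \<mu>" and M: "0 \<le> M"
    and eq: "\<And>t. t \<in> {0..T} \<Longrightarrow> c t = c0 - \<mu> * integral {0..t} c + F t"
    and F: "\<And>t. t \<in> {0..T} \<Longrightarrow> \<bar>F t\<bar> \<le> M * t" and t: "t \<in> {0..T}"
  shows "\<bar>c t - c0 * exp (- \<mu> * t)\<bar> \<le> (\<mu> * t\<^sup>2 + t) * M"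
proof -
  define D where "D = integral {0..t} c - c0 * (1 - exp (- \<mu> * t)) / \<mu>"
  have "D \<le> M * t\<^sup>2"
    unfolding D_def by (rule perturbed_decay_integral_le[OF c \<mu> M eq _ t]) (use F in force)+
  moreover have "- D \<le> M * t\<^sup>2"
  proof -
    have "integral {0..t} (\<lambda>t. - c t) - (- c0) * (1 - exp (- \<mu> * t)) / \<mu> \<le> M * t\<^sup>2"
    proof (rule perturbed_decay_integral_le[where T = T and F = "\<lambda>t. - F t"])
      show "- c s = - c0 - \<mu> * integral {0..s} (\<lambda>t. - c t) + - F s" if "s \<in> {0..T}" for s
        using eq[OF that] by simp
      show "- F s \<le> M * s" if "s \<in> {0..T}" for s using F[OF that] by simp
    qed (use c \<mu> M t in \<open>auto intro: continuous_intros\<close>)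
    then show ?thesis by (simp add: D_def)
  qed
  ultimately have "\<bar>\<mu> * D\<bar> \<le> \<mu> * (M * t\<^sup>2)"
    using \<mu> by (simp add: abs_mult)
  moreover have "c t - c0 * exp (- \<mu> * t) = - (\<mu> * D) + F t"
  proof -
    have "\<mu> * D = \<mu> * integral {0..t} c - c0 * (1 - exp (- \<mu> * t))"
      using \<mu> by (simp add: D_def field_simps)
    then show ?thesis unfolding eq[OF t] by (simp add: right_diff_distrib)
  qed
  ultimately show ?thesis using F[OF t] by (simp add: algebra_simps)
qed

lemma L2_norm_indicator_le:
  fixes f :: "'a::euclidean_space \<Rightarrow> real"
  assumes "f \<in> L2 \<Omega>" "\<omega> \<in> sets lebesgue"
  shows "(\<lambda>x. indicator \<omega> x * f x) \<in> L2 \<Omega>" "L2_norm \<Omega> (\<lambda>x. indicator \<omega> x * f x) \<le> L2_norm \<Omega> f"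
proof -
  have m: "(\<lambda>x. indicator \<omega> x * f x) \<in> borel_measurable (lebesgue_on \<Omega>)"
  proof (intro borel_measurable_times)
    show "indicator \<omega> \<in> borel_measurable (lebesgue_on \<Omega>)"
      using assms(2) by (intro measurable_restrict_space1 borel_measurable_indicator)
  qed (use assms in \<open>auto simp: L2_def\<close>)
  have "(\<integral>\<^sup>+x. ennreal ((norm (indicator \<omega> x * f x))\<^sup>2) \<partial>lebesgue_on \<Omega>)
      \<le> (\<integral>\<^sup>+x. ennreal ((norm (f x))\<^sup>2) \<partial>lebesgue_on \<Omega>)"
    by (intro nn_integral_mono ennreal_leI) (auto simp: indicator_def)
  also have "\<dots> = ennreal ((L2_norm \<Omega> f)\<^sup>2)" by (rule nn_integral_norm_power2[OF assms(1)])
  finally show "(\<lambda>x. indicator \<omega> x * f x) \<in> L2 \<Omega>" "L2_norm \<Omega> (\<lambda>x. indicator \<omega> x * f x) \<le> L2_norm \<Omega> f"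
    using L2_if_nn_integral_le[OF m _ L2_norm_nonneg] by auto
qed

text \<open>Testing the weak form with an eigenfunction gives a scalar equation for that coefficient, in which a
  control of size \<open>M\<close> enters as a forcing of size at most \<open>M\<close>.\<close>

theorem heat_solution_mode_estimate:
  fixes \<Omega> \<omega> :: "'a::euclidean_space set"
  assumes \<omega>: "\<omega> \<in> sets lebesgue" and e: "eigenpair \<Omega> e \<gamma> \<mu>" "0 < \<mu>"
    and y: "heat_solution \<Omega> \<omega> T y0 u y"
    and u: "\<And>t. t \<in> {0<..<T} \<Longrightarrow> u t \<in> L2 \<Omega>" "AE t in lebesgue_on {0<..<T}. L2_norm \<Omega> (u t) \<le> M" "0 \<le> M"
    and t: "t \<in> {0..T}"
  shows "\<bar>L2_inner \<Omega> (y t) e - exp (- \<mu> * t) * L2_inner \<Omega> y0 e\<bar> \<le> (\<mu> * t\<^sup>2 + t) * M"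
proof -
  note eL = eigenpairD[OF e(1)]
  define c where "c = (\<lambda>t. L2_inner \<Omega> (y t) e)"
  define F where "F = (\<lambda>t. LINT s|lebesgue_on {0<..<t}. L2_inner \<Omega> (\<lambda>x. indicator \<omega> x * u s x) e)"
  have yL: "\<And>t. t \<in> {0..T} \<Longrightarrow> y t \<in> L2 \<Omega>"
    and yc: "\<And>t. t \<in> {0..T} \<Longrightarrow> ((\<lambda>s. L2_dist \<Omega> (y s) (y t)) \<longlongrightarrow> 0) (at t within {0..T})"
    using y by (auto simp: heat_solution_def)
  obtain G where GH: "AE t in lebesgue_on {0<..<T}. H10_gradient \<Omega> (y t) (G t)"
    and weak': "\<forall>\<phi> \<psi>. H10_gradient \<Omega> \<phi> \<psi> \<longrightarrow> (\<forall>t\<in>{0..T}.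
              L2_inner \<Omega> (y t) \<phi> - L2_inner \<Omega> y0 \<phi> + (LINT s|lebesgue_on {0<..<t}. L2_inner \<Omega> (G s) \<psi>)
              = (LINT s|lebesgue_on {0<..<t}. L2_inner \<Omega> (\<lambda>x. indicator \<omega> x * u s x) \<phi>))"
    using y unfolding heat_solution_def by (elim conjE exE)
  note weak = weak'[rule_format]
  have cc: "continuous_on {0..T} c"
    unfolding continuous_on_def
  proof
    fix t assume t: "t \<in> {0..T}"
    show "(c \<longlongrightarrow> c t) (at t within {0..T})"
    proof (rule Lim_transform2[OF tendsto_const], rule Lim_null_comparison[OF _ yc[OF t]])
      have "\<forall>\<^sub>F s in at t within {0..T}. s \<in> {0..T}" by (simp add: eventually_at_filter)
      then show "\<forall>\<^sub>F s in at t within {0..T}. norm (c t - c s) \<le> L2_dist \<Omega> (y s) (y t)"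
      proof eventually_elim
        case (elim s)
        have "c t - c s = - L2_inner \<Omega> (\<lambda>x. y s x - y t x) e"
          using yL[OF t] yL[OF elim] eL by (simp add: c_def L2_inner_diff_left)
        then show ?case
          using L2_Cauchy_Schwarz[OF L2_diff[OF yL[OF elim] yL[OF t]] eL(2)] eL(4) by simp
      qed
    qed
  qed
  have "AE s in lebesgue_on {0<..<T}. L2_inner \<Omega> (G s) \<gamma> = \<mu> * c s"
    using GH
  proof eventually_elim
    case (elim s)
    then show ?case using eigenpair_eq[OF e(1) elim] by (simp add: c_def L2_inner_commute)
  qed
  then have Gc: "(LINT s|lebesgue_on {0<..<t}. L2_inner \<Omega> (G s) \<gamma>) = \<mu> * integral {0..t} c" if "t \<in> {0..T}" for t
  proof -
    have ct: "continuous_on {0..t} (\<lambda>s. \<mu> * c s)"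
      using that by (intro continuous_intros continuous_on_subset[OF cc]) auto
    have "(LINT s|lebesgue_on {0<..<t}. L2_inner \<Omega> (G s) \<gamma>) = (LINT s|lebesgue_on {0<..<t}. \<mu> * c s)"
      by (rule time_integral_cong_AE[OF time_integral_continuous(1)[OF ct]])
         (use \<open>AE s in lebesgue_on {0<..<T}. L2_inner \<Omega> (G s) \<gamma> = \<mu> * c s\<close> that in auto)
    then show ?thesis using time_integral_continuous(2)[OF ct] by simp
  qed
  have "AE s in lebesgue_on {0<..<T}. \<bar>L2_inner \<Omega> (\<lambda>x. indicator \<omega> x * u s x) e\<bar> \<le> M"
  proof -
    have "AE s in lebesgue_on {0<..<T}. s \<in> {0<..<T}" by (intro AE_I2) simp
    with u(2) show ?thesis
    proof eventually_elim
      case (elim s)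
      note ui = L2_norm_indicator_le[OF u(1)[OF elim(2)] \<omega>]
      have "\<bar>L2_inner \<Omega> (\<lambda>x. indicator \<omega> x * u s x) e\<bar> \<le> L2_norm \<Omega> (\<lambda>x. indicator \<omega> x * u s x) * 1"
        using L2_Cauchy_Schwarz[OF ui(1) eL(2)] eL(4) by simp
      then show ?case using ui(2) elim(1) by simp
    qed
  qed
  then have F: "\<bar>F t\<bar> \<le> M * t" if "t \<in> {0..T}" for t
    unfolding F_def using that u(3) by (intro abs_time_integral_le) auto
  have eq: "c t = L2_inner \<Omega> y0 e - \<mu> * integral {0..t} c + F t" if "t \<in> {0..T}" for t
    using weak[OF eL(1) that] Gc[OF that] by (simp add: c_def F_def)
  show ?thesis
    using perturbed_decay[OF cc e(2) u(3) eq F t] by (simp add: c_def mult.commute)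
qed

section \<open>The target\<close>

text \<open>The target depends on two coefficients, cut off by a large ball.  The zero function is an interior point:
  both linear inequalities are strict there because \<open>\<alpha>\<close> and \<open>m * c\<close> are positive.\<close>

lemma wedge_in_targets:
  fixes \<Omega> :: "'a::euclidean_space set"
  assumes e: "e\<^sub>1 \<in> L2 \<Omega>" "e\<^sub>2 \<in> L2 \<Omega>" "L2_norm \<Omega> e\<^sub>1 = 1" "L2_norm \<Omega> e\<^sub>2 = 1"
    and pos: "0 < \<alpha>" "0 < m" "0 < c" "0 < B"
  shows "{f \<in> L2 \<Omega>. L2_norm \<Omega> f \<le> B \<and> L2_inner \<Omega> f e\<^sub>1 \<le> \<alpha> \<and>
      m * (L2_inner \<Omega> f e\<^sub>1 - c) \<le> L2_inner \<Omega> f e\<^sub>2} \<in> targets \<Omega>" (is "?Q \<in> _")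
proof -
  have "L2_bounded \<Omega> ?Q" unfolding L2_bounded_def by (intro exI[of _ B]) auto
  moreover have "L2_closed \<Omega> ?Q"
    unfolding L2_closed_def
  proof (intro ballI impI)
    fix f assume f: "f \<in> L2 \<Omega>" and approx: "\<forall>\<epsilon>>0. \<exists>g\<in>?Q. L2_dist \<Omega> g f < \<epsilon>"
    have "\<forall>n. \<exists>g. g \<in> ?Q \<and> L2_dist \<Omega> g f < 1 / Suc n"
    proof
      fix n
      have "0 < 1 / real (Suc n)" by simp
      from approx[rule_format, OF this] show "\<exists>g. g \<in> ?Q \<and> L2_dist \<Omega> g f < 1 / Suc n"
        unfolding Bex_def .
    qed
    from choice[OF this] obtain g where g': "\<forall>n. g n \<in> ?Q \<and> L2_dist \<Omega> (g n) f < 1 / Suc n"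
      by (elim exE)
    then have g: "\<And>n. g n \<in> ?Q" "\<And>n. L2_dist \<Omega> (g n) f < 1 / Suc n" by simp_all
    have lim: "(\<lambda>n. L2_dist \<Omega> (g n) f) \<longlonglongrightarrow> 0"
    proof (rule Lim_null_comparison[OF _ LIMSEQ_Suc[OF lim_1_over_n]])
      show "\<forall>\<^sub>F n in sequentially. norm (L2_dist \<Omega> (g n) f) \<le> 1 / real (Suc n)"
        using g(2) by (intro always_eventually allI) (simp add: L2_norm_nonneg less_imp_le)
    qed
    have gL: "g n \<in> L2 \<Omega>" for n using g(1)[of n] by simp
    have "(\<lambda>n. L2_norm \<Omega> (g n)) \<longlonglongrightarrow> L2_norm \<Omega> f" by (rule L2_norm_tendsto[OF gL f lim])
    then have "L2_norm \<Omega> f \<le> B" by (rule LIMSEQ_le_const2) (use g(1) in auto)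
    moreover have X: "(\<lambda>n. L2_inner \<Omega> (g n) e\<^sub>1) \<longlonglongrightarrow> L2_inner \<Omega> f e\<^sub>1" by (rule L2_inner_tendsto[OF gL f e(1) lim])
    then have "L2_inner \<Omega> f e\<^sub>1 \<le> \<alpha>" by (rule LIMSEQ_le_const2) (use g(1) in auto)
    moreover have Y: "(\<lambda>n. L2_inner \<Omega> (g n) e\<^sub>2) \<longlonglongrightarrow> L2_inner \<Omega> f e\<^sub>2" by (rule L2_inner_tendsto[OF gL f e(2) lim])
    have "(\<lambda>n. m * (L2_inner \<Omega> (g n) e\<^sub>1 - c)) \<longlonglongrightarrow> m * (L2_inner \<Omega> f e\<^sub>1 - c)" by (intro tendsto_intros X)
    then have "m * (L2_inner \<Omega> f e\<^sub>1 - c) \<le> L2_inner \<Omega> f e\<^sub>2" by (rule LIMSEQ_le[OF _ Y]) (use g(1) in auto)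
    ultimately show "f \<in> ?Q" using f by simp
  qed
  moreover have "L2_convex ?Q"
    unfolding L2_convex_def
  proof (intro ballI)
    fix f g and s :: real assume f: "f \<in> ?Q" and g: "g \<in> ?Q" and s: "s \<in> {0..1}"
    let ?h = "\<lambda>x. (1 - s) * f x + s * g x"
    have L: "f \<in> L2 \<Omega>" "g \<in> L2 \<Omega>" using f g by auto
    have h: "?h \<in> L2 \<Omega>" by (intro L2_add L2_mult L)
    have inner: "L2_inner \<Omega> ?h e = (1 - s) * L2_inner \<Omega> f e + s * L2_inner \<Omega> g e" if "e \<in> L2 \<Omega>" for e
      using L2_inner_add_left[OF L2_mult[OF L(1)] L2_mult[OF L(2)] that] by (simp add: L2_inner_mult_left)
    have "L2_norm \<Omega> ?h \<le> (1 - s) * L2_norm \<Omega> f + s * L2_norm \<Omega> g"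
      using L2_norm_triangle[OF L2_mult[OF L(1)] L2_mult[OF L(2)], of "1 - s" s] s by (simp add: L2_norm_mult)
    also have "\<dots> \<le> B" using f g s by (intro convex_bound_le) auto
    finally have "L2_norm \<Omega> ?h \<le> B" .
    moreover have "L2_inner \<Omega> ?h e\<^sub>1 \<le> \<alpha>"
      unfolding inner[OF e(1)] using f g s by (intro convex_bound_le) auto
    moreover have "m * (L2_inner \<Omega> ?h e\<^sub>1 - c) \<le> L2_inner \<Omega> ?h e\<^sub>2"
    proof -
      have "m * (L2_inner \<Omega> ?h e\<^sub>1 - c) = (1 - s) * (m * (L2_inner \<Omega> f e\<^sub>1 - c)) + s * (m * (L2_inner \<Omega> g e\<^sub>1 - c))"
        unfolding inner[OF e(1)] by (simp add: algebra_simps)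
      also have "\<dots> \<le> (1 - s) * L2_inner \<Omega> f e\<^sub>2 + s * L2_inner \<Omega> g e\<^sub>2"
        using f g s by (intro add_mono mult_left_mono) auto
      finally show ?thesis unfolding inner[OF e(2)] .
    qed
    ultimately show "?h \<in> ?Q" using h by simp
  qed
  moreover have "(\<lambda>x. 0) \<in> L2_interior \<Omega> ?Q"
  proof -
    \<comment> \<open>The last entry ensures \<open>m * r + r \<le> m * c\<close>: both coefficients may move by \<open>r\<close>.\<close>
    define r where "r = min B (min \<alpha> (m * c / (1 + m)))"
    have r: "0 < r" "r \<le> B" "r \<le> \<alpha>" "r \<le> m * c / (1 + m)" using pos by (auto simp: r_def)
    then have r': "m * r + r \<le> m * c" using pos by (simp add: field_simps)
    have "g \<in> ?Q" if g: "g \<in> L2 \<Omega>" "L2_norm \<Omega> g < r" for g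
    proof -
      have X: "\<bar>L2_inner \<Omega> g e\<^sub>1\<bar> \<le> r" "\<bar>L2_inner \<Omega> g e\<^sub>2\<bar> \<le> r"
        using L2_Cauchy_Schwarz[OF g(1) e(1)] L2_Cauchy_Schwarz[OF g(1) e(2)] e(3,4) g(2) by auto
      have "m * L2_inner \<Omega> g e\<^sub>1 \<le> m * r" using X pos by (intro mult_left_mono) auto
      then have "m * (L2_inner \<Omega> g e\<^sub>1 - c) \<le> L2_inner \<Omega> g e\<^sub>2"
        using X(2) r' by (simp add: algebra_simps)
      then show ?thesis using g r X by simp
    qed
    then show ?thesis using r(1) by (auto simp: L2_interior_def L2_zero)
  qed
  ultimately show ?thesis by (auto simp: targets_def)
qed

section \<open>A controlled trajectory\<close>

lemma eigenpair_uminus: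
  assumes \<Omega>: "bounded \<Omega>" "open \<Omega>" and e: "eigenpair \<Omega> e \<gamma> \<mu>"
  shows "eigenpair \<Omega> (\<lambda>x. - e x) (\<lambda>x. - \<gamma> x) \<mu>"
proof -
  have "H10_gradient \<Omega> (\<lambda>x. e x + (-2) * e x) (\<lambda>x. \<gamma> x + (-2) *\<^sub>R \<gamma> x)"
    by (intro H10_gradient_add_scaleR[OF \<Omega>] eigenpairD[OF e])
  moreover have "(\<lambda>x. e x + (-2) * e x) = (\<lambda>x. - e x)" by (simp add: fun_eq_iff)
  moreover have "(\<lambda>x. \<gamma> x + (-2) *\<^sub>R \<gamma> x) = (\<lambda>x. - \<gamma> x)"
    by (rule ext) (simp add: scaleR_2)
  moreover have "L2_norm \<Omega> (\<lambda>x. - e x) = 1"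
    using L2_norm_mult[of \<Omega> "-1" e] eigenpairD(4)[OF e] by simp
  ultimately show ?thesis
    using e by (simp add: eigenpair_def L2_inner_uminus_left)
qed

text \<open>Flipping the signs of the bump and of the second eigenfunction lets a positive multiple of \<open>\<phi>\<close> lower the
  first coefficient without lowering the second, which moves a point of the trajectory towards the target.\<close>

lemma exist_signed_modes:
  assumes \<Omega>: "bounded \<Omega>" "open \<Omega>" and \<omega>: "open \<omega>" "\<omega> \<noteq> {}" "\<omega> \<subseteq> \<Omega>"
  shows "\<exists>\<phi> e\<^sub>1 \<gamma>\<^sub>1 \<mu>\<^sub>1 e\<^sub>2 \<gamma>\<^sub>2 \<mu>\<^sub>2. test_function \<omega> \<phi> \<and> eigenpair \<Omega> e\<^sub>1 \<gamma>\<^sub>1 \<mu>\<^sub>1 \<and> eigenpair \<Omega> e\<^sub>2 \<gamma>\<^sub>2 \<mu>\<^sub>2 \<and>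
     0 < \<mu>\<^sub>1 \<and> \<mu>\<^sub>1 < \<mu>\<^sub>2 \<and> L2_inner \<Omega> \<phi> e\<^sub>1 < 0 \<and> 0 \<le> L2_inner \<Omega> \<phi> e\<^sub>2"
proof -
  from exist_two_eigenpairs[OF \<Omega> \<omega>]
  obtain \<phi>0 e\<^sub>1 \<gamma>\<^sub>1 \<mu>\<^sub>1 e\<^sub>2 \<gamma>\<^sub>2 \<mu>\<^sub>2 where 1: "test_function \<omega> \<phi>0" "eigenpair \<Omega> e\<^sub>1 \<gamma>\<^sub>1 \<mu>\<^sub>1" "eigenpair \<Omega> e\<^sub>2 \<gamma>\<^sub>2 \<mu>\<^sub>2"
    "0 < \<mu>\<^sub>1" "\<mu>\<^sub>1 < \<mu>\<^sub>2" "L2_inner \<Omega> \<phi>0 e\<^sub>1 \<noteq> 0" by (elim exE conjE)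
  define \<phi> where "\<phi> = (\<lambda>x. - L2_inner \<Omega> \<phi>0 e\<^sub>1 * \<phi>0 x)"
  have \<phi>: "test_function \<omega> \<phi>" unfolding \<phi>_def by (rule test_function_scale[OF 1(1)])
  have "L2_inner \<Omega> \<phi> e\<^sub>1 = - (L2_inner \<Omega> \<phi>0 e\<^sub>1)\<^sup>2"
    unfolding \<phi>_def by (simp only: L2_inner_mult_left) (simp add: power2_eq_square)
  then have neg: "L2_inner \<Omega> \<phi> e\<^sub>1 < 0" using 1(6) by simp
  show ?thesis
  proof (cases "0 \<le> L2_inner \<Omega> \<phi> e\<^sub>2")
    case True
    with \<phi> neg 1 show ?thesis by (intro exI conjI)
  next
    case False
    then have "0 \<le> L2_inner \<Omega> \<phi> (\<lambda>x. - e\<^sub>2 x)"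
      by (simp add: L2_inner_commute[of \<Omega> \<phi>] L2_inner_uminus_left)
    with \<phi> neg 1 eigenpair_uminus[OF \<Omega> 1(3)] show ?thesis by (intro exI conjI)
  qed
qed

text \<open>The free evolution of \<open>e\<^sub>1 + e\<^sub>2\<close>, plus a multiple of \<open>\<phi>\<close> that starts at zero and stays bounded
  together with its time derivative; \<open>steering\<close> is the result of applying \<open>\<partial>\<^sub>t - \<Delta>\<close> to that multiple.\<close>

definition trajectory ::
  "('a \<Rightarrow> real) \<Rightarrow> ('a \<Rightarrow> real) \<Rightarrow> real \<Rightarrow> real \<Rightarrow> ('a \<Rightarrow> real) \<Rightarrow> real \<Rightarrow> real \<Rightarrow> 'a \<Rightarrow> real" where
  "trajectory e\<^sub>1 e\<^sub>2 \<mu>\<^sub>1 \<mu>\<^sub>2 \<phi> \<kappa> t x =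
     exp (- \<mu>\<^sub>1 * t) * e\<^sub>1 x + exp (- \<mu>\<^sub>2 * t) * e\<^sub>2 x + \<kappa> * (1 - exp (- t)) * \<phi> x"

definition steering :: "('a::euclidean_space \<Rightarrow> real) \<Rightarrow> real \<Rightarrow> real \<Rightarrow> 'a \<Rightarrow> real" where
  "steering \<phi> \<kappa> t x = \<kappa> * exp (- t) * \<phi> x + \<kappa> * (1 - exp (- t)) * neg_laplacian \<phi> x"

context
  fixes \<Omega> \<omega> :: "'a::euclidean_space set"
  assumes \<Omega>: "bounded \<Omega>" "open \<Omega>" and \<omega>: "\<omega> \<subseteq> \<Omega>"
begin

lemma heat_solution_trajectory:
  assumes e: "eigenpair \<Omega> e\<^sub>1 \<gamma>\<^sub>1 \<mu>\<^sub>1" "eigenpair \<Omega> e\<^sub>2 \<gamma>\<^sub>2 \<mu>\<^sub>2" and \<phi>: "test_function \<omega> \<phi>"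
  shows "heat_solution \<Omega> \<omega> T (\<lambda>x. e\<^sub>1 x + e\<^sub>2 x) (steering \<phi> \<kappa>) (trajectory e\<^sub>1 e\<^sub>2 \<mu>\<^sub>1 \<mu>\<^sub>2 \<phi> \<kappa>)"
proof -
  have \<phi>\<Omega>: "test_function \<Omega> \<phi>" by (rule test_function_mono[OF \<phi> \<omega>])
  define g where "g = (\<lambda>j::nat. if j = 0 then e\<^sub>1 else if j = 1 then e\<^sub>2 else \<phi>)"
  define \<gamma> where "\<gamma> = (\<lambda>j::nat. if j = 0 then \<gamma>\<^sub>1 else if j = 1 then \<gamma>\<^sub>2 else grad \<phi>)"
  define p where "p = (\<lambda>j::nat. if j = 0 then (\<lambda>x. \<mu>\<^sub>1 * e\<^sub>1 x) else if j = 1 then (\<lambda>x. \<mu>\<^sub>2 * e\<^sub>2 x) else neg_laplacian \<phi>)"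
  define a where "a = (\<lambda>(j::nat) t. if j = 0 then exp (- \<mu>\<^sub>1 * t) else if j = 1 then exp (- \<mu>\<^sub>2 * t) else \<kappa> * (1 - exp (- t)))"
  define a' where "a' = (\<lambda>(j::nat) t. if j = 0 then - \<mu>\<^sub>1 * exp (- \<mu>\<^sub>1 * t) else if j = 1 then - \<mu>\<^sub>2 * exp (- \<mu>\<^sub>2 * t) else \<kappa> * exp (- t))"
  have "heat_solution \<Omega> \<omega> T (\<lambda>x. \<Sum>j\<in>{0,1,2}. a j 0 * g j x) (steering \<phi> \<kappa>) (\<lambda>t x. \<Sum>j\<in>{0,1,2}. a j t * g j x)"
  proof (rule modal_heat_solution[OF \<Omega>, where \<gamma> = \<gamma> and p = p and a' = a'])
    show "H10_gradient \<Omega> (g j) (\<gamma> j)" for j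
      using eigenpairD(1)[OF e(1)] eigenpairD(1)[OF e(2)] H10_test_function[OF \<Omega> \<phi>\<Omega>] by (simp add: g_def \<gamma>_def)
    show "p j \<in> L2 \<Omega>" for j
      using eigenpairD(2)[OF e(1)] eigenpairD(2)[OF e(2)] test_function_L2[OF \<Omega> test_function_neg_laplacian[OF \<phi>\<Omega>]]
      by (simp add: p_def L2_mult)
    show "L2_inner \<Omega> (\<gamma> j) \<psi> = L2_inner \<Omega> (p j) \<phi>'" if "H10_gradient \<Omega> \<phi>' \<psi>" for j \<phi>' \<psi>
      using eigenpair_eq[OF e(1) that] eigenpair_eq[OF e(2) that] H10_integration_by_parts[OF \<Omega> \<phi>\<Omega> that]
      by (simp add: p_def \<gamma>_def L2_inner_mult_left)
    show "(a j has_real_derivative a' j t) (at t)" for j t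
      unfolding a_def a'_def by (cases "j = 0"; cases "j = 1") (auto intro!: derivative_eq_intros)
    show "continuous_on UNIV (a' j)" for j
      unfolding a'_def by (cases "j = 0"; cases "j = 1") (auto intro!: continuous_intros)
    show "indicator \<omega> x * steering \<phi> \<kappa> t x = (\<Sum>j\<in>{0,1,2}. a' j t * g j x + a j t * p j x)" for t x
      using test_function_eq_0[OF \<phi>, of x] test_function_eq_0[OF test_function_neg_laplacian[OF \<phi>], of x]
      by (auto simp: a_def a'_def g_def p_def steering_def indicator_def)
  qed simp
  then show ?thesis
    by (simp add: a_def g_def trajectory_def[abs_def] add.assoc)
qed

lemma trajectory_coordinates:
  assumes e: "eigenpair \<Omega> e\<^sub>1 \<gamma>\<^sub>1 \<mu>\<^sub>1" "eigenpair \<Omega> e\<^sub>2 \<gamma>\<^sub>2 \<mu>\<^sub>2" "\<mu>\<^sub>1 < \<mu>\<^sub>2" and \<phi>: "test_function \<omega> \<phi>"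
  shows "trajectory e\<^sub>1 e\<^sub>2 \<mu>\<^sub>1 \<mu>\<^sub>2 \<phi> \<kappa> t \<in> L2 \<Omega>"
    and "L2_inner \<Omega> (trajectory e\<^sub>1 e\<^sub>2 \<mu>\<^sub>1 \<mu>\<^sub>2 \<phi> \<kappa> t) e\<^sub>1 = exp (- \<mu>\<^sub>1 * t) + \<kappa> * (1 - exp (- t)) * L2_inner \<Omega> \<phi> e\<^sub>1"
    and "L2_inner \<Omega> (trajectory e\<^sub>1 e\<^sub>2 \<mu>\<^sub>1 \<mu>\<^sub>2 \<phi> \<kappa> t) e\<^sub>2 = exp (- \<mu>\<^sub>2 * t) + \<kappa> * (1 - exp (- t)) * L2_inner \<Omega> \<phi> e\<^sub>2"
proof -
  have o: "L2_inner \<Omega> e\<^sub>1 e\<^sub>2 = 0" "L2_inner \<Omega> e\<^sub>2 e\<^sub>1 = 0"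
    using eigenpair_orthogonal[OF e(1,2)] e(3) by (auto simp: L2_inner_commute[of \<Omega> e\<^sub>2 e\<^sub>1])
  have L: "e\<^sub>1 \<in> L2 \<Omega>" "e\<^sub>2 \<in> L2 \<Omega>" "\<phi> \<in> L2 \<Omega>"
    using eigenpairD(2)[OF e(1)] eigenpairD(2)[OF e(2)] test_function_L2[OF \<Omega> test_function_mono[OF \<phi> \<omega>]] by auto
  show "trajectory e\<^sub>1 e\<^sub>2 \<mu>\<^sub>1 \<mu>\<^sub>2 \<phi> \<kappa> t \<in> L2 \<Omega>"
    unfolding trajectory_def[abs_def] by (intro L2_add L2_mult L)
  have "L2_inner \<Omega> (trajectory e\<^sub>1 e\<^sub>2 \<mu>\<^sub>1 \<mu>\<^sub>2 \<phi> \<kappa> t) h = exp (- \<mu>\<^sub>1 * t) * L2_inner \<Omega> e\<^sub>1 h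
      + exp (- \<mu>\<^sub>2 * t) * L2_inner \<Omega> e\<^sub>2 h + \<kappa> * (1 - exp (- t)) * L2_inner \<Omega> \<phi> h" if "h \<in> L2 \<Omega>" for h
    unfolding trajectory_def[abs_def]
    by (subst L2_inner_add_left[OF L2_add[OF L2_mult[OF L(1)] L2_mult[OF L(2)]] L2_mult[OF L(3)] that],
        subst L2_inner_add_left[OF L2_mult[OF L(1)] L2_mult[OF L(2)] that])
       (simp only: L2_inner_mult_left)
  from this[OF L(1)] this[OF L(2)]
  show "L2_inner \<Omega> (trajectory e\<^sub>1 e\<^sub>2 \<mu>\<^sub>1 \<mu>\<^sub>2 \<phi> \<kappa> t) e\<^sub>1 = exp (- \<mu>\<^sub>1 * t) + \<kappa> * (1 - exp (- t)) * L2_inner \<Omega> \<phi> e\<^sub>1"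
    and "L2_inner \<Omega> (trajectory e\<^sub>1 e\<^sub>2 \<mu>\<^sub>1 \<mu>\<^sub>2 \<phi> \<kappa> t) e\<^sub>2 = exp (- \<mu>\<^sub>2 * t) + \<kappa> * (1 - exp (- t)) * L2_inner \<Omega> \<phi> e\<^sub>2"
    by (simp_all add: o eigenpairD(5)[OF e(1)] eigenpairD(5)[OF e(2)])
qed

lemma steering_admissible:
  assumes \<phi>: "test_function \<omega> \<phi>" and I: "I \<in> sets lebesgue" "I \<subseteq> {0<..}" and \<kappa>: "0 \<le> \<kappa>"
  defines "C \<equiv> L2_norm \<Omega> \<phi> + L2_norm \<Omega> (neg_laplacian \<phi>)"
  shows "steering \<phi> \<kappa> \<in> Linfty_L2 I \<Omega>" "AE t in lebesgue_on I. L2_norm \<Omega> (steering \<phi> \<kappa> t) \<le> \<kappa> * C"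
    "Linfty_norm I \<Omega> (steering \<phi> \<kappa>) \<le> ereal (\<kappa> * C)"
proof -
  have \<phi>\<Omega>: "test_function \<Omega> \<phi>" by (rule test_function_mono[OF \<phi> \<omega>])
  let ?p = "neg_laplacian \<phi>"
  have L: "\<phi> \<in> L2 \<Omega>" "?p \<in> L2 \<Omega>"
    using test_function_L2[OF \<Omega> \<phi>\<Omega>] test_function_L2[OF \<Omega> test_function_neg_laplacian[OF \<phi>\<Omega>]] by auto
  have bound: "L2_norm \<Omega> (steering \<phi> \<kappa> t) \<le> \<kappa> * C" if "t \<in> I" for t
  proof -
    have t: "0 < t" using that I by auto
    have "L2_norm \<Omega> (steering \<phi> \<kappa> t) \<le> L2_norm \<Omega> (\<lambda>x. \<kappa> * exp (- t) * \<phi> x) + L2_norm \<Omega> (\<lambda>x. \<kappa> * (1 - exp (- t)) * ?p x)"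
      unfolding steering_def[abs_def] by (intro L2_norm_triangle L2_mult L)
    also have "\<dots> = \<kappa> * exp (- t) * L2_norm \<Omega> \<phi> + \<kappa> * (1 - exp (- t)) * L2_norm \<Omega> ?p"
      unfolding L2_norm_mult using \<kappa> t by (simp add: abs_mult)
    also have "\<dots> \<le> \<kappa> * 1 * L2_norm \<Omega> \<phi> + \<kappa> * 1 * L2_norm \<Omega> ?p"
      using \<kappa> t by (intro add_mono mult_right_mono mult_left_mono) (auto simp: L2_norm_nonneg)
    finally show ?thesis by (simp add: C_def algebra_simps)
  qed
  then show ae: "AE t in lebesgue_on I. L2_norm \<Omega> (steering \<phi> \<kappa> t) \<le> \<kappa> * C"
    using I by (intro AE_I2) simp
  have "strongly_measurable I \<Omega> (\<lambda>t x. (\<kappa> * exp (- t)) *\<^sub>R \<phi> x + (\<kappa> * (1 - exp (- t))) *\<^sub>R ?p x)"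
    by (intro strongly_measurable_add strongly_measurable_scaleR L I continuous_lebesgue_on_measurable continuous_intros)
  then have sm: "strongly_measurable I \<Omega> (steering \<phi> \<kappa>)" by (simp add: steering_def[abs_def])
  define N where "N = (\<lambda>t. (\<kappa> * exp (- t))\<^sup>2 * L2_inner \<Omega> \<phi> \<phi>
      + 2 * (\<kappa> * exp (- t)) * (\<kappa> * (1 - exp (- t))) * L2_inner \<Omega> \<phi> ?p
      + (\<kappa> * (1 - exp (- t)))\<^sup>2 * L2_inner \<Omega> ?p ?p)"
  have "L2_norm \<Omega> (steering \<phi> \<kappa> t) = sqrt (N t)" for t
  proof -
    have "(L2_norm \<Omega> (steering \<phi> \<kappa> t))\<^sup>2 = N t"
      unfolding N_def steering_def[abs_def] L2_norm_add_power2[OF L2_mult[OF L(1)] L2_mult[OF L(2)]] L2_norm_mult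
        L2_inner_mult_left L2_inner_mult_right L2_norm_power2[symmetric] power_mult_distrib power2_abs
      by simp
    then show ?thesis
      using L2_norm_nonneg[of \<Omega> "steering \<phi> \<kappa> t"] by (metis real_sqrt_abs abs_of_nonneg)
  qed
  moreover have "continuous_on UNIV (\<lambda>t. sqrt (N t))"
    unfolding N_def by (intro continuous_intros)
  ultimately have "(\<lambda>t. L2_norm \<Omega> (steering \<phi> \<kappa> t)) \<in> borel_measurable (lebesgue_on I)"
    using continuous_lebesgue_on_measurable[of "\<lambda>t. sqrt (N t)" I] by simp
  then show le: "Linfty_norm I \<Omega> (steering \<phi> \<kappa>) \<le> ereal (\<kappa> * C)"
    unfolding Linfty_norm_def using ae by (intro esssup_I) auto
  show "steering \<phi> \<kappa> \<in> Linfty_L2 I \<Omega>"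
    unfolding Linfty_L2_def using sm le by (auto intro: le_less_trans)
qed

end

lemma Linfty_norm_less_imp_AE:
  assumes "Linfty_norm I \<Omega> v < ereal M"
  shows "AE t in lebesgue_on I. L2_norm \<Omega> (v t) \<le> M"
proof -
  have "AE t in lebesgue_on I. ereal (L2_norm \<Omega> (v t)) \<le> Linfty_norm I \<Omega> v"
    unfolding Linfty_norm_def by (rule esssup_AE)
  then show ?thesis
  proof eventually_elim
    case (elim t)
    then have "ereal (L2_norm \<Omega> (v t)) < ereal M" using assms by (rule le_less_trans)
    then show ?case by simp
  qed
qed

lemma Linfty_norm_nonneg:
  assumes "0 < T"
  shows "0 \<le> Linfty_norm {0<..<T} \<Omega> v"
proof (rule ccontr)
  assume "\<not> 0 \<le> Linfty_norm {0<..<T} \<Omega> v"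
  then have neg: "Linfty_norm {0<..<T} \<Omega> v < 0" by simp
  have "AE t in lebesgue_on {0<..<T}. ereal (L2_norm \<Omega> (v t)) \<le> Linfty_norm {0<..<T} \<Omega> v"
    unfolding Linfty_norm_def by (rule esssup_AE)
  then have "AE t in lebesgue_on {0<..<T}. False"
  proof eventually_elim
    case (elim t)
    then have "ereal (L2_norm \<Omega> (v t)) < 0" using neg by (rule le_less_trans)
    then show ?case using L2_norm_nonneg[of \<Omega> "v t"] by simp
  qed
  from AE_E2[OF this] have "emeasure (lebesgue_on {0<..<T}) (space (lebesgue_on {0<..<T})) = 0"
    by (simp only: not_False_eq_True simp_thms Collect_mem_eq)
  then have "emeasure lborel {0<..<T} = 0"
    by (simp add: emeasure_restrict_space)
  then show False using assms by simp
qed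

section \<open>The gap in the minimal time function\<close>

definition reaches ::
    "'a::euclidean_space set \<Rightarrow> 'a set \<Rightarrow> ('a \<Rightarrow> real) \<Rightarrow> ('a \<Rightarrow> real) set \<Rightarrow> real \<Rightarrow> real \<Rightarrow> bool" where
  "reaches \<Omega> \<omega> y0 Q M t \<longleftrightarrow>
     (\<exists>u\<in>controls_bounded_by \<Omega> M. \<exists>y. heat_solution_global \<Omega> \<omega> y0 u y \<and> y t \<in> Q)"

lemma minimal_time_eq:
  "minimal_time \<Omega> \<omega> M y0 Q = Inf {ereal t | t. 0 \<le> t \<and> reaches \<Omega> \<omega> y0 Q M t}"
  by (simp add: minimal_time_def reaches_def)

lemma minimal_time_le: "reaches \<Omega> \<omega> y0 Q M t \<Longrightarrow> 0 \<le> t \<Longrightarrow> minimal_time \<Omega> \<omega> M y0 Q \<le> ereal t"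
  unfolding minimal_time_eq by (intro Inf_lower) auto

lemma le_minimal_time:
  assumes "\<And>t. 0 \<le> t \<Longrightarrow> reaches \<Omega> \<omega> y0 Q M t \<Longrightarrow> s \<le> t"
  shows "ereal s \<le> minimal_time \<Omega> \<omega> M y0 Q"
  unfolding minimal_time_eq by (rule Inf_greatest) (use assms in auto)

lemma minimal_time_less:
  assumes "minimal_time \<Omega> \<omega> M y0 Q < ereal s"
  shows "\<exists>t. 0 \<le> t \<and> t < s \<and> reaches \<Omega> \<omega> y0 Q M t"
  using assms unfolding minimal_time_eq Inf_less_iff by auto

text \<open>The minimal time jumps over the whole interval from \<open>t\<^sub>2\<close> to \<open>t\<^sub>3\<close>.  A bound of at least \<open>M\<^sub>1\<close>
  permits arrival at \<open>t\<^sub>1\<close>, and a bound of at most \<open>M\<^sub>1\<close> permits no arrival between \<open>t\<^sub>2\<close> and \<open>t\<^sub>3\<close>; so the horizontal line at height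
  \<open>t\<^sub>2\<close> misses the graph, although there are points of the graph above it (for \<open>M = 0\<close>) and below it (for \<open>M = M\<^sub>1\<close>).\<close>

lemma GT_set_not_connected:
  assumes M1: "0 \<le> M\<^sub>1" and large: "\<And>M. M\<^sub>1 \<le> M \<Longrightarrow> reaches \<Omega> \<omega> y0 Q M t\<^sub>1"
    and free: "reaches \<Omega> \<omega> y0 Q 0 t\<^sub>4" "0 \<le> t\<^sub>4" "\<And>t. 0 \<le> t \<Longrightarrow> reaches \<Omega> \<omega> y0 Q 0 t \<Longrightarrow> t\<^sub>3 \<le> t"
    and start: "\<And>t. 0 \<le> t \<Longrightarrow> reaches \<Omega> \<omega> y0 Q M\<^sub>1 t \<Longrightarrow> t\<^sub>0 \<le> t"
    and gap: "\<And>M t. 0 \<le> M \<Longrightarrow> M \<le> M\<^sub>1 \<Longrightarrow> t\<^sub>2 \<le> t \<Longrightarrow> t \<le> t\<^sub>3 \<Longrightarrow> \<not> reaches \<Omega> \<omega> y0 Q M t"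
    and t: "0 < t\<^sub>0" "t\<^sub>1 < t\<^sub>2" "t\<^sub>2 < t\<^sub>3" "0 \<le> t\<^sub>1"
  shows "\<not> connected (GT_set \<Omega> \<omega> y0 Q)"
proof
  let ?T = "\<lambda>M. minimal_time \<Omega> \<omega> M y0 Q"
  assume conn: "connected (GT_set \<Omega> \<omega> y0 Q)"
  have "ereal t\<^sub>3 \<le> ?T 0" by (rule le_minimal_time) (rule free(3))
  moreover have "?T 0 \<le> ereal t\<^sub>4" by (rule minimal_time_le[OF free(1,2)])
  ultimately obtain \<tau>\<^sub>0 where \<tau>\<^sub>0: "?T 0 = ereal \<tau>\<^sub>0" "t\<^sub>3 \<le> \<tau>\<^sub>0" by (cases "?T 0") auto
  have "ereal t\<^sub>0 \<le> ?T M\<^sub>1" by (rule le_minimal_time) (rule start)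
  moreover have "?T M\<^sub>1 \<le> ereal t\<^sub>1" by (rule minimal_time_le[OF large[OF order_refl] t(4)])
  ultimately obtain \<tau>\<^sub>1 where \<tau>\<^sub>1: "?T M\<^sub>1 = ereal \<tau>\<^sub>1" "t\<^sub>0 \<le> \<tau>\<^sub>1" "\<tau>\<^sub>1 \<le> t\<^sub>1" by (cases "?T M\<^sub>1") auto
  have "(0, \<tau>\<^sub>0) \<in> GT_set \<Omega> \<omega> y0 Q" "(M\<^sub>1, \<tau>\<^sub>1) \<in> GT_set \<Omega> \<omega> y0 Q"
    using \<tau>\<^sub>0 \<tau>\<^sub>1 t M1 by (auto simp: GT_set_def)
  then have "\<tau>\<^sub>0 \<in> snd ` GT_set \<Omega> \<omega> y0 Q" "\<tau>\<^sub>1 \<in> snd ` GT_set \<Omega> \<omega> y0 Q" by force+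
  moreover have "connected (snd ` GT_set \<Omega> \<omega> y0 Q)"
    by (intro connected_continuous_image continuous_intros conn)
  ultimately have "t\<^sub>2 \<in> snd ` GT_set \<Omega> \<omega> y0 Q"
    using connectedD_interval[of "snd ` GT_set \<Omega> \<omega> y0 Q" \<tau>\<^sub>1 \<tau>\<^sub>0 t\<^sub>2] \<tau>\<^sub>0(2) \<tau>\<^sub>1(3) t by linarith
  then obtain M where M: "0 \<le> M" "ereal t\<^sub>2 = ?T M" by (auto simp: GT_set_def)
  show False
  proof (cases "M\<^sub>1 \<le> M")
    case True
    from minimal_time_le[OF large[OF this] t(4)] show False using M(2) t by (metis ereal_less_eq(3) not_le)
  next
    case False
    \<comment> \<open>The infimum need not be attained, but there are arrival times at or just above \<open>t\<^sub>2\<close>.\<close>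
    have "?T M < ereal t\<^sub>3" using M(2) t(3) by (metis less_ereal.simps(1))
    from minimal_time_less[OF this]
    obtain s where s: "0 \<le> s" "s < t\<^sub>3" "reaches \<Omega> \<omega> y0 Q M s" by (elim exE conjE)
    have "t\<^sub>2 \<le> s" using minimal_time_le[OF s(3,1)] M(2) by (metis ereal_less_eq(3))
    with gap[OF M(1) _ this] s False show False by auto
  qed
qed

lemma AE_lebesgue_on_subset:
  assumes "AE t in lebesgue_on I. P t" "J \<subseteq> I" "I \<in> sets lebesgue" "J \<in> sets lebesgue"
  shows "AE t in lebesgue_on J. P t"
proof -
  have "AE t in lebesgue. t \<in> I \<longrightarrow> P t"
    using assms(1,3) by (subst (asm) AE_restrict_space_iff) auto
  then have "AE t in lebesgue. t \<in> J \<longrightarrow> P t"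
    by eventually_elim (use assms(2) in auto)
  then show ?thesis using assms(4) by (subst AE_restrict_space_iff) auto
qed

lemma strongly_measurable_subset:
  assumes "strongly_measurable I \<Omega> u" "J \<subseteq> I" "I \<in> sets lebesgue" "J \<in> sets lebesgue"
  shows "strongly_measurable J \<Omega> u"
proof -
  obtain s where s: "\<forall>k::nat. simple_function (lebesgue_on I) (s k) \<and> (\<forall>t\<in>I. s k t \<in> L2 \<Omega>)"
    "AE t in lebesgue_on I. (\<lambda>k. L2_dist \<Omega> (s k t) (u t)) \<longlonglongrightarrow> 0"
    using assms(1) unfolding strongly_measurable_def by (elim conjE exE)
  have sf: "simple_function (lebesgue_on J) (s k)" for k
  proof -
    have k: "finite (s k ` I)" "\<And>z. z \<in> s k ` I \<Longrightarrow> s k -` {z} \<inter> I \<in> sets (lebesgue_on I)"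
      using s(1) assms(3) by (auto simp: simple_function_def)
    have "s k -` {z} \<inter> J \<in> sets (lebesgue_on J)" if "z \<in> s k ` J" for z
    proof -
      have "s k -` {z} \<inter> I \<in> sets lebesgue"
        using k(2)[of z] that assms(2,3) by (auto simp: sets_restrict_space_iff)
      then have "(s k -` {z} \<inter> I) \<inter> J \<in> sets lebesgue" using assms(4) by auto
      moreover have "(s k -` {z} \<inter> I) \<inter> J = s k -` {z} \<inter> J" using assms(2) by auto
      ultimately show ?thesis using assms(4) by (simp add: sets_restrict_space_iff)
    qed
    moreover have "finite (s k ` J)" using k(1) assms(2) by (meson finite_subset image_mono)
    ultimately show ?thesis using assms(4) by (simp add: simple_function_def)
  qed
  show ?thesis
    unfolding strongly_measurable_def
  proof (intro conjI exI[of _ s] allI ballI)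
    show "AE t in lebesgue_on J. (\<lambda>k. L2_dist \<Omega> (s k t) (u t)) \<longlonglongrightarrow> 0"
      by (rule AE_lebesgue_on_subset[OF s(2) assms(2-4)])
  qed (use assms(1,2) s(1) sf in \<open>auto simp: strongly_measurable_def\<close>)
qed

lemma mode_estimates:
  assumes \<omega>: "\<omega> \<in> sets lebesgue" and e: "eigenpair \<Omega> e\<^sub>1 \<gamma>\<^sub>1 \<mu>\<^sub>1" "eigenpair \<Omega> e\<^sub>2 \<gamma>\<^sub>2 \<mu>\<^sub>2" "0 < \<mu>\<^sub>1" "\<mu>\<^sub>1 < \<mu>\<^sub>2"
    and y: "heat_solution \<Omega> \<omega> T (\<lambda>x. e\<^sub>1 x + e\<^sub>2 x) u y" and T: "T \<le> 3"
    and u: "strongly_measurable {0<..<T} \<Omega> u" "AE t in lebesgue_on {0<..<T}. L2_norm \<Omega> (u t) \<le> M" "0 \<le> M"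
    and t: "0 \<le> t" "t \<le> T"
  shows "\<bar>L2_inner \<Omega> (y t) e\<^sub>1 - exp (- \<mu>\<^sub>1 * t)\<bar> \<le> (9 * \<mu>\<^sub>2 + 3) * M"
    and "\<bar>L2_inner \<Omega> (y t) e\<^sub>2 - exp (- \<mu>\<^sub>2 * t)\<bar> \<le> (9 * \<mu>\<^sub>2 + 3) * M"
proof -
  have o: "L2_inner \<Omega> e\<^sub>1 e\<^sub>2 = 0" using eigenpair_orthogonal[OF e(1,2)] e(4) by simp
  have y0: "L2_inner \<Omega> (\<lambda>x. e\<^sub>1 x + e\<^sub>2 x) e\<^sub>1 = 1" "L2_inner \<Omega> (\<lambda>x. e\<^sub>1 x + e\<^sub>2 x) e\<^sub>2 = 1"
    using o eigenpairD[OF e(1)] eigenpairD[OF e(2)]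
    by (simp_all add: L2_inner_add_left L2_inner_commute[of \<Omega> e\<^sub>2 e\<^sub>1])
  have uL: "u t \<in> L2 \<Omega>" if "t \<in> {0<..<T}" for t using u(1) that by (simp add: strongly_measurable_def)
  have tT: "t \<in> {0..T}" using t by simp
  have t3: "t\<^sup>2 \<le> 9" "t \<le> 3" using t T power_mono[of t 3 2] by auto
  have c: "(\<mu> * t\<^sup>2 + t) * M \<le> (9 * \<mu>\<^sub>2 + 3) * M" if "0 < \<mu>" "\<mu> \<le> \<mu>\<^sub>2" for \<mu>
  proof -
    have "\<mu> * t\<^sup>2 \<le> \<mu>\<^sub>2 * 9" using that t3 by (intro mult_mono) auto
    then show ?thesis using t3 u(3) by (intro mult_right_mono) auto
  qed
  show "\<bar>L2_inner \<Omega> (y t) e\<^sub>1 - exp (- \<mu>\<^sub>1 * t)\<bar> \<le> (9 * \<mu>\<^sub>2 + 3) * M"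
    using heat_solution_mode_estimate[OF \<omega> e(1,3) y uL u(2,3) tT] c[of \<mu>\<^sub>1] e(3,4) by (simp add: y0)
  show "\<bar>L2_inner \<Omega> (y t) e\<^sub>2 - exp (- \<mu>\<^sub>2 * t)\<bar> \<le> (9 * \<mu>\<^sub>2 + 3) * M"
    using heat_solution_mode_estimate[OF \<omega> e(2) _ y uL u(2,3) tT] c[of \<mu>\<^sub>2] e(3,4) by (simp add: y0)
qed

text \<open>Here \<open>x = exp (- \<mu>\<^sub>1 * t)\<close> and \<open>z * x = exp (- \<mu>\<^sub>2 * t)\<close> are the coefficients of the free trajectory.
  Before time 1 the first one is too large.  From then on \<open>z \<le> \<rho>\<close>, while the edge of the wedge has the slope \<open>m = \<rho> + \<epsilon>\<close>, so the free
  trajectory runs below the edge as long as \<open>m * c < \<epsilon> * x\<close>; the choice of \<open>c\<close> guarantees this up to time 3.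
  From time 2 on even \<open>z \<le> \<rho>\<^sup>2\<close>, and the distance to the edge is bounded below by a quantity in which \<open>\<delta>\<close> does not occur.\<close>

lemma wedge_avoidance:
  fixes X Y :: real
  assumes \<mu>: "0 < \<mu>\<^sub>1" "\<mu>\<^sub>1 < \<mu>\<^sub>2" and t: "0 \<le> t" "t \<le> 3" and \<delta>: "0 < \<delta>"
    and q: "q = exp (- \<mu>\<^sub>1)" and \<rho>: "\<rho> = exp (- (\<mu>\<^sub>2 - \<mu>\<^sub>1))" and xs: "xs = exp (- \<mu>\<^sub>1 * 3)"
    and m: "m = \<rho> * (1 + \<delta> / q)" "m \<le> 2" and c: "c = \<rho> * \<delta> / q * xs / (2 * m)"
    and X: "\<bar>X - exp (- \<mu>\<^sub>1 * t)\<bar> \<le> h" and Y: "\<bar>Y - exp (- \<mu>\<^sub>2 * t)\<bar> \<le> h"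
  shows "h = 0 \<Longrightarrow> \<not> (X \<le> q - \<delta> \<and> m * (X - c) \<le> Y)"
    and "2 \<le> t \<Longrightarrow> 3 * h < \<rho> * (1 - \<rho>) * xs \<Longrightarrow> \<not> (X \<le> q - \<delta> \<and> m * (X - c) \<le> Y)"
proof -
  define x where "x = exp (- \<mu>\<^sub>1 * t)"
  define z where "z = exp (- (\<mu>\<^sub>2 - \<mu>\<^sub>1) * t)"
  have y: "exp (- \<mu>\<^sub>2 * t) = z * x"
    by (simp add: x_def z_def algebra_simps flip: exp_add)
  have pos: "0 < q" "0 < \<rho>" "\<rho> < 1" "0 < xs" "0 < x" using q \<rho> xs \<mu> by (auto simp: x_def)
  have m0: "0 < m" unfolding m(1) using pos \<delta> by (intro mult_pos_pos add_pos_pos) auto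
  have xsx: "xs \<le> x" unfolding xs x_def using t \<mu> by simp
  define \<epsilon> where "\<epsilon> = \<rho> * \<delta> / q"
  have \<epsilon>: "0 < \<epsilon>" using pos \<delta> by (simp add: \<epsilon>_def)
  have mc: "m * c = \<epsilon> * xs / 2" using m0 by (simp add: c \<epsilon>_def)
  have mx: "m * x = \<rho> * x + \<epsilon> * x" by (simp add: m(1) \<epsilon>_def algebra_simps)
  have eps: "\<epsilon> * xs \<le> \<epsilon> * x" using xsx \<epsilon> by (intro mult_left_mono) auto
  have eps0: "0 < \<epsilon> * xs" using pos \<epsilon> by simp
  show "\<not> (X \<le> q - \<delta> \<and> m * (X - c) \<le> Y)" if h: "h = 0"
  proof
    assume A: "X \<le> q - \<delta> \<and> m * (X - c) \<le> Y"
    have XY: "X = x" "Y = z * x" using X Y h unfolding y x_def[symmetric] by simp_all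
    show False
    proof (cases "t \<le> 1")
      case True
      then have "q \<le> x" unfolding q x_def using \<mu> by simp
      then show False using A XY \<delta> by simp
    next
      case False
      then have "z \<le> \<rho>" unfolding z_def \<rho> using \<mu> by simp
      then have "Y \<le> \<rho> * x" using XY pos by (simp add: mult_right_mono)
      moreover have "\<rho> * x < m * (x - c)"
        unfolding right_diff_distrib mc mx using eps eps0 by linarith
      ultimately show False using A XY by simp
    qed
  qed
  show "\<not> (X \<le> q - \<delta> \<and> m * (X - c) \<le> Y)" if t2: "2 \<le> t" and h: "3 * h < \<rho> * (1 - \<rho>) * xs"
  proof
    assume A: "X \<le> q - \<delta> \<and> m * (X - c) \<le> Y"
    have h0: "0 \<le> h" using X by linarith
    have "m * (x - h - c) \<le> m * (X - c)" using X m0 by (intro mult_left_mono) (auto simp: x_def)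
    also have "\<dots> \<le> z * x + h" using A Y unfolding y by linarith
    finally have "m * x - m * c \<le> z * x + h + m * h" by (simp add: algebra_simps)
    also have "m * h \<le> 2 * h" using m(2) h0 by (rule mult_right_mono)
    finally have 1: "m * x - m * c \<le> z * x + 3 * h" by simp
    have "z \<le> exp (- (\<mu>\<^sub>2 - \<mu>\<^sub>1) * 2)" unfolding z_def exp_le_cancel_iff mult_minus_left
      using mult_left_mono[OF t2, of "\<mu>\<^sub>2 - \<mu>\<^sub>1"] \<mu> by (simp only: neg_le_iff_le)
    also have "\<dots> = \<rho> * \<rho>" unfolding \<rho> by (simp flip: exp_add)
    finally have "z * x \<le> \<rho> * \<rho> * x" using pos by (intro mult_right_mono) auto
    have "\<rho> * (1 - \<rho>) * xs \<le> \<rho> * (1 - \<rho>) * x"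
      using xsx pos by (intro mult_left_mono) auto
    have "\<rho> * x \<le> m * x - m * c" unfolding mc mx using eps eps0 by linarith
    with 1 have "\<rho> * x \<le> \<rho> * \<rho> * x + 3 * h" using \<open>z * x \<le> \<rho> * \<rho> * x\<close> by simp
    then have "\<rho> * (1 - \<rho>) * x \<le> 3 * h" by (simp add: algebra_simps)
    with \<open>\<rho> * (1 - \<rho>) * xs \<le> \<rho> * (1 - \<rho>) * x\<close> h show False by simp
  qed
qed

theorem theorem3p1:
  fixes \<Omega> \<omega> :: "(real ^ 'n) set"
  assumes "open \<Omega>" and "connected \<Omega>" and "bounded \<Omega>" and "C2_boundary \<Omega>"
    and "open \<omega>" and "\<omega> \<noteq> {}" and "\<omega> \<subseteq> \<Omega>"
  shows "\<exists>Q\<in>targets \<Omega>. \<exists>y0\<in>L2 \<Omega> - Q.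
           \<not> antimono_on {0<..} (\<lambda>T. minimal_norm \<Omega> \<omega> T y0 Q) \<and>
           KN_set \<Omega> \<omega> y0 Q \<noteq> {} \<and>
           \<not> connected (GT_set \<Omega> \<omega> y0 Q)"
proof -
  note \<Omega> = \<open>bounded \<Omega>\<close> \<open>open \<Omega>\<close>
  from exist_signed_modes[OF \<Omega> \<open>open \<omega>\<close> \<open>\<omega> \<noteq> {}\<close> \<open>\<omega> \<subseteq> \<Omega>\<close>]
  obtain \<phi> e\<^sub>1 \<gamma>\<^sub>1 \<mu>\<^sub>1 e\<^sub>2 \<gamma>\<^sub>2 \<mu>\<^sub>2 where \<phi>: "test_function \<omega> \<phi>"
    and e: "eigenpair \<Omega> e\<^sub>1 \<gamma>\<^sub>1 \<mu>\<^sub>1" "eigenpair \<Omega> e\<^sub>2 \<gamma>\<^sub>2 \<mu>\<^sub>2"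
    and \<mu>: "0 < \<mu>\<^sub>1" "\<mu>\<^sub>1 < \<mu>\<^sub>2" and sgn: "L2_inner \<Omega> \<phi> e\<^sub>1 < 0" "0 \<le> L2_inner \<Omega> \<phi> e\<^sub>2"
    by (elim exE conjE)
  have \<omega>: "\<omega> \<in> sets lebesgue" using \<open>open \<omega>\<close> by auto
  \<comment> \<open>\<open>(q, \<rho> * q)\<close> is the position of the free trajectory at time 1, and \<open>xs\<close> its first coefficient at time 3.  The steering control that
    shifts the first coefficient by \<open>\<delta>\<close> at time 1 has size at most \<open>\<delta> * S\<close>; any control of size \<open>M\<close> shifts either coefficient by at most \<open>C * M\<close>
    up to time 3.\<close>
  define y0 where "y0 = (\<lambda>x. e\<^sub>1 x + e\<^sub>2 x)"
  define q where "q = exp (- \<mu>\<^sub>1)"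
  define \<rho> where "\<rho> = exp (- (\<mu>\<^sub>2 - \<mu>\<^sub>1))"
  define xs where "xs = exp (- \<mu>\<^sub>1 * 3)"
  define E where "E = 1 - exp (- 1 :: real)"
  define A where "A = - L2_inner \<Omega> \<phi> e\<^sub>1"
  define K where "K = L2_norm \<Omega> \<phi> + L2_norm \<Omega> (neg_laplacian \<phi>)"
  define S where "S = K / (E * A)"
  define C where "C = 9 * \<mu>\<^sub>2 + 3"
  have \<phi>L: "\<phi> \<in> L2 \<Omega>" by (rule test_function_L2[OF \<Omega> test_function_mono[OF \<phi> \<open>\<omega> \<subseteq> \<Omega>\<close>]])
  have eL: "e\<^sub>1 \<in> L2 \<Omega>" "e\<^sub>2 \<in> L2 \<Omega>" and en: "L2_norm \<Omega> e\<^sub>1 = 1" "L2_norm \<Omega> e\<^sub>2 = 1"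
    using eigenpairD[OF e(1)] eigenpairD[OF e(2)] by auto
  have pos: "0 < q" "q < 1" "0 < \<rho>" "\<rho> < 1" "0 < xs" "0 < E" "0 < A" "0 < C"
    using \<mu> sgn by (auto simp: q_def \<rho>_def xs_def E_def A_def C_def)
  have "A \<le> L2_norm \<Omega> \<phi>" using L2_Cauchy_Schwarz[OF \<phi>L eL(1)] en(1) sgn by (simp add: A_def)
  then have "0 < K" using pos(7) L2_norm_nonneg[of \<Omega> "neg_laplacian \<phi>"] by (simp add: K_def)
  then have S: "0 < S" using pos by (simp add: S_def)
  have half: "q < exp (- \<mu>\<^sub>1 / 2)" using \<mu> by (simp add: q_def)
  \<comment> \<open>The three bounds ensure, in this order, that the slope \<open>m\<close> is at most 2, that controls of size \<open>2 * M\<^sub>1\<close> cannot close the gap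
    between times 2 and 3, and that controls of size \<open>M\<^sub>1\<close> cannot arrive before time 1/2.\<close>
  define \<delta> where "\<delta> = min (q / 2) (min (\<rho> * (1 - \<rho>) * xs / (12 * C * S)) ((exp (- \<mu>\<^sub>1 / 2) - q) / (2 * C * S)))"
  have \<delta>: "0 < \<delta>" "\<delta> \<le> q / 2" "\<delta> \<le> \<rho> * (1 - \<rho>) * xs / (12 * C * S)" "\<delta> \<le> (exp (- \<mu>\<^sub>1 / 2) - q) / (2 * C * S)"
    using pos S half by (auto simp: \<delta>_def)
  define M\<^sub>1 where "M\<^sub>1 = \<delta> * S"
  define \<kappa> where "\<kappa> = \<delta> / (E * A)"
  have M1: "0 < M\<^sub>1" using \<delta> S by (simp add: M\<^sub>1_def)
  have \<kappa>: "0 \<le> \<kappa>" "\<kappa> * K = M\<^sub>1" "\<kappa> * E * A = \<delta>" using \<delta> pos by (auto simp: \<kappa>_def M\<^sub>1_def S_def)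
  have small1: "3 * (C * (2 * M\<^sub>1)) < \<rho> * (1 - \<rho>) * xs"
  proof -
    have "12 * C * S * \<delta> \<le> \<rho> * (1 - \<rho>) * xs" using \<delta>(3) pos S by (simp add: pos_le_divide_eq mult.commute)
    moreover have "0 < C * S * \<delta>" using pos S \<delta> by simp
    ultimately show ?thesis by (simp add: M\<^sub>1_def algebra_simps)
  qed
  have small2: "C * M\<^sub>1 < exp (- \<mu>\<^sub>1 / 2) - q + \<delta>"
  proof -
    have "2 * C * S * \<delta> \<le> exp (- \<mu>\<^sub>1 / 2) - q" using \<delta>(4) pos S by (simp add: pos_le_divide_eq mult.commute)
    moreover have "0 < C * S * \<delta>" using pos S \<delta> by simp
    ultimately show ?thesis using \<delta>(1) by (simp add: M\<^sub>1_def algebra_simps)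
  qed
  \<comment> \<open>The edge is steeper than \<open>\<rho>\<close>, so that the free trajectory can stay below it, yet flat enough for the wedge to contain
    \<open>(q - \<delta>, \<rho> * q)\<close>.  It meets the axis at \<open>c > 0\<close>, so that the free trajectory, which converges to the origin, enters the
    wedge eventually.\<close>
  define m where "m = \<rho> * (1 + \<delta> / q)"
  define c where "c = \<rho> * \<delta> / q * xs / (2 * m)"
  have "\<delta> / q \<le> 1" using \<delta>(1,2) pos by (simp add: pos_divide_le_eq)
  then have m2: "m \<le> 2" unfolding m_def using pos mult_mono[of \<rho> 1 "1 + \<delta> / q" 2] \<delta>(1) by simp
  have m0: "0 < m" unfolding m_def using pos \<delta> by (intro mult_pos_pos add_pos_pos) auto
  have c0: "0 < c" unfolding c_def using pos \<delta> m0 by simp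
  \<comment> \<open>A time by which the first coefficient has dropped below \<open>c\<close> and \<open>q - \<delta>\<close>.\<close>
  define T\<^sub>2 where "T\<^sub>2 = max 1 (- ln (min c (q - \<delta>)) / \<mu>\<^sub>1)"
  have T2: "0 < T\<^sub>2" "exp (- \<mu>\<^sub>1 * T\<^sub>2) \<le> min c (q - \<delta>)"
  proof -
    show "0 < T\<^sub>2" by (simp add: T\<^sub>2_def)
    have p: "0 < min c (q - \<delta>)" using c0 \<delta> pos by auto
    have "- ln (min c (q - \<delta>)) / \<mu>\<^sub>1 \<le> T\<^sub>2" by (simp add: T\<^sub>2_def)
    then have "(- ln (min c (q - \<delta>)) / \<mu>\<^sub>1) * \<mu>\<^sub>1 \<le> T\<^sub>2 * \<mu>\<^sub>1" using \<mu>(1) by (intro mult_right_mono) auto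
    then have "- ln (min c (q - \<delta>)) \<le> T\<^sub>2 * \<mu>\<^sub>1" using \<mu>(1) by simp
    then have "- \<mu>\<^sub>1 * T\<^sub>2 \<le> ln (min c (q - \<delta>))" by (simp add: mult.commute)
    then have "exp (- \<mu>\<^sub>1 * T\<^sub>2) \<le> exp (ln (min c (q - \<delta>)))" by (simp only: exp_le_cancel_iff)
    then show "exp (- \<mu>\<^sub>1 * T\<^sub>2) \<le> min c (q - \<delta>)" using p by (simp only: exp_ln)
  qed
  let ?y = "trajectory e\<^sub>1 e\<^sub>2 \<mu>\<^sub>1 \<mu>\<^sub>2 \<phi>"
  note traj = trajectory_coordinates[OF \<Omega> \<open>\<omega> \<subseteq> \<Omega>\<close> e \<mu>(2) \<phi>]
  \<comment> \<open>The radius only has to admit the two arrival points.\<close>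
  define B where "B = L2_norm \<Omega> (?y \<kappa> 1) + L2_norm \<Omega> (?y 0 T\<^sub>2) + 1"
  have B: "0 < B" "L2_norm \<Omega> (?y \<kappa> 1) \<le> B" "L2_norm \<Omega> (?y 0 T\<^sub>2) \<le> B"
    using L2_norm_nonneg[of \<Omega> "?y \<kappa> 1"] L2_norm_nonneg[of \<Omega> "?y 0 T\<^sub>2"] by (auto simp: B_def)
  define Q where "Q = {f \<in> L2 \<Omega>. L2_norm \<Omega> f \<le> B \<and> L2_inner \<Omega> f e\<^sub>1 \<le> q - \<delta> \<and>
      m * (L2_inner \<Omega> f e\<^sub>1 - c) \<le> L2_inner \<Omega> f e\<^sub>2}"
  have Q: "Q \<in> targets \<Omega>"
    unfolding Q_def by (rule wedge_in_targets[OF eL en _ m0 c0 B(1)]) (use \<delta> pos in simp)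
  have y0: "y0 \<in> L2 \<Omega> - Q"
  proof -
    have "L2_inner \<Omega> y0 e\<^sub>1 = 1"
      using eL eigenpairD(5)[OF e(1)] eigenpair_orthogonal[OF e(2,1)] \<mu>(2) by (simp add: y0_def L2_inner_add_left)
    then show ?thesis using pos(2) \<delta>(1) L2_add[OF eL] by (simp add: Q_def y0_def)
  qed

  have hit1: "?y \<kappa> 1 \<in> Q"
  proof -
    have X: "L2_inner \<Omega> (?y \<kappa> 1) e\<^sub>1 = q - \<delta>"
      using traj(2)[of \<kappa> 1] \<kappa>(3) by (simp add: q_def E_def[symmetric] A_def)
    have "exp (- \<mu>\<^sub>2) = \<rho> * q" by (simp add: \<rho>_def q_def flip: exp_add)
    then have Y: "\<rho> * q \<le> L2_inner \<Omega> (?y \<kappa> 1) e\<^sub>2"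
      using traj(3)[of \<kappa> 1] \<kappa>(1) pos(6) sgn(2) by (simp add: E_def[symmetric])
    have "m * (q - \<delta> - c) \<le> m * (q - \<delta>)" using m0 c0 by (intro mult_left_mono) auto
    also have "\<dots> = \<rho> * (q - \<delta> * \<delta> / q)" using pos(1) by (simp add: m_def field_simps)
    also have "\<dots> \<le> \<rho> * q" using pos by (intro mult_left_mono) auto
    finally show ?thesis using X Y B traj(1) by (simp add: Q_def)
  qed
  have hit2: "?y 0 T\<^sub>2 \<in> Q"
  proof -
    have X: "L2_inner \<Omega> (?y 0 T\<^sub>2) e\<^sub>1 \<le> min c (q - \<delta>)" using traj(2)[of 0 T\<^sub>2] T2(2) by simp
    have Y: "0 < L2_inner \<Omega> (?y 0 T\<^sub>2) e\<^sub>2" using traj(3)[of 0 T\<^sub>2] by simp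
    have "m * (L2_inner \<Omega> (?y 0 T\<^sub>2) e\<^sub>1 - c) \<le> 0" using X m0 by (intro mult_nonneg_nonpos) auto
    then show ?thesis using X Y B traj(1) by (simp add: Q_def)
  qed

  have sol: "heat_solution \<Omega> \<omega> T y0 (steering \<phi> k) (?y k)" for k T
    unfolding y0_def by (rule heat_solution_trajectory[OF \<Omega> \<open>\<omega> \<subseteq> \<Omega>\<close> e \<phi>])
  note steer = steering_admissible[OF \<Omega> \<open>\<omega> \<subseteq> \<Omega>\<close> \<phi>, folded K_def]
  have reach: "reaches \<Omega> \<omega> y0 Q M t" if "0 \<le> k" "k * K \<le> M" "?y k t \<in> Q" for k M t
  proof -
    have "AE t in lebesgue_on {0<..}. L2_norm \<Omega> (steering \<phi> k t) \<le> M"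
      using steer(2)[of "{0<..}" k] that(1,2) by (auto elim!: eventually_mono)
    then have "steering \<phi> k \<in> controls_bounded_by \<Omega> M"
      using steer(1)[of "{0<..}" k] that(1) by (simp add: controls_bounded_by_def)
    then show ?thesis using sol that(3) by (auto simp: reaches_def heat_solution_global_def)
  qed

  have norm_le: "minimal_norm \<Omega> \<omega> T y0 Q \<le> ereal (k * K)" if "0 \<le> k" "?y k T \<in> Q" for k T
  proof -
    have "minimal_norm \<Omega> \<omega> T y0 Q \<le> Linfty_norm {0<..<T} \<Omega> (steering \<phi> k)"
      unfolding minimal_norm_def
    proof (rule Inf_lower, rule CollectI, rule exI[of _ "steering \<phi> k"], intro conjI refl)
      show "steering \<phi> k \<in> Linfty_L2 {0<..<T} \<Omega>" by (rule steer(1)) (use that(1) in auto)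
      show "\<exists>y. heat_solution \<Omega> \<omega> T y0 (steering \<phi> k) y \<and> y T \<in> Q"
        using sol that(2) by (intro exI[of _ "?y k"] conjI)
    qed
    also have "\<dots> \<le> ereal (k * K)" by (rule steer(3)) (use that(1) in auto)
    finally show ?thesis .
  qed

  \<comment> \<open>The coefficients of a solution differ by at most \<open>C * M\<close> from those of the free trajectory.  The first two cases are
    \<open>wedge_avoidance\<close>; in the third the first coefficient is still too large.\<close>
  have miss: "L2_inner \<Omega> (y t) e\<^sub>1 \<le> q - \<delta> \<and> m * (L2_inner \<Omega> (y t) e\<^sub>1 - c) \<le> L2_inner \<Omega> (y t) e\<^sub>2 \<longrightarrow>
      \<not> (M = 0 \<or> M \<le> 2 * M\<^sub>1 \<and> 2 \<le> t \<or> M \<le> M\<^sub>1 \<and> t < 1 / 2)"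
    if "heat_solution \<Omega> \<omega> T y0 u y" "T \<le> 3" "strongly_measurable {0<..<T} \<Omega> u"
      "AE t in lebesgue_on {0<..<T}. L2_norm \<Omega> (u t) \<le> M" "0 \<le> M" "0 \<le> t" "t \<le> T" for T u y M t
  proof -
    note est = mode_estimates[OF \<omega> e \<mu> that(1)[unfolded y0_def] that(2-7), folded C_def]
    have t3: "t \<le> 3" using that by simp
    note avoid = wedge_avoidance[OF \<mu> that(6) t3 \<delta>(1) q_def \<rho>_def xs_def m_def m2 c_def est]
    have "C * M \<le> C * (2 * M\<^sub>1)" if "M \<le> 2 * M\<^sub>1" using that pos(8) by (intro mult_left_mono) auto
    then have "3 * (C * M) < \<rho> * (1 - \<rho>) * xs" if "M \<le> 2 * M\<^sub>1" using that small1 by simp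
    moreover have "q - \<delta> < L2_inner \<Omega> (y t) e\<^sub>1" if "M \<le> M\<^sub>1" "t < 1 / 2"
    proof -
      have "C * M \<le> C * M\<^sub>1" using that pos(8) by (intro mult_left_mono) auto
      moreover have "exp (- \<mu>\<^sub>1 / 2) \<le> exp (- \<mu>\<^sub>1 * t)" using that \<mu>(1) by simp
      ultimately show ?thesis using est(1) small2 by linarith
    qed
    ultimately show ?thesis using avoid by fastforce
  qed
  have miss_global: "\<not> (M = 0 \<or> M \<le> 2 * M\<^sub>1 \<and> 2 \<le> t \<or> M \<le> M\<^sub>1 \<and> t < 1 / 2)"
    if r: "reaches \<Omega> \<omega> y0 Q M t" and M: "0 \<le> M" and t: "0 \<le> t" "t \<le> 3" for M t
  proof -
    obtain u y where u: "u \<in> controls_bounded_by \<Omega> M" and y: "heat_solution_global \<Omega> \<omega> y0 u y" "y t \<in> Q"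
      using r unfolding reaches_def by blast
    have sm: "strongly_measurable {0<..} \<Omega> u" and ae: "AE t in lebesgue_on {0<..}. L2_norm \<Omega> (u t) \<le> M"
      using u by (auto simp: controls_bounded_by_def Linfty_L2_def)
    have "heat_solution \<Omega> \<omega> 3 y0 u y" using y(1) by (simp add: heat_solution_global_def)
    moreover have "strongly_measurable {0<..<3} \<Omega> u"
      by (rule strongly_measurable_subset[OF sm]) auto
    moreover have "AE t in lebesgue_on {0<..<3}. L2_norm \<Omega> (u t) \<le> M"
      by (rule AE_lebesgue_on_subset[OF ae]) auto
    ultimately show ?thesis
      using miss[of 3 u y M t] M t y(2) by (simp add: Q_def)
  qed

  have "\<not> antimono_on {0<..} (\<lambda>T. minimal_norm \<Omega> \<omega> T y0 Q)"
  proof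
    assume "antimono_on {0<..} (\<lambda>T. minimal_norm \<Omega> \<omega> T y0 Q)"
    then have "minimal_norm \<Omega> \<omega> 2 y0 Q \<le> minimal_norm \<Omega> \<omega> 1 y0 Q"
      by (rule monotone_onD) auto
    also have "\<dots> \<le> ereal M\<^sub>1" using norm_le[OF \<kappa>(1) hit1] \<kappa>(2) by simp
    also have "\<dots> < ereal (2 * M\<^sub>1)" using M1 by simp
    finally have "minimal_norm \<Omega> \<omega> 2 y0 Q < ereal (2 * M\<^sub>1)" .
    then obtain v y where v: "v \<in> Linfty_L2 {0<..<2} \<Omega>" "Linfty_norm {0<..<2} \<Omega> v < ereal (2 * M\<^sub>1)"
      "heat_solution \<Omega> \<omega> 2 y0 v y" "y 2 \<in> Q"
      unfolding minimal_norm_def Inf_less_iff by blast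
    from miss[OF v(3) _ _ Linfty_norm_less_imp_AE[OF v(2)], of 2] v(1,4) M1
    show False by (simp add: Q_def Linfty_L2_def)
  qed
  moreover have "KN_set \<Omega> \<omega> y0 Q \<noteq> {}"
  proof -
    have "minimal_norm \<Omega> \<omega> T\<^sub>2 y0 Q \<le> 0" using norm_le[OF order_refl hit2] by (simp add: zero_ereal_def)
    moreover have "0 \<le> minimal_norm \<Omega> \<omega> T\<^sub>2 y0 Q"
      unfolding minimal_norm_def by (rule Inf_greatest) (use Linfty_norm_nonneg[OF T2(1)] in auto)
    ultimately have "(0, T\<^sub>2) \<in> KN_set \<Omega> \<omega> y0 Q" using T2(1) by (simp add: KN_set_def)
    then show ?thesis by blast
  qed
  moreover have "\<not> connected (GT_set \<Omega> \<omega> y0 Q)"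
  proof (rule GT_set_not_connected[where M\<^sub>1 = M\<^sub>1 and t\<^sub>0 = "1 / 2" and t\<^sub>1 = 1 and t\<^sub>2 = 2 and t\<^sub>3 = 3 and t\<^sub>4 = T\<^sub>2])
    show "reaches \<Omega> \<omega> y0 Q M 1" if "M\<^sub>1 \<le> M" for M by (rule reach[OF \<kappa>(1) _ hit1]) (use \<kappa>(2) that in simp)
    show "reaches \<Omega> \<omega> y0 Q 0 T\<^sub>2" by (rule reach[OF order_refl _ hit2]) simp
    show "3 \<le> t" if "0 \<le> t" "reaches \<Omega> \<omega> y0 Q 0 t" for t
      using miss_global[OF that(2) order_refl that(1)] by force
    show "1 / 2 \<le> t" if "0 \<le> t" "reaches \<Omega> \<omega> y0 Q M\<^sub>1 t" for t
      using miss_global[OF that(2) less_imp_le[OF M1] that(1)] by force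
    show "\<not> reaches \<Omega> \<omega> y0 Q M t" if "0 \<le> M" "M \<le> M\<^sub>1" "2 \<le> t" "t \<le> 3" for M t
      using miss_global[of M t] that M1 by force
  qed (use M1 T2 in auto)
  ultimately show ?thesis using Q y0 by blast
qed

end
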